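(* Let $d\ge3$, $\phi>0$, $\epsilon\in(0,1]$, and let $\Sigma$ be a $d\times d$ symmetric positive definite matrix with unit diagonal entries; let $\sigma_*>0$ be the square root of the smallest eigenvalue of $\Sigma$. Let $v\in\mathbb Z$ and $K\in\mathbb R$ be such that $v\ge1$ and $K>0$. Set $\eta=\eta_d=K/\sqrt{\log d}$. Then $$\sup_{A\in\mathcal R}\sup_{w\in\mathbb R^d}\sum_{j_{1},\dots,j_{v}=1}^{d}\ \sup_{y\in R(0,\epsilon\sigma_*\eta)}|\partial_{j_{1},\dots,j_{v}}\rho^{A,\phi,\epsilon,\Sigma}(w+y)|\leq C\frac{\phi(\log d)^{(v-1)/2}}{(\epsilon\sigma_* )^{v-1}},$$ where $C>0$ is a constant depending only on $v$ and $K$.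
   Context: $\mathcal R$ is the class of rectangles $A=\prod_{j=1}^d(a_j,b_j]$ in $\mathbb R^d$ with $-\infty\le a_j\le b_j\le\infty$. $R(0,t):=\{y\in\mathbb R^d:\|y\|_\infty\le t\}$, with $\|y\|_\infty=\max_j|y_j|$. $\partial_{j_1,\dots,j_v}$ denotes the $v$-th order partial derivative with respect to coordinates $j_1,\dots,j_v$. The function $g^\phi:\mathbb R\to\mathbb R$ is given by $g^\phi(t)=1$ for $t\le0$, $g^\phi(t)=1-\phi t$ for $0<t<1/\phi$, and $g^\phi(t)=0$ for $t\ge1/\phi$. For $A=\prod_{j=1}^d(a_j,b_j]\in\mathcal R$, $$m^{A,\phi}(w):=g^\phi\Big(\max_{1\le j\le d}[(w_j-b_j)\vee(a_j-w_j)]\Big),\qquad \rho^{A,\phi,\epsilon,\Sigma}(w):=\mathrm E\, m^{A,\phi}(w+\epsilon Z),\quad w\in\mathbb R^d,$$ where $Z\sim N(0,\Sigma)$ in $\mathbb R^d$. *)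

theory Defs
  imports
    "HOL-Probability.Probability"
    "Jordan_Normal_Form.Spectral_Radius"
    "Jordan_Normal_Form.Gauss_Jordan_Elimination"
begin

text \<open>
  The constant of the theorem is uniform in the dimension \<open>d\<close>, so \<open>d\<close> has to be a
  natural number quantified inside the statement. Vectors and matrices are therefore those
  of \<open>Jordan_Normal_Form\<close> (\<open>carrier_vec d\<close>, \<open>carrier_mat d d\<close>), with coordinates
  numbered \<open>0, \<dots>, d - 1\<close>.
\<close>

unbundle no vec_syntax and no inner_syntax

definition symmetric_pos_def :: "nat \<Rightarrow> real mat \<Rightarrow> bool" where
  "symmetric_pos_def d S \<longleftrightarrow>
     S \<in> carrier_mat d d \<and> transpose_mat S = S \<and>
     (\<forall>x\<in>carrier_vec d. x \<noteq> 0\<^sub>v d \<longrightarrow> 0 < x \<bullet> (S *\<^sub>v x))"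

definition sigma_star :: "real mat \<Rightarrow> real" where
  "sigma_star S = sqrt (Min (spectrum S))"

text \<open>
  The centred normal law \<open>N(0, S)\<close> for positive definite \<open>S\<close>, given by its Lebesgue density.
  \<open>Matrix.vec\<close> carries no measurable structure, so the law lives on the product
  space of coordinate functions \<open>z\<close>, and \<open>Matrix.vec d z\<close> is the corresponding random vector.
  For positive definite \<open>S\<close> the matrix \<open>the (mat_inverse S)\<close> is the inverse of \<open>S\<close>.
\<close>

definition mvn_density :: "real mat \<Rightarrow> real Matrix.vec \<Rightarrow> real" where
  "mvn_density S x =
     exp (- (x \<bullet> (the (mat_inverse S) *\<^sub>v x)) / 2)
       / sqrt ((2 * pi) ^ dim_row S * Determinant.det S)"

definition mvn :: "real mat \<Rightarrow> (nat \<Rightarrow> real) measure" where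
  "mvn S = density (\<Pi>\<^sub>M i\<in>{..<dim_row S}. lborel)
             (\<lambda>z. ennreal (mvn_density S (Matrix.vec (dim_row S) z)))"

text \<open>
  A rectangle \<open>\<Prod>\<^sub>j (a\<^sub>j, b\<^sub>j]\<close> is given by its pair \<open>(a, b)\<close> of endpoint vectors.
  For a nonempty rectangle the endpoints are determined by the set; for an empty one the
  function \<open>mrect\<close> below depends on the chosen endpoints, and all choices are included.
\<close>

type_synonym rectangle = "ereal Matrix.vec \<times> ereal Matrix.vec"

definition rectangles :: "nat \<Rightarrow> rectangle set" where
  "rectangles d =
     {(a, b). a \<in> carrier_vec d \<and> b \<in> carrier_vec d \<and> (\<forall>j<d. a $ j \<le> b $ j)}"

text \<open>
  With infinite endpoints the maximum in the definition of \<open>mrect\<close> may be infinite;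
  \<open>gphi\<close> is therefore extended to \<open>ereal\<close> by its limits: \<open>1\<close> at \<open>-\<infinity>\<close> and \<open>0\<close> at \<open>\<infinity>\<close>.
\<close>

definition gphi :: "real \<Rightarrow> ereal \<Rightarrow> real" where
  "gphi \<phi> t = (if t \<le> 0 then 1 else if t < ereal (1 / \<phi>) then 1 - \<phi> * real_of_ereal t else 0)"

definition mrect :: "rectangle \<Rightarrow> real \<Rightarrow> real Matrix.vec \<Rightarrow> real" where
  "mrect A \<phi> w =
     (case A of (a, b) \<Rightarrow>
        gphi \<phi> (Max ((\<lambda>j. max (ereal (w $ j) - b $ j) (a $ j - ereal (w $ j))) ` {..<dim_vec w})))"

definition rho :: "rectangle \<Rightarrow> real \<Rightarrow> real \<Rightarrow> real mat \<Rightarrow> real Matrix.vec \<Rightarrow> real" where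
  "rho A \<phi> \<epsilon> S w = (\<integral>z. mrect A \<phi> (w + \<epsilon> \<cdot>\<^sub>v Matrix.vec (dim_row S) z) \<partial>mvn S)"

definition sup_ball :: "nat \<Rightarrow> real \<Rightarrow> real Matrix.vec set" where
  "sup_ball d t = {y \<in> carrier_vec d. Max ((\<lambda>j. \<bar>y $ j\<bar>) ` {..<d}) \<le> t}"

definition partial_deriv ::
    "nat \<Rightarrow> (real Matrix.vec \<Rightarrow> real) \<Rightarrow> real Matrix.vec \<Rightarrow> real" where
  "partial_deriv j f w = deriv (\<lambda>t. f (w + t \<cdot>\<^sub>v unit_vec (dim_vec w) j)) 0"

text \<open>
  \<open>deriv\<close> is an unspecified number where the derivative does not exist. The function \<open>rho\<close> is
  smooth, so the order of differentiation is immaterial.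
\<close>

fun partial_derivs ::
    "nat list \<Rightarrow> (real Matrix.vec \<Rightarrow> real) \<Rightarrow> real Matrix.vec \<Rightarrow> real" where
  "partial_derivs [] f = f"
| "partial_derivs (j # js) f = partial_deriv j (partial_derivs js f)"

definition multi_indices :: "nat \<Rightarrow> nat \<Rightarrow> nat list set" where
  "multi_indices d v = {js. length js = v \<and> set js \<subseteq> {..<d}}"

end

theory Submission
  imports Defs
begin

text \<open>
  The bound rests on two ideas: splitting off independent noise, and trading one derivative
  for the integration in the layer-cake representation of \<open>mrect\<close>, which is what produces
  the factor \<open>\<phi>\<close> and the exponent \<open>v - 1\<close> in place of \<open>v\<close>.

  Splitting. With \<open>\<tau> = sigma_star S / 2\<close> the law \<open>N(0, S)\<close> is a mixture over a random centre \<open>u\<close>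
  of the laws \<open>N(u, \<tau>\<^sup>2 I)\<close>, because \<open>S - \<tau>\<^sup>2 I\<close> is positive definite
  (\<open>mvn_density_mixture\<close>). Also \<open>gphi \<phi> x\<close> is the probability that \<open>x \<le> t\<close> for \<open>t\<close> uniform on
  \<open>[0, 1 / \<phi>]\<close>, so \<open>mrect A \<phi>\<close> is an average of indicators of the rectangle enlarged by \<open>t\<close>
  on every side. Given \<open>u\<close> and \<open>t\<close> the coordinates are independent, hence
  \<open>rho A \<phi> \<epsilon> S w = E (\<Prod>\<^sub>j F\<^sub>j (w\<^sub>j + \<epsilon> u\<^sub>j, t))\<close> where
  \<open>F\<^sub>j (x, t) = P (a\<^sub>j - t \<le> x + s Z \<le> b\<^sub>j + t)\<close> and \<open>s = \<epsilon> \<tau>\<close>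
  with \<open>Z\<close> standard normal (\<open>nn_integral_mrect_mvn\<close>). Each partial derivative moves inside and
  acts on the factors separately (\<open>partial_derivs_integral_prod\<close>).

  Bounding. Put \<open>L = sqrt (ln d)\<close> and let \<open>\<Psi>\<close> be the standard normal tail. Write \<open>G\<close> for the sum
  over the \<open>2 d\<close> ends of the sides of the standard normal density at the distance (in units
  of \<open>s\<close>) to that end, and \<open>M\<close> for the same sum with \<open>\<Psi>\<close>, that is, \<open>M = \<Sum>\<^sub>j (1 - F\<^sub>j)\<close>. For
  distances up to a multiple of \<open>L\<close> a further derivative of \<open>F\<^sub>j\<close> costs a factor \<open>L / s\<close>, a shift
  by \<open>K s / L\<close> costs a constant, and the Mills ratio bounds the density by a multiple of
  \<open>L\<close> times \<open>\<Psi>\<close>. Larger distances contribute errors of order \<open>1 / d\<close> each, which add up to a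
  constant. Since \<open>\<Prod>\<^sub>j F\<^sub>j \<le> exp (- M)\<close>, summing over all multi-indices gives at most a constant
  times \<open>s\<^sup>-\<^sup>v G (L + G)\<^sup>v\<^sup>-\<^sup>1 exp (- c M)\<close>. Here \<open>G \<le> C L (M + 1)\<close>, and the powers of \<open>M\<close> are absorbed by
  the exponential, so what remains is \<open>s\<^sup>-\<^sup>v L\<^sup>v\<^sup>-\<^sup>1 G exp (- c M / 2)\<close>. The last factor \<open>G\<close> must not be
  estimated: \<open>- G / s\<close> is the derivative of \<open>M\<close> in \<open>t\<close>, so the integral of \<open>G exp (- c M / 2)\<close> over
  \<open>t\<close> is at most a constant times \<open>s\<close> (\<open>nn_integral_total_envelope_le\<close>), while \<open>t\<close> has density \<open>\<phi>\<close>.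
  This yields \<open>\<phi> L\<^sup>v\<^sup>-\<^sup>1 / s\<^sup>v\<^sup>-\<^sup>1\<close>.

  For each multi-index the bound of the integrand is the same for all shifts \<open>y\<close>, so the
  supremum over \<open>y\<close> inside the sum costs nothing.
\<close>

section \<open>The Gaussian tail and its derivatives\<close>

definition \<Psi> :: "real \<Rightarrow> real" where
  "\<Psi> x = measure (density lborel std_normal_density) {x<..}"

lemma prob_space_std_normal: "prob_space (density lborel std_normal_density)"
  by (rule prob_space_normal_density) simp

lemma Psi_nonneg: "0 \<le> \<Psi> x"
  unfolding \<Psi>_def by simp

lemma Psi_le_1: "\<Psi> x \<le> 1"
  unfolding \<Psi>_def using prob_space.prob_le_1[OF prob_space_std_normal] by simp

lemma ennreal_Psi: "ennreal (\<Psi> x) = (\<integral>\<^sup>+z. ennreal (std_normal_density z) * indicator {x<..} z \<partial>lborel)"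
proof -
  interpret prob_space "density lborel std_normal_density" by (rule prob_space_std_normal)
  have "ennreal (\<Psi> x) = emeasure (density lborel std_normal_density) {x<..}"
    unfolding \<Psi>_def by (simp add: emeasure_eq_measure)
  also have "\<dots> = (\<integral>\<^sup>+z. ennreal (std_normal_density z) * indicator {x<..} z \<partial>lborel)"
    by (subst emeasure_density) auto
  finally show ?thesis .
qed

lemma std_normal_density_le: "std_normal_density x \<le> exp (- x\<^sup>2 / 2)"
proof -
  have "1 / sqrt (2 * pi) \<le> 1" using pi_gt3 by (simp add: real_le_rsqrt)
  then show ?thesis unfolding std_normal_density_def
    by (metis exp_ge_zero mult_left_le_one_le mult_right_mono mult_1)
qed

lemma std_normal_density_mono: "\<bar>x\<bar> \<le> \<bar>y\<bar> \<Longrightarrow> std_normal_density y \<le> std_normal_density x"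
  unfolding std_normal_density_def
  by (intro mult_left_mono) (auto simp: abs_le_square_iff)

lemma has_field_derivative_std_normal_density:
  "(std_normal_density has_field_derivative (- x * std_normal_density x)) (at x)"
proof -
  have "((\<lambda>x. 1 / sqrt (2 * pi) * exp (- x\<^sup>2 / 2)) has_field_derivative
      (- x * std_normal_density x)) (at x)"
    unfolding std_normal_density_def by (auto intro!: derivative_eq_intros simp: field_simps)
  then show ?thesis by (simp add: std_normal_density_def[abs_def])
qed

lemma nn_integral_gaussian_line:
  assumes "0 < c"
  shows "(\<integral>\<^sup>+t. ennreal (exp (- (c * (t - m)\<^sup>2) / 2)) \<partial>lborel) = ennreal (sqrt (2 * pi / c))"
proof -
  define \<sigma> where "\<sigma> = 1 / sqrt c"
  have \<sigma>: "0 < \<sigma>" "\<sigma>\<^sup>2 = 1 / c" using assms by (auto simp: \<sigma>_def power_divide)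
  have "exp (- (c * (t - m)\<^sup>2) / 2) = sqrt (2 * pi / c) * normal_density m \<sigma> t" for t
    using assms by (simp add: normal_density_def \<sigma>)
  then have "(\<integral>\<^sup>+t. ennreal (exp (- (c * (t - m)\<^sup>2) / 2)) \<partial>lborel) =
     (\<integral>\<^sup>+t. ennreal (sqrt (2 * pi / c)) * ennreal (normal_density m \<sigma> t) \<partial>lborel)"
    using assms by (simp add: ennreal_mult')
  also have "\<dots> = ennreal (sqrt (2 * pi / c)) * emeasure (density lborel (normal_density m \<sigma>)) UNIV"
    by (simp add: nn_integral_cmult emeasure_density)
  also have "emeasure (density lborel (normal_density m \<sigma>)) UNIV = 1"
    using prob_space.emeasure_space_1[OF prob_space_normal_density[OF \<sigma>(1)], of m] by simp
  finally show ?thesis by simp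
qed

lemma Psi_diff:
  assumes "x \<le> y"
  shows "ennreal (\<Psi> x - \<Psi> y) = (\<integral>\<^sup>+z. ennreal (std_normal_density z) * indicator {x..y} z \<partial>lborel)"
proof -
  interpret prob_space "density lborel std_normal_density" by (rule prob_space_std_normal)
  have "\<Psi> x = \<Psi> y + measure (density lborel std_normal_density) {x<..y}"
    unfolding \<Psi>_def using assms 
    by (subst finite_measure_Union[symmetric]) (auto intro!: arg_cong2[where f = measure])
  then have "ennreal (\<Psi> x - \<Psi> y) = emeasure (density lborel std_normal_density) {x<..y}"
    by (simp add: emeasure_eq_measure)
  also have "\<dots> = (\<integral>\<^sup>+z. ennreal (std_normal_density z) * indicator {x<..y} z \<partial>lborel)"
    by (subst emeasure_density) auto
  also have "\<dots> = (\<integral>\<^sup>+z. ennreal (std_normal_density z) * indicator {x..y} z \<partial>lborel)"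
    by (intro nn_integral_cong_AE, use AE_lborel_singleton[of x] in eventually_elim)
       (auto simp: indicator_def)
  finally show ?thesis .
qed

lemma Psi_diff_integral:
  assumes "x \<le> y"
  shows "\<Psi> x - \<Psi> y = integral {x..y} std_normal_density"
proof -
  have i: "std_normal_density integrable_on {x..y}"
    by (intro integrable_continuous_interval
      DERIV_continuous_on[OF has_field_derivative_at_within[OF has_field_derivative_std_normal_density]])
  have "(\<integral>\<^sup>+z. ennreal (std_normal_density z) * indicator {x..y} z \<partial>lborel) = 
     ennreal (integral {x..y} std_normal_density)"
    by (rule nn_integral_has_integral_lebesgue') (auto intro: integrable_integral[OF i])
  then have "ennreal (\<Psi> x - \<Psi> y) = ennreal (integral {x..y} std_normal_density)"
    using Psi_diff[OF assms] by simp
  moreover have "0 \<le> integral {x..y} std_normal_density" by (rule integral_nonneg[OF i]) simp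
  moreover have "\<Psi> y \<le> \<Psi> x"
    unfolding \<Psi>_def using assms
    by (intro finite_measure.finite_measure_mono prob_space.finite_measure prob_space_std_normal) auto
  ultimately show ?thesis by simp
qed

lemma DERIV_Psi: "(\<Psi> has_field_derivative (- std_normal_density x)) (at x)"
proof -
  have "((\<lambda>u. integral {x - 1..u} std_normal_density) has_field_derivative std_normal_density x) (at x within {x - 1..x + 1})"
    by (rule integral_has_real_derivative) (auto intro!: DERIV_continuous_on
      has_field_derivative_at_within[OF has_field_derivative_std_normal_density])
  then have "((\<lambda>u. integral {x - 1..u} std_normal_density) has_field_derivative std_normal_density x) (at x)"
    by (subst (asm) at_within_interior) auto
  then have *: "((\<lambda>u. \<Psi> (x - 1) - integral {x - 1..u} std_normal_density) has_field_derivative - std_normal_density x) (at x)"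
    by (auto intro!: derivative_eq_intros)
  show ?thesis
    by (rule has_field_derivative_transform_within_open[OF *, of "{x - 1<..}"])
       (auto simp: Psi_diff_integral[symmetric])
qed

lemma Psi_antimono: "x \<le> y \<Longrightarrow> \<Psi> y \<le> \<Psi> x"
proof (rule DERIV_nonpos_imp_nonincreasing[where f = \<Psi>])
  fix u
  show "\<exists>y. (\<Psi> has_real_derivative y) (at u) \<and> y \<le> 0"
    using DERIV_Psi[of u] by (intro exI[of _ "- std_normal_density u"]) simp
qed


lemma nn_integral_std_normal: "(\<integral>\<^sup>+z. ennreal (std_normal_density z) \<partial>lborel) = 1"
  using prob_space.emeasure_space_1[OF prob_space_std_normal] by (simp add: emeasure_density)

lemma Psi_minus: "\<Psi> (- x) = 1 - \<Psi> x"
proof -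
  have "ennreal (\<Psi> (- x)) = (\<integral>\<^sup>+z. ennreal (std_normal_density z) * indicator {..<x} z \<partial>lborel)"
    unfolding ennreal_Psi
    by (subst nn_integral_real_affine[where c = "-1" and t = 0])
       (auto simp: indicator_def std_normal_density_def intro!: nn_integral_cong)
  then have "ennreal (\<Psi> x) + ennreal (\<Psi> (- x)) =
    (\<integral>\<^sup>+z. ennreal (std_normal_density z) * indicator {x<..} z + 
      ennreal (std_normal_density z) * indicator {..<x} z \<partial>lborel)"
    by (subst nn_integral_add) (auto simp: ennreal_Psi)
  also have "\<dots> = (\<integral>\<^sup>+z. ennreal (std_normal_density z) \<partial>lborel)"
    by (intro nn_integral_cong_AE, use AE_lborel_singleton[of x] in eventually_elim)
       (auto simp: indicator_def)
  finally have "ennreal (\<Psi> x + \<Psi> (- x)) = ennreal 1"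
    by (simp add: nn_integral_std_normal ennreal_plus Psi_nonneg)
  then show ?thesis by (subst (asm) ennreal_inj) (auto simp: Psi_nonneg)
qed

text \<open>
  Each end of the interval may be absent, which accounts for the infinite endpoints of a
  rectangle. The tail beyond the left end \<open>l\<close> is written \<open>\<Psi> (- l)\<close>, so that both ends enter
  in the same way.
\<close>
lemma std_normal_mass_interval:
  assumes "p \<Longrightarrow> q \<Longrightarrow> l \<le> r"
  shows "(\<integral>\<^sup>+z. ennreal (std_normal_density z) * of_bool ((p \<longrightarrow> z \<le> r) \<and> (q \<longrightarrow> l \<le> z)) \<partial>lborel)
    = ennreal (1 - of_bool p * \<Psi> r - of_bool q * \<Psi> (- l))"
proof -
  have up: "(\<integral>\<^sup>+z. ennreal (std_normal_density z) * of_bool (l \<le> z) \<partial>lborel) = ennreal (\<Psi> l)" for l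
    unfolding ennreal_Psi
    by (intro nn_integral_cong_AE, use AE_lborel_singleton[of l] in eventually_elim)
       (auto simp: indicator_def)
  have down: "(\<integral>\<^sup>+z. ennreal (std_normal_density z) * of_bool (z \<le> r) \<partial>lborel) = ennreal (\<Psi> (- r))"
    unfolding up[symmetric]
    by (subst nn_integral_real_affine[where c = "-1" and t = 0])
       (auto simp: std_normal_density_def intro!: nn_integral_cong)
  have both: "(\<integral>\<^sup>+z. ennreal (std_normal_density z) * of_bool (z \<le> r \<and> l \<le> z) \<partial>lborel) = ennreal (\<Psi> l - \<Psi> r)"
    if "l \<le> r" unfolding Psi_diff[OF that]
    by (auto intro!: nn_integral_cong simp: indicator_def)
  show ?thesis
    using assms up[of l] down both nn_integral_std_normal by (cases p; cases q) (auto simp: Psi_minus)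
qed

lemma std_normal_density_shift:
  "std_normal_density (x + h) = std_normal_density x * exp (- x * h - h\<^sup>2 / 2)"
  by (simp add: std_normal_density_def power2_sum mult_exp_exp field_simps flip: exp_add)

text \<open>
  After the substitution \<open>z = x + u\<close> the density at \<open>x + u\<close> is at most \<open>exp (- x\<^sup>2 / 2)\<close> times the
  density at \<open>u\<close>, since \<open>x u \<ge> 0\<close>.
\<close>
lemma Psi_le_exp: assumes "0 \<le> x" shows "\<Psi> x \<le> exp (- x\<^sup>2 / 2)"
proof -
  have "ennreal (\<Psi> x) = (\<integral>\<^sup>+z. ennreal (std_normal_density (x + z)) * indicator {0<..} z \<partial>lborel)"
    unfolding ennreal_Psi
    by (subst nn_integral_real_affine[where c = 1 and t = x])
       (auto simp: indicator_def intro!: nn_integral_cong)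
  also have "\<dots> \<le> (\<integral>\<^sup>+z. ennreal (exp (- x\<^sup>2 / 2)) * ennreal (std_normal_density z) \<partial>lborel)"
  proof (intro nn_integral_mono)
    fix z :: real
    have "std_normal_density (x + z) \<le> exp (- x\<^sup>2 / 2) * std_normal_density z" if "0 < z"
    proof -
      have "std_normal_density (z + x) = std_normal_density z * exp (- z * x - x\<^sup>2 / 2)"
        by (rule std_normal_density_shift)
      also have "\<dots> \<le> std_normal_density z * exp (- x\<^sup>2 / 2)"
        using assms that by (intro mult_left_mono) auto
      finally show ?thesis by (simp add: ac_simps)
    qed
    then show "ennreal (std_normal_density (x + z)) * indicator {0<..} z \<le> ennreal (exp (- x\<^sup>2 / 2)) * ennreal (std_normal_density z)"
      by (auto simp: indicator_def ennreal_mult'[symmetric] intro!: ennreal_leI)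
  qed
  also have "\<dots> = ennreal (exp (- x\<^sup>2 / 2))"
    by (subst nn_integral_cmult) (auto simp: nn_integral_std_normal)
  finally show ?thesis by simp
qed

lemma Psi_0: "\<Psi> 0 = 1 / 2"
  using Psi_minus[of 0] by simp

text \<open>
  A Mills ratio bound. For \<open>x \<ge> 0\<close> the mass of \<open>[x, x + \<delta>]\<close> with \<open>\<delta> = 1 / (1 + x)\<close> is enough: on this
  interval the density loses at most the factor \<open>exp (3 / 2)\<close>, because \<open>x \<delta> + \<delta>\<^sup>2 / 2 \<le> 3 / 2\<close>. For
  \<open>x < 0\<close> the tail is at least \<open>1 / 2\<close>.
\<close>
lemma mills:
  "std_normal_density x \<le> exp (3 / 2) * (1 + max 0 x) * \<Psi> x"
proof (cases "0 \<le> x")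
  case True
  define \<delta> where "\<delta> = 1 / (1 + x)"
  have d: "0 < \<delta>" "\<delta> \<le> 1" "x * \<delta> \<le> 1" using True by (auto simp: \<delta>_def field_simps)
  obtain \<xi> where \<xi>: "x < \<xi>" "\<xi> < x + \<delta>" "\<Psi> (x + \<delta>) - \<Psi> x = (x + \<delta> - x) * (- std_normal_density \<xi>)"
    using MVT2[of x "x + \<delta>" \<Psi> "\<lambda>x. - std_normal_density x"] DERIV_Psi d by auto
  have "std_normal_density x * exp (- 3 / 2) \<le> std_normal_density x * exp (- x * \<delta> - \<delta>\<^sup>2 / 2)"
    using d power_le_one[of \<delta> 2] by (intro mult_left_mono) auto
  also have "\<dots> = std_normal_density (x + \<delta>)" by (rule std_normal_density_shift[symmetric])
  also have "\<dots> \<le> std_normal_density \<xi>" using True \<xi> by (intro std_normal_density_mono) auto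
  finally have "\<delta> * (std_normal_density x * exp (- 3 / 2)) \<le> \<delta> * std_normal_density \<xi>"
    using d by (intro mult_left_mono) auto
  also have "\<dots> \<le> \<Psi> x" using \<xi>(3) Psi_nonneg[of "x + \<delta>"] by simp
  finally have le: "(exp (3 / 2) * (1 + x)) * (\<delta> * (std_normal_density x * exp (- 3 / 2))) \<le> (exp (3 / 2) * (1 + x)) * \<Psi> x"
    using True by (intro mult_left_mono) auto
  have eq1: "(exp (3 / 2) * (1 + x)) * (\<delta> * (std_normal_density x * exp (- 3 / 2))) = 
     std_normal_density x * (exp (3 / 2) * exp (- 3 / 2)) * ((1 + x) * \<delta>)" by (simp only: ac_simps)
  have eq2: "exp (3 / 2) * exp (- 3 / 2) = (1 :: real)" by (simp flip: exp_add)
  have eq3: "(1 + x) * \<delta> = 1" using True by (simp add: \<delta>_def)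
  from le have "std_normal_density x \<le> exp (3 / 2) * (1 + x) * \<Psi> x"
    unfolding eq1 eq2 eq3 mult_1_right .
  then show ?thesis using True by simp
next
  case False
  have "std_normal_density x \<le> 1" using std_normal_density_le[of x] 
    by (rule order_trans) simp
  moreover have "1 / 2 \<le> \<Psi> x" using Psi_antimono[of x 0] False by (simp add: Psi_0)
  moreover have "2 \<le> exp (3 / 2 :: real)" using exp_ge_add_one_self[of "3/2::real"] by simp
  ultimately have "std_normal_density x \<le> 2 * \<Psi> x" "2 * \<Psi> x \<le> exp (3 / 2) * \<Psi> x"
    by (auto intro!: mult_right_mono)
  then show ?thesis using False by simp
qed

text \<open>
  On \<open>(- \<infinity>, R]\<close> the density at \<open>u + h\<close> is at least \<open>exp (- R h - h\<^sup>2 / 2)\<close> times the density at \<open>u\<close>;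
  integrate from \<open>x\<close> to \<open>R\<close>. What lies beyond \<open>R\<close> is given up, hence the correction \<open>\<Psi> R\<close>.
\<close>
lemma Psi_shift_ge:
  assumes "0 \<le> h" "0 \<le> R"
  shows "exp (- R * h - h\<^sup>2 / 2) * (\<Psi> x - \<Psi> R) \<le> \<Psi> (x + h)"
proof (cases "x \<le> R")
  case True
  let ?c = "exp (- R * h - h\<^sup>2 / 2)"
  have "\<Psi> (R + h) - ?c * \<Psi> R \<le> \<Psi> (x + h) - ?c * \<Psi> x"
  proof (rule DERIV_nonpos_imp_nonincreasing[OF True])
    fix u assume u: "x \<le> u" "u \<le> R"
    have "?c * std_normal_density u \<le> std_normal_density (u + h)"
      using u assms unfolding std_normal_density_shift 
      by (subst mult.commute) (auto intro!: mult_left_mono mult_right_mono)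
    moreover have "((\<lambda>x. \<Psi> (x + h) - ?c * \<Psi> x) has_field_derivative 
       - std_normal_density (u + h) + ?c * std_normal_density u) (at u)"
      by (auto intro!: derivative_eq_intros DERIV_chain2[of \<Psi>] DERIV_Psi)
    ultimately show "\<exists>y. ((\<lambda>x. \<Psi> (x + h) - ?c * \<Psi> x) has_field_derivative y) (at u) \<and> y \<le> 0"
      by (intro exI[of _ "- std_normal_density (u + h) + ?c * std_normal_density u"]) auto
  qed
  then show ?thesis using Psi_nonneg[of "R + h"] by (simp add: algebra_simps)
next
  case False
  then have "\<Psi> x - \<Psi> R \<le> 0" using Psi_antimono[of R x] by simp
  then have "exp (- R * h - h\<^sup>2 / 2) * (\<Psi> x - \<Psi> R) \<le> 0" by (simp add: mult_nonneg_nonpos)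
  then show ?thesis using Psi_nonneg[of "x + h"] by linarith
qed

definition shift_const :: "real \<Rightarrow> real" where "shift_const K = exp (- 2 * K - K\<^sup>2 / 2)"

text \<open>
  A shift of size \<open>K / L\<close> changes the tail by at most a constant factor, up to an error
  \<open>exp (- L\<^sup>2)\<close>. In the application \<open>L = sqrt (ln d)\<close>, so the errors of all coordinates together
  stay bounded. The cut-off is \<open>R = 2 L\<close>, where \<open>R h \<le> 2 K\<close> and \<open>\<Psi> R \<le> exp (- 2 L\<^sup>2)\<close>.
\<close>
lemma Psi_shift:
  assumes "1 \<le> L" "0 \<le> K" "\<bar>h\<bar> \<le> K / L"
  shows "shift_const K * (\<Psi> x - exp (- L\<^sup>2)) \<le> \<Psi> (x + h)"
proof (cases "0 \<le> h")
  case True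
  have hK1: "L * h \<le> K" using assms True by (simp add: field_simps)
  moreover have "1 * h \<le> L * h" using assms True by (intro mult_right_mono) auto
  ultimately have hK: "L * h \<le> K" "h \<le> K" by simp_all
  have "\<Psi> (2 * L) \<le> exp (- (2 * L)\<^sup>2 / 2)" using assms by (intro Psi_le_exp) auto
  also have "\<dots> \<le> exp (- L\<^sup>2)" by (simp add: power_mult_distrib)
  finally have R: "\<Psi> (2 * L) \<le> exp (- L\<^sup>2)" .
  show ?thesis
  proof (cases "exp (- L\<^sup>2) \<le> \<Psi> x")
    case c: True
    have "h\<^sup>2 \<le> K\<^sup>2" using hK True by (intro power_mono) auto
    then have "- 2 * K - K\<^sup>2 / 2 \<le> - (2 * L) * h - h\<^sup>2 / 2" using hK by linarith
    then have "shift_const K * (\<Psi> x - exp (- L\<^sup>2)) \<le> exp (- (2 * L) * h - h\<^sup>2 / 2) * (\<Psi> x - \<Psi> (2 * L))"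
      using c R unfolding shift_const_def by (intro mult_mono) auto
    also have "\<dots> \<le> \<Psi> (x + h)" using True assms by (intro Psi_shift_ge) auto
    finally show ?thesis .
  next
    case False
    then have "shift_const K * (\<Psi> x - exp (- L\<^sup>2)) \<le> 0" by (auto simp: mult_nonneg_nonpos shift_const_def)
    then show ?thesis using Psi_nonneg[of "x + h"] by linarith
  qed
next
  case False
  have "- 2 * K - K\<^sup>2 / 2 \<le> 0" using assms(2) zero_le_power2[of K] by linarith
  then have "shift_const K \<le> 1" unfolding shift_const_def by simp
  then have "shift_const K * \<Psi> x \<le> \<Psi> x" using Psi_nonneg[of x] by (simp add: mult_left_le_one_le shift_const_def)
  moreover have "\<Psi> x \<le> \<Psi> (x + h)" using False by (intro Psi_antimono) auto
  moreover have "0 \<le> shift_const K * exp (- L\<^sup>2)" by (simp add: shift_const_def)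
  ultimately show ?thesis by (simp add: algebra_simps)
qed

text \<open>
  The \<open>k\<close>-th polynomial is \<open>- (- 1)\<^sup>k\<close> times the \<open>k\<close>-th probabilists' Hermite polynomial.
\<close>
fun tail_deriv_poly :: "nat \<Rightarrow> real poly" where
  "tail_deriv_poly 0 = [:-1:]"
| "tail_deriv_poly (Suc k) = pderiv (tail_deriv_poly k) - [:0, 1:] * tail_deriv_poly k"

fun tail_deriv :: "nat \<Rightarrow> real \<Rightarrow> real" where
  "tail_deriv 0 x = \<Psi> x"
| "tail_deriv (Suc k) x = poly (tail_deriv_poly k) x * std_normal_density x"

lemma DERIV_tail_deriv: "(tail_deriv k has_field_derivative tail_deriv (Suc k) x) (at x)"
proof (cases k)
  case 0
  then show ?thesis using DERIV_Psi[of x] by (simp add: fun_eq_iff[of "tail_deriv 0" \<Psi>, THEN iffD2])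
next
  case (Suc k')
  have "((\<lambda>x. poly (tail_deriv_poly k') x * std_normal_density x) has_field_derivative tail_deriv (Suc k) x) (at x)"
    unfolding Suc
    by (rule derivative_eq_intros poly_DERIV has_field_derivative_std_normal_density refl)+ (simp add: algebra_simps)
  then show ?thesis by (simp add: Suc tail_deriv.simps(2)[abs_def])
qed

lemma degree_tail_deriv_poly: "degree (tail_deriv_poly k) \<le> k"
proof (induction k)
  case (Suc k)
  have "degree ([:0, 1:] * tail_deriv_poly k) \<le> Suc k"
    using degree_mult_le[of "[:0, 1:]" "tail_deriv_poly k"] Suc by simp
  then show ?case using Suc
    by (auto intro!: degree_diff_le simp: degree_pderiv)
qed simp

lemma poly_bound:
  fixes p :: "real poly"
  assumes "degree p \<le> k"
  shows "\<exists>C\<ge>0. \<forall>x. \<bar>poly p x\<bar> \<le> C * (1 + \<bar>x\<bar>) ^ k"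
proof (intro exI conjI allI)
  show "0 \<le> (\<Sum>i\<le>degree p. \<bar>coeff p i\<bar>)" by (auto intro: sum_nonneg)
  fix x
  have "\<bar>poly p x\<bar> \<le> (\<Sum>i\<le>degree p. \<bar>coeff p i * x ^ i\<bar>)" unfolding poly_altdef by (rule sum_abs)
  also have "\<dots> \<le> (\<Sum>i\<le>degree p. \<bar>coeff p i\<bar> * (1 + \<bar>x\<bar>) ^ k)"
  proof (rule sum_mono)
    fix i assume "i \<in> {..degree p}"
    then have "\<bar>x\<bar> ^ i \<le> (1 + \<bar>x\<bar>) ^ i" "(1 + \<bar>x\<bar>) ^ i \<le> (1 + \<bar>x\<bar>) ^ k" using assms
      by (auto intro!: power_mono power_increasing)
    then show "\<bar>coeff p i * x ^ i\<bar> \<le> \<bar>coeff p i\<bar> * (1 + \<bar>x\<bar>) ^ k" 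
      by (simp add: abs_mult power_abs mult_left_mono)
  qed
  finally show "\<bar>poly p x\<bar> \<le> (\<Sum>i\<le>degree p. \<bar>coeff p i\<bar>) * (1 + \<bar>x\<bar>) ^ k" by (simp add: sum_distrib_right)
qed

lemma power_le_fact_exp:
  fixes x :: real
  assumes "0 \<le> x"
  shows "x ^ n \<le> fact n * exp x"
proof -
  have "inverse (fact n) *\<^sub>R x ^ n \<le> exp x"
    unfolding exp_def using sum_le_suminf[OF summable_exp_generic[of x], of "{n}"] assms by simp
  then show ?thesis by (simp add: field_simps)
qed

text \<open>
  From \<open>u \<le> u\<^sup>2 / 8 + 2\<close> and \<open>x\<^sup>k \<le> fact k * exp x\<close> at \<open>x = 1 + \<bar>y\<bar>\<close>.
\<close>
lemma power_le_gauss: "(1 + \<bar>y\<bar>) ^ k \<le> fact k * exp 3 * exp (y\<^sup>2 / 8)" for y :: real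
proof -
  have "(1 + \<bar>y\<bar>) ^ k \<le> fact k * exp (1 + \<bar>y\<bar>)" by (rule power_le_fact_exp) simp
  also have "\<dots> \<le> fact k * exp (3 + y\<^sup>2 / 8)"
    using zero_le_power2[of "\<bar>y\<bar> - 4"] by (intro mult_left_mono) (simp_all add: power2_diff)
  finally have "(1 + \<bar>y\<bar>) ^ k \<le> fact k * exp (3 + y\<^sup>2 / 8)" .
  then show ?thesis by (simp only: exp_add mult.assoc)
qed

lemma tail_deriv_Suc_le:
  "\<exists>C\<ge>0. \<forall>y. \<bar>tail_deriv (Suc k) y\<bar> \<le> C * (1 + \<bar>y\<bar>) ^ k * std_normal_density y"
proof -
  obtain C where "0 \<le> C" "\<And>x. \<bar>poly (tail_deriv_poly k) x\<bar> \<le> C * (1 + \<bar>x\<bar>) ^ k"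
    using poly_bound[OF degree_tail_deriv_poly] by blast
  then show ?thesis by (intro exI[of _ C]) (auto simp: abs_mult intro!: mult_right_mono)
qed

lemma power_gauss_le:
  "(1 + \<bar>y\<bar>) ^ k * std_normal_density y \<le> fact k * exp 3 * exp (- 3 * y\<^sup>2 / 8)"
proof -
  have "(1 + \<bar>y\<bar>) ^ k * std_normal_density y \<le> (fact k * exp 3 * exp (y\<^sup>2 / 8)) * exp (- y\<^sup>2 / 2)"
    by (intro mult_mono power_le_gauss std_normal_density_le) auto
  also have "\<dots> = fact k * exp 3 * exp (- 3 * y\<^sup>2 / 8)" by (simp add: mult_exp_exp)
  finally show ?thesis .
qed

lemma tail_deriv_bounded: "\<exists>B. \<forall>x. \<bar>tail_deriv k x\<bar> \<le> B"
proof (cases k)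
  case 0
  then show ?thesis using Psi_nonneg Psi_le_1 by (auto intro!: exI[of _ 1])
next
  case (Suc k')
  obtain C where C: "0 \<le> C" "\<And>x. \<bar>tail_deriv (Suc k') x\<bar> \<le> C * (1 + \<bar>x\<bar>) ^ k' * std_normal_density x"
    using tail_deriv_Suc_le by blast
  have "\<bar>tail_deriv k x\<bar> \<le> C * (fact k' * exp 3)" for x
  proof -
    have "\<bar>tail_deriv k x\<bar> \<le> C * ((1 + \<bar>x\<bar>) ^ k' * std_normal_density x)"
      using C(2)[of x] by (simp add: Suc mult.assoc)
    also have "\<dots> \<le> C * (fact k' * exp 3 * exp (- 3 * x\<^sup>2 / 8))"
      by (intro mult_left_mono power_gauss_le C(1))
    also have "\<dots> \<le> C * (fact k' * exp 3 * 1)" using C(1) by (intro mult_left_mono) auto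
    finally show ?thesis by simp
  qed
  then show ?thesis by blast
qed

lemma borel_measurable_tail_deriv[measurable]: "tail_deriv k \<in> borel_measurable borel"
  by (intro borel_measurable_continuous_onI continuous_at_imp_continuous_on ballI DERIV_isCont[OF DERIV_tail_deriv])

text \<open>
  Bounds every derivative of the tail, after division by the appropriate power of \<open>L\<close>. The
  first summand serves points within distance of order \<open>L\<close> from the origin. The second one
  serves all other points: it is integrable in \<open>x\<close>, and its prefactor is \<open>1 / d\<close> when
  \<open>L = sqrt (ln d)\<close>.
\<close>
definition envelope :: "real \<Rightarrow> real \<Rightarrow> real" where
  "envelope L x = std_normal_density x + exp (- L\<^sup>2) * exp (- x\<^sup>2 / 8)"

lemma envelope_nonneg: "0 \<le> envelope L x"
  by (simp add: envelope_def)

text \<open>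
  For \<open>\<bar>x\<bar> \<le> 3 L\<close> the polynomial factor is \<open>O(L\<^sup>k)\<close> and the shift \<open>h\<close> changes the density by at most
  the factor \<open>exp (3 K)\<close>. For \<open>\<bar>x\<bar> > 3 L\<close> the derivative is \<open>O(exp (- 3 (x + h)\<^sup>2 / 8))\<close>, which is
  \<open>O(exp (- x\<^sup>2 / 4))\<close>; one half of this exponent gives \<open>exp (- L\<^sup>2)\<close> since \<open>x\<^sup>2 / 8 \<ge> L\<^sup>2\<close>, the other
  half is kept for integrability.
\<close>
lemma tail_deriv_le_envelope:
  assumes "0 \<le> K"
  shows "\<exists>C\<ge>0. \<forall>L\<ge>1. \<forall>x h. \<bar>h\<bar> \<le> K / L \<longrightarrow> \<bar>tail_deriv (Suc k) (x + h)\<bar> \<le> C * L ^ k * envelope L x"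
proof -
  obtain C where C: "0 \<le> C" "\<And>x. \<bar>tail_deriv (Suc k) x\<bar> \<le> C * (1 + \<bar>x\<bar>) ^ k * std_normal_density x"
    using tail_deriv_Suc_le by blast
  define D where "D = C * ((4 + K) ^ k * exp (3 * K))"
  define E where "E = C * (fact k * exp 3 * exp (3 * K\<^sup>2 / 4))"
  have nn: "0 \<le> D" "0 \<le> E" using C assms by (auto simp: D_def E_def)
  have "\<bar>tail_deriv (Suc k) (x + h)\<bar> \<le> (D + E) * L ^ k * envelope L x" if L: "1 \<le> L" and h: "\<bar>h\<bar> \<le> K / L" for L x h
  proof (cases "\<bar>x\<bar> \<le> 3 * L")
    case True
    have hK: "L * \<bar>h\<bar> \<le> K" using L h by (simp add: field_simps)
    have "K / L \<le> K / 1" using L assms by (intro divide_left_mono) auto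
    moreover have "K * 1 \<le> K * L" using L assms by (intro mult_left_mono) auto
    ultimately have KL: "K / L \<le> K" "K \<le> K * L" by simp_all
    have "1 + \<bar>x + h\<bar> \<le> (4 + K) * L" using True h L KL by (simp add: algebra_simps)
    then have 1: "(1 + \<bar>x + h\<bar>) ^ k \<le> (4 + K) ^ k * L ^ k"
      unfolding power_mult_distrib[symmetric] by (intro power_mono) auto
    have "- (x * h) \<le> \<bar>x\<bar> * \<bar>h\<bar>" by (metis abs_ge_minus_self abs_mult)
    also have "\<dots> \<le> 3 * L * \<bar>h\<bar>" using True by (intro mult_right_mono) auto
    also have "\<dots> \<le> 3 * K" using hK by simp
    finally have 2: "std_normal_density (x + h) \<le> std_normal_density x * exp (3 * K)"
      unfolding std_normal_density_shift by (intro mult_left_mono) (auto intro: order_trans[of _ "- (x*h)"])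
    have "\<bar>tail_deriv (Suc k) (x + h)\<bar> \<le> C * ((4 + K) ^ k * L ^ k) * (std_normal_density x * exp (3 * K))"
      using C(1) assms L by (intro order_trans[OF C(2)] mult_mono mult_left_mono 1 2) auto
    also have "\<dots> = D * L ^ k * std_normal_density x" by (simp add: D_def)
    also have "\<dots> \<le> (D + E) * L ^ k * envelope L x"
      using nn L by (intro mult_mono) (auto simp: envelope_def)
    finally show ?thesis .
  next
    case False
    let ?y = "x + h"
    have "K / L \<le> K / 1" using L assms by (intro divide_left_mono) auto
    then have hK: "\<bar>h\<bar> \<le> K" using h by simp
    have h2: "h\<^sup>2 \<le> K\<^sup>2" using hK assms by (simp add: abs_le_square_iff[symmetric])
    have x2: "9 * L\<^sup>2 \<le> x\<^sup>2" using False L abs_le_square_iff[of "3 * L" x] by (simp add: power_mult_distrib)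
    have y2: "2 / 3 * x\<^sup>2 - 2 * h\<^sup>2 \<le> ?y\<^sup>2"
      using zero_le_power2[of "x + 3 * h"] by (simp add: power2_sum power_mult_distrib algebra_simps)
    have "\<bar>tail_deriv (Suc k) ?y\<bar> \<le> C * ((1 + \<bar>?y\<bar>) ^ k * std_normal_density ?y)"
      using C(2)[of ?y] by (simp only: mult.assoc)
    also have "\<dots> \<le> C * (fact k * exp 3 * exp (- 3 * ?y\<^sup>2 / 8))"
      by (intro mult_left_mono power_gauss_le C(1))
    also have "\<dots> = C * (fact k * exp 3) * exp (- 3 * ?y\<^sup>2 / 8)" by (simp only: mult.assoc)
    also have "\<dots> \<le> C * (fact k * exp 3) * exp (3 * K\<^sup>2 / 4 + - L\<^sup>2 + - x\<^sup>2 / 8)"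
    proof (intro mult_left_mono)
      show "0 \<le> C * (fact k * exp 3)" using C(1) by simp
      have "- 3 * ?y\<^sup>2 / 8 \<le> 3 * K\<^sup>2 / 4 + - L\<^sup>2 + - x\<^sup>2 / 8"
        using y2 x2 h2 zero_le_power2[of L] by linarith
      then show "exp (- 3 * ?y\<^sup>2 / 8) \<le> exp (3 * K\<^sup>2 / 4 + - L\<^sup>2 + - x\<^sup>2 / 8)" by simp
    qed
    also have "\<dots> = E * 1 * (exp (- L\<^sup>2) * exp (- x\<^sup>2 / 8))" by (simp only: E_def exp_add mult_1_right mult.assoc)
    also have "\<dots> \<le> (D + E) * L ^ k * envelope L x"
      using nn L by (intro mult_mono) (auto simp: envelope_def)
    finally show ?thesis .
  qed
  then show ?thesis using nn by (intro exI[of _ "D + E"]) auto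
qed

text \<open>
  This is the Mills ratio for \<open>x \<le> 3 L\<close>; beyond that point the density itself is below
  \<open>exp (- L\<^sup>2)\<close>.
\<close>
lemma envelope_le_Psi:
  assumes "1 \<le> L"
  shows "envelope L x \<le> (4 * exp (3 / 2) + 2) * (L * \<Psi> x + exp (- L\<^sup>2))"
proof -
  have 1: "exp (- L\<^sup>2) * exp (- x\<^sup>2 / 8) \<le> exp (- L\<^sup>2)" by (simp add: mult_left_le)
  have "std_normal_density x \<le> 4 * exp (3 / 2) * (L * \<Psi> x) + exp (- L\<^sup>2)"
  proof (cases "x \<le> 3 * L")
    case True
    have "exp (3 / 2) * (1 + max 0 x) * \<Psi> x \<le> exp (3 / 2) * (4 * L) * \<Psi> x"
      using True assms by (intro mult_right_mono mult_left_mono) (auto simp: Psi_nonneg)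
    then show ?thesis using mills[of x] by (intro order_trans[OF mills] add_increasing2) (auto simp: ac_simps)
  next
    case False
    have x2: "9 * L\<^sup>2 \<le> x\<^sup>2" using False assms abs_le_square_iff[of "3 * L" x] by (simp add: power_mult_distrib)
    have "- x\<^sup>2 / 2 \<le> - L\<^sup>2" using x2 zero_le_power2[of L] by linarith
    then have "exp (- x\<^sup>2 / 2) \<le> exp (- L\<^sup>2)" by simp
    then have "std_normal_density x \<le> exp (- L\<^sup>2)" using std_normal_density_le[of x] by linarith
    moreover have "0 \<le> 4 * exp (3 / 2) * (L * \<Psi> x)" using assms Psi_nonneg by auto
    ultimately show ?thesis by linarith
  qed
  moreover have "0 \<le> 2 * (L * \<Psi> x)" "0 \<le> 4 * exp (3 / 2) * exp (- L\<^sup>2)" using assms Psi_nonneg by auto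
  ultimately show ?thesis using 1 unfolding envelope_def distrib_left distrib_right by linarith
qed

section \<open>Differentiating an integral of products\<close>

text \<open>
  The mean value theorem bounds the difference quotients by \<open>B\<close>, so dominated convergence
  applies along every sequence of increments.
\<close>
lemma (in finite_measure) DERIV_lebesgue_integral:
  fixes f f' :: "real \<Rightarrow> 'a \<Rightarrow> real"
  assumes deriv: "\<And>x \<omega>. \<omega> \<in> space M \<Longrightarrow> ((\<lambda>x. f x \<omega>) has_field_derivative f' x \<omega>) (at x)"
    and bound: "\<And>x \<omega>. \<omega> \<in> space M \<Longrightarrow> \<bar>f' x \<omega>\<bar> \<le> B"
    and f: "\<And>x. integrable M (f x)"
    and f': "\<And>x. f' x \<in> borel_measurable M"
  shows "((\<lambda>x. \<integral>\<omega>. f x \<omega> \<partial>M) has_field_derivative (\<integral>\<omega>. f' x \<omega> \<partial>M)) (at x)"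
  unfolding DERIV_def tendsto_at_iff_sequentially
proof (intro allI impI)
  fix h :: "nat \<Rightarrow> real"
  assume h: "\<forall>i. h i \<in> UNIV - {0}" "h \<longlonglongrightarrow> 0"
  have [measurable]: "f x \<in> borel_measurable M" for x using f[of x] by simp
  have "(\<lambda>i. \<integral>\<omega>. (f (x + h i) \<omega> - f x \<omega>) / h i \<partial>M) \<longlonglongrightarrow> (\<integral>\<omega>. f' x \<omega> \<partial>M)"
  proof (rule integral_dominated_convergence[where w = "\<lambda>_. B"])
    show "AE \<omega> in M. (\<lambda>i. (f (x + h i) \<omega> - f x \<omega>) / h i) \<longlonglongrightarrow> f' x \<omega>"
    proof (rule AE_I2)
      fix \<omega> assume "\<omega> \<in> space M"
      from deriv[OF this, of x] h show "(\<lambda>i. (f (x + h i) \<omega> - f x \<omega>) / h i) \<longlonglongrightarrow> f' x \<omega>"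
        unfolding DERIV_def tendsto_at_iff_sequentially by (auto simp: o_def)
    qed
    show "AE \<omega> in M. norm ((f (x + h i) \<omega> - f x \<omega>) / h i) \<le> B" for i
    proof (rule AE_I2)
      fix \<omega> assume \<omega>: "\<omega> \<in> space M"
      have "\<bar>f (x + h i) \<omega> - f x \<omega>\<bar> \<le> B * \<bar>x + h i - x\<bar>"
        using field_differentiable_bound[of UNIV "\<lambda>x. f x \<omega>" "\<lambda>x. f' x \<omega>" B "x + h i" x] deriv[OF \<omega>] bound[OF \<omega>]
        by auto
      then show "norm ((f (x + h i) \<omega> - f x \<omega>) / h i) \<le> B"
        using h(1) by (simp add: field_simps)
    qed
  qed (use f' in auto)
  then show "((\<lambda>t. ((\<integral>\<omega>. f (x + t) \<omega> \<partial>M) - (\<integral>\<omega>. f x \<omega> \<partial>M)) / t) \<circ> h) \<longlonglongrightarrow> (\<integral>\<omega>. f' x \<omega> \<partial>M)"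
    by (simp add: o_def f Bochner_Integration.integral_diff[OF f f])
qed

lemma prod_abs_le_power:
  fixes B :: real
  assumes "finite A" "1 \<le> B" "\<And>j. j \<in> A \<Longrightarrow> \<bar>f j\<bar> \<le> B"
  shows "\<bar>\<Prod>j\<in>A. f j\<bar> \<le> B ^ card A"
  unfolding abs_prod using prod_mono[of A "\<lambda>j. \<bar>f j\<bar>" "\<lambda>_. B"] assms by simp

text \<open>
  The \<open>j\<close>-th factor depends on the \<open>j\<close>-th coordinate only, so a partial derivative replaces a
  single factor by its derivative. The bounds on the factors, uniform in \<open>\<omega>\<close> and \<open>x\<close>, justify
  the exchange with the integral.
\<close>
lemma (in finite_measure) partial_derivs_integral_prod:
  fixes F :: "nat \<Rightarrow> nat \<Rightarrow> 'a \<Rightarrow> real \<Rightarrow> real"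
  assumes deriv: "\<And>k j \<omega> x. j < d \<Longrightarrow> \<omega> \<in> space M \<Longrightarrow> (F k j \<omega> has_field_derivative F (Suc k) j \<omega> x) (at x)"
    and bound: "\<And>k. \<exists>B. \<forall>j<d. \<forall>\<omega>\<in>space M. \<forall>x. \<bar>F k j \<omega> x\<bar> \<le> B"
    and meas[measurable]: "\<And>k j x. j < d \<Longrightarrow> (\<lambda>\<omega>. F k j \<omega> x) \<in> borel_measurable M"
    and f: "\<And>w. w \<in> carrier_vec d \<Longrightarrow> f w = (\<integral>\<omega>. (\<Prod>j<d. F 0 j \<omega> (w $ j)) \<partial>M)"
  shows "set js \<subseteq> {..<d} \<Longrightarrow> w \<in> carrier_vec d \<Longrightarrow>
    partial_derivs js f w = (\<integral>\<omega>. (\<Prod>j<d. F (count_list js j) j \<omega> (w $ j)) \<partial>M)"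
proof (induction js arbitrary: w)
  case Nil
  then show ?case by (simp add: f)
next
  case (Cons i js)
  let ?c = "count_list js"
  have i: "i < d" using Cons.prems by simp
  define w' where "w' t = w + t \<cdot>\<^sub>v unit_vec (dim_vec w) i" for t
  have w': "w' t \<in> carrier_vec d" for t using Cons.prems by (auto simp: w'_def)
  have w'_nth: "w' t $ j = (if j = i then w $ i + t else w $ j)" if "j < d" for t j
    using Cons.prems that i by (auto simp: w'_def)
  define R where "R \<omega> = (\<Prod>j\<in>{..<d} - {i}. F (?c j) j \<omega> (w $ j))" for \<omega>
  have [measurable]: "R \<in> borel_measurable M" unfolding R_def by measurable
  obtain Bk where Bk: "\<And>k j \<omega> x. j < d \<Longrightarrow> \<omega> \<in> space M \<Longrightarrow> \<bar>F k j \<omega> x\<bar> \<le> Bk k"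
    using bound by metis
  define B where "B = 1 + (\<Sum>k\<le>Suc (length js). \<bar>Bk k\<bar>)"
  have B1: "1 \<le> B" unfolding B_def by (simp add: sum_nonneg)
  have B: "\<bar>F k j \<omega> x\<bar> \<le> B" if "j < d" "\<omega> \<in> space M" "k \<le> Suc (length js)" for k j \<omega> x
  proof -
    have "\<bar>F k j \<omega> x\<bar> \<le> \<bar>Bk k\<bar>" using Bk[OF that(1,2), of k x] by linarith
    also have "\<dots> \<le> (\<Sum>k\<le>Suc (length js). \<bar>Bk k\<bar>)" using that by (intro member_le_sum) auto
    finally show ?thesis by (simp add: B_def)
  qed
  have cl: "?c j \<le> length js" for j by (rule count_le_length)
  have R: "\<bar>R \<omega>\<bar> \<le> B ^ card ({..<d} - {i})" if "\<omega> \<in> space M" for \<omega>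
    unfolding R_def using that B1 cl by (intro prod_abs_le_power B) (auto intro: le_SucI)
  have split: "(\<Prod>j<d. F (?c j) j \<omega> (w' t $ j)) = F (?c i) i \<omega> (w $ i + t) * R \<omega>" for t \<omega>
    unfolding R_def using i by (subst prod.remove[of _ i]) (auto simp: w'_nth intro!: prod.cong)
  have split': "(\<Prod>j<d. F (count_list (i # js) j) j \<omega> (w $ j)) = F (Suc (?c i)) i \<omega> (w $ i + 0) * R \<omega>" for \<omega>
    unfolding R_def using i by (subst prod.remove[of _ i]) (auto intro!: prod.cong)
  have *: "\<bar>F k i \<omega> x * R \<omega>\<bar> \<le> B * B ^ card ({..<d} - {i})" if "\<omega> \<in> space M" "k \<le> Suc (length js)" for \<omega> k x
    unfolding abs_mult using that i by (intro mult_mono B R) (use B1 in auto)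
  have "((\<lambda>t. \<integral>\<omega>. F (?c i) i \<omega> (w $ i + t) * R \<omega> \<partial>M) has_field_derivative
     (\<integral>\<omega>. F (Suc (?c i)) i \<omega> (w $ i + 0) * R \<omega> \<partial>M)) (at 0)"
  proof (rule DERIV_lebesgue_integral[where B = "B * B ^ card ({..<d} - {i})"])
    fix t \<omega> assume \<omega>: "\<omega> \<in> space M"
    show "((\<lambda>t. F (?c i) i \<omega> (w $ i + t) * R \<omega>) has_field_derivative F (Suc (?c i)) i \<omega> (w $ i + t) * R \<omega>) (at t)"
      using DERIV_shift[of "F (?c i) i \<omega>" _ t "w $ i"] deriv[OF i \<omega>, of "?c i" "w $ i + t"]
      by (intro DERIV_cmult_right) (simp add: add.commute)
    show "\<bar>F (Suc (?c i)) i \<omega> (w $ i + t) * R \<omega>\<bar> \<le> B * B ^ card ({..<d} - {i})"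
      using \<omega> cl by (intro *) auto
  next
    fix t
    show "integrable M (\<lambda>\<omega>. F (?c i) i \<omega> (w $ i + t) * R \<omega>)"
      using i cl by (intro integrable_const_bound[where B = "B * B ^ card ({..<d} - {i})"] AE_I2)
        (unfold real_norm_def, (intro *)[1], use le_SucI[OF cl] in auto)
    show "(\<lambda>\<omega>. F (Suc (?c i)) i \<omega> (w $ i + t) * R \<omega>) \<in> borel_measurable M"
      using i by measurable
  qed
  then have "deriv (\<lambda>t. \<integral>\<omega>. F (?c i) i \<omega> (w $ i + t) * R \<omega> \<partial>M) 0 =
     (\<integral>\<omega>. F (Suc (?c i)) i \<omega> (w $ i + 0) * R \<omega> \<partial>M)" by (rule DERIV_imp_deriv)
  moreover have "partial_derivs (i # js) f w = deriv (\<lambda>t. \<integral>\<omega>. F (?c i) i \<omega> (w $ i + t) * R \<omega> \<partial>M) 0"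
  proof -
    have "partial_derivs js f (w' t) = (\<integral>\<omega>. F (?c i) i \<omega> (w $ i + t) * R \<omega> \<partial>M)" for t
      using Cons.IH[OF _ w'] Cons.prems by (simp only: split) simp
    then show ?thesis by (simp add: partial_deriv_def flip: w'_def)
  qed
  ultimately show ?case by (simp only: split')
qed

section \<open>Summation over multi-indices\<close>

text \<open>
  The contribution of the coordinates that occur in \<open>js\<close>: the first derivative in coordinate
  \<open>j\<close> is worth \<open>G j\<close>, each further one \<open>L\<close>.
\<close>
definition weight :: "real \<Rightarrow> (nat \<Rightarrow> real) \<Rightarrow> nat list \<Rightarrow> real" where
  "weight L G js = (\<Prod>j\<in>set js. L ^ (count_list js j - 1) * G j)"

lemma weight_Cons:
  "weight L G (j # js) = (if j \<in> set js then L else G j) * weight L G js"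
proof (cases "j \<in> set js")
  case True
  then have "0 < count_list js j" using count_list_0_iff[of js j] by auto
  then have "L ^ count_list js j = L * L ^ (count_list js j - 1)" by (cases "count_list js j") auto
  moreover have "(\<Prod>i\<in>set js - {j}. L ^ (count_list (j # js) i - 1) * G i) = (\<Prod>i\<in>set js - {j}. L ^ (count_list js i - 1) * G i)"
    by (intro prod.cong) auto
  ultimately show ?thesis using True
    by (simp add: weight_def insert_absorb prod.remove[of "set js" j])
next
  case False
  have "(\<Prod>i\<in>set js. L ^ (count_list (j # js) i - 1) * G i) = weight L G js"
    unfolding weight_def using False by (intro prod.cong) auto
  then show ?thesis using False by (simp add: weight_def)
qed

lemma weight_nonneg: "0 \<le> L \<Longrightarrow> (\<And>j. 0 \<le> G j) \<Longrightarrow> 0 \<le> weight L G js"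
  unfolding weight_def by (intro prod_nonneg) auto

lemma multi_indices_Suc:
  "multi_indices d (Suc v) = (\<lambda>(j, js). j # js) ` ({..<d} \<times> multi_indices d v)"
  by (auto simp: multi_indices_def length_Suc_conv image_iff)

lemma sum_multi_indices_Suc:
  "(\<Sum>js\<in>multi_indices d (Suc v). f js) = (\<Sum>js\<in>multi_indices d v. \<Sum>j<d. f (j # js))"
  unfolding multi_indices_Suc
  by (subst sum.reindex) (auto simp: inj_on_def sum.cartesian_product' split_def sum.swap[of _ "{..<d}"] comp_def)

text \<open>
  Induction on the length. Prepending an index multiplies the weight by \<open>L\<close> if the index
  already occurs, which is so for at most as many indices as the length of the list, and by
  \<open>G j\<close> otherwise.
\<close>
lemma sum_weight_le:
  assumes "0 \<le> L" "\<And>j. 0 \<le> G j"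
  shows "(\<Sum>js\<in>multi_indices d (Suc n). weight L G js) \<le> (\<Sum>j<d. G j) * (real n * L + (\<Sum>j<d. G j)) ^ n"
proof (induction n)
  case 0
  have "multi_indices d 0 = {[]}" by (auto simp: multi_indices_def)
  then show ?case by (simp add: sum_multi_indices_Suc weight_def)
next
  case (Suc n)
  let ?S = "\<Sum>j<d. G j"
  have S: "0 \<le> ?S" using assms by (intro sum_nonneg) auto
  have "(\<Sum>js\<in>multi_indices d (Suc (Suc n)). weight L G js) =
      (\<Sum>js\<in>multi_indices d (Suc n). \<Sum>j<d. weight L G (j # js))" by (rule sum_multi_indices_Suc)
  also have "\<dots> \<le> (\<Sum>js\<in>multi_indices d (Suc n). weight L G js * (real (Suc n) * L + ?S))"
  proof (rule sum_mono)
    fix js assume js: "js \<in> multi_indices d (Suc n)"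
    have "(\<Sum>j<d. if j \<in> set js then L else G j) \<le> (\<Sum>j<d. (if j \<in> set js then L else 0) + G j)"
      using assms by (intro sum_mono) auto
    also have "\<dots> = real (card ({..<d} \<inter> set js)) * L + ?S"
      by (simp add: sum.distrib sum.If_cases)
    also have "\<dots> \<le> real (Suc n) * L + ?S"
    proof -
      have "card ({..<d} \<inter> set js) \<le> card (set js)" by (intro card_mono) auto
      also have "\<dots> \<le> length js" by (rule card_length)
      also have "\<dots> = Suc n" using js by (simp add: multi_indices_def)
      finally show ?thesis using assms by (intro add_right_mono mult_right_mono) auto
    qed
    finally show "(\<Sum>j<d. weight L G (j # js)) \<le> weight L G js * (real (Suc n) * L + ?S)"
      using weight_nonneg[where js = js, OF assms]
      by (simp add: weight_Cons sum_distrib_right[symmetric] mult.commute[of "weight L G js"] mult_right_mono)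
  qed
  also have "\<dots> = (\<Sum>js\<in>multi_indices d (Suc n). weight L G js) * (real (Suc n) * L + ?S)"
    by (simp only: sum_distrib_right)
  also have "\<dots> \<le> (?S * (real n * L + ?S) ^ n) * (real (Suc n) * L + ?S)"
    using assms S by (intro mult_right_mono Suc.IH) auto
  also have "\<dots> \<le> (?S * (real (Suc n) * L + ?S) ^ n) * (real (Suc n) * L + ?S)"
    using assms S by (intro mult_right_mono mult_left_mono power_mono add_right_mono) auto
  finally show ?case by (simp add: ac_simps)
qed

section \<open>Pointwise bounds for the derivatives of a product\<close>

lemma prod_power_count:
  fixes c :: real
  shows "(\<Prod>j\<in>set js. c ^ count_list js j) = c ^ length js"
  by (simp add: power_sum[symmetric] sum_count_set)

text \<open>
  The rectangle in terms of real numbers: \<open>p j\<close> and \<open>q j\<close> say whether the upper end \<open>b j\<close> and the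
  lower end \<open>a j\<close> of the \<open>j\<close>-th side are finite. The standard deviation of the smoothing noise
  is \<open>s\<close>.
\<close>
locale box =
  fixes d :: nat and p q :: "nat \<Rightarrow> bool" and a b :: "nat \<Rightarrow> real" and s :: real
  assumes s_pos: "0 < s"
    and ordered: "\<And>j. j < d \<Longrightarrow> p j \<Longrightarrow> q j \<Longrightarrow> a j \<le> b j"
begin

definition upper :: "nat \<Rightarrow> real \<Rightarrow> real \<Rightarrow> real" where "upper j t x = (b j + t - x) / s"

definition lower :: "nat \<Rightarrow> real \<Rightarrow> real \<Rightarrow> real" where "lower j t x = (t + x - a j) / s"

text \<open>
  The \<open>k\<close>-th derivative in \<open>x\<close> of the probability that \<open>x + s Z\<close>, with \<open>Z\<close> standard normal, lies in
  \<open>[a j - t, b j + t]\<close>.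
\<close>
definition side_deriv :: "nat \<Rightarrow> nat \<Rightarrow> real \<Rightarrow> real \<Rightarrow> real" where
  "side_deriv k j t x = (if k = 0 then 1 else 0)
    - of_bool (p j) * (- 1 / s) ^ k * tail_deriv k (upper j t x)
    - of_bool (q j) * (1 / s) ^ k * tail_deriv k (lower j t x)"

definition ends_sum :: "(real \<Rightarrow> real) \<Rightarrow> nat \<Rightarrow> real \<Rightarrow> real \<Rightarrow> real" where
  "ends_sum f j t x = of_bool (p j) * f (upper j t x) + of_bool (q j) * f (lower j t x)"

lemma upper_shift: "upper j t (x + y) = upper j t x + (- y / s)"
  and lower_shift: "lower j t (x + y) = lower j t x + y / s"
  by (simp_all add: upper_def lower_def diff_divide_distrib add_divide_distrib)

lemma ends_sum_nonneg: "(\<And>x. 0 \<le> f x) \<Longrightarrow> 0 \<le> ends_sum f j t x"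
  by (simp add: ends_sum_def)

lemma DERIV_side_deriv: "(side_deriv k j t has_field_derivative side_deriv (Suc k) j t x) (at x)"
proof -
  have u: "((\<lambda>x. tail_deriv k (upper j t x)) has_field_derivative (tail_deriv (Suc k) (upper j t x) * (- 1 / s))) (at x)"
    by (rule DERIV_chain2[OF DERIV_tail_deriv])
       (use s_pos in \<open>auto simp: upper_def[abs_def] intro!: derivative_eq_intros\<close>)
  have l: "((\<lambda>x. tail_deriv k (lower j t x)) has_field_derivative (tail_deriv (Suc k) (lower j t x) * (1 / s))) (at x)"
    by (rule DERIV_chain2[OF DERIV_tail_deriv])
       (use s_pos in \<open>auto simp: lower_def[abs_def] intro!: derivative_eq_intros\<close>)
  show ?thesis
    unfolding side_deriv_def
    by (rule DERIV_cong[OF DERIV_diff[OF DERIV_diff[OF DERIV_const DERIV_cmult[OF u]] DERIV_cmult[OF l]]])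
       (simp del: tail_deriv.simps)
qed

lemma side_deriv_bounded: "\<exists>B. \<forall>j t x. \<bar>side_deriv k j t x\<bar> \<le> B"
proof -
  obtain B where B: "\<And>x. \<bar>tail_deriv k x\<bar> \<le> B" using tail_deriv_bounded by blast
  have B0: "0 \<le> B" using B[of 0] by linarith
  have "\<bar>side_deriv k j t x\<bar> \<le> 1 + (1 / s) ^ k * B + (1 / s) ^ k * B" for j t x
  proof -
    have "\<bar>of_bool (p j) * (- 1 / s) ^ k * tail_deriv k (upper j t x)\<bar> \<le> (1 / s) ^ k * B"
      unfolding abs_mult using B B0 s_pos
      by (intro mult_mono order_trans[OF mult_left_le_one_le]) (auto simp: power_abs simp flip: power_divide)
    moreover have "\<bar>of_bool (q j) * (1 / s) ^ k * tail_deriv k (lower j t x)\<bar> \<le> (1 / s) ^ k * B"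
      unfolding abs_mult using B B0 s_pos
      by (intro mult_mono order_trans[OF mult_left_le_one_le]) (auto simp: power_abs simp flip: power_divide)
    moreover have "\<bar>(if k = 0 then 1 else 0) - P - Q\<bar> \<le> 1 + \<bar>P\<bar> + \<bar>Q\<bar>" for P Q :: real by auto
    ultimately show ?thesis unfolding side_deriv_def mult_1_left by (meson add_mono order_trans order_refl)
  qed
  then show ?thesis by blast
qed

lemma side_deriv_0: "side_deriv 0 j t x = 1 - ends_sum \<Psi> j t x"
  by (simp add: side_deriv_def ends_sum_def)

lemma side_deriv_0_nonneg:
  assumes "j < d" "0 \<le> t"
  shows "0 \<le> side_deriv 0 j t x"
proof -
  have "ends_sum \<Psi> j t x \<le> 1"
  proof (cases "p j \<and> q j")
    case True
    then have "- (t + x - a j) \<le> b j + t - x" using assms ordered[of j] by auto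
    then have "- lower j t x \<le> upper j t x" using s_pos
      unfolding upper_def lower_def minus_divide_left by (intro divide_right_mono) auto
    then have "\<Psi> (upper j t x) \<le> 1 - \<Psi> (lower j t x)" using Psi_antimono by (simp flip: Psi_minus)
    then show ?thesis using True by (simp add: ends_sum_def)
  qed (auto simp: ends_sum_def Psi_le_1)
  then show ?thesis by (simp add: side_deriv_0)
qed

end

text \<open>
  In the application \<open>L = sqrt (ln d)\<close>, which makes \<open>d * exp (- L\<^sup>2)\<close> equal to \<open>1\<close>.
\<close>
locale box_scale = box +
  fixes L K c :: real
  assumes L1: "1 \<le> L" and dL: "real d * exp (- L\<^sup>2) \<le> 1" and K0: "0 \<le> K"
  defines "c \<equiv> shift_const K"
begin

definition mass :: "real \<Rightarrow> (nat \<Rightarrow> real) \<Rightarrow> real" where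
  "mass t x = (\<Sum>j<d. ends_sum \<Psi> j t (x j))"

definition total_envelope :: "real \<Rightarrow> (nat \<Rightarrow> real) \<Rightarrow> real" where
  "total_envelope t x = (\<Sum>j<d. ends_sum (envelope L) j t (x j))"

lemma mass_nonneg: "0 \<le> mass t x"
  unfolding mass_def by (intro sum_nonneg ends_sum_nonneg Psi_nonneg)

lemma total_envelope_nonneg: "0 \<le> total_envelope t x"
  unfolding total_envelope_def by (intro sum_nonneg ends_sum_nonneg envelope_nonneg)

lemma c_pos: "0 < c" and c_le_1: "c \<le> 1"
proof -
  show "0 < c" by (simp add: c_def shift_const_def)
  have "- 2 * K - K\<^sup>2 / 2 \<le> 0" using K0 zero_le_power2[of K] by linarith
  then show "c \<le> 1" unfolding c_def shift_const_def by simp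
qed

text \<open>
  From \<open>1 - f \<le> exp (- f)\<close>. The bound does not depend on the shift \<open>y\<close>.
\<close>
lemma side_deriv_0_le:
  assumes y: "\<bar>y\<bar> \<le> s * K / L"
  shows "side_deriv 0 j t (x + y) \<le> exp (- c * ends_sum \<Psi> j t x + 2 * exp (- L\<^sup>2))"
proof -
  define e where "e = exp (- L\<^sup>2)"
  have y': "\<bar>- y / s\<bar> \<le> K / L" "\<bar>y / s\<bar> \<le> K / L" using y s_pos L1 by (auto simp: field_simps)
  have e: "0 \<le> e" "c * e \<le> e" unfolding e_def using c_pos c_le_1 by (auto intro!: mult_left_le_one_le)
  have "c * (\<Psi> (upper j t x) - e) \<le> \<Psi> (upper j t x + (- y / s))"
    unfolding c_def e_def using L1 K0 y' by (intro Psi_shift) auto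
  then have u: "c * \<Psi> (upper j t x) - e \<le> \<Psi> (upper j t (x + y))"
    using e by (simp add: upper_shift right_diff_distrib)
  have "c * (\<Psi> (lower j t x) - e) \<le> \<Psi> (lower j t x + y / s)"
    unfolding c_def e_def using L1 K0 y' by (intro Psi_shift) auto
  then have l: "c * \<Psi> (lower j t x) - e \<le> \<Psi> (lower j t (x + y))"
    using e by (simp add: lower_shift right_diff_distrib)
  have "c * ends_sum \<Psi> j t x - 2 * e \<le> ends_sum \<Psi> j t (x + y)"
    using u l e(1) unfolding ends_sum_def by (cases "p j"; cases "q j") (simp_all add: distrib_left)
  then have "- ends_sum \<Psi> j t (x + y) \<le> - c * ends_sum \<Psi> j t x + 2 * exp (- L\<^sup>2)" by (simp add: e_def)
  moreover have "side_deriv 0 j t (x + y) \<le> exp (- ends_sum \<Psi> j t (x + y))"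
    unfolding side_deriv_0 using exp_ge_add_one_self[of "- ends_sum \<Psi> j t (x + y)"] by simp
  ultimately show ?thesis by (meson exp_le_cancel_iff order_trans)
qed

lemma side_deriv_Suc_le:
  assumes C: "\<And>x h. \<bar>h\<bar> \<le> K / L \<Longrightarrow> \<bar>tail_deriv (Suc k) (x + h)\<bar> \<le> C * L ^ k * envelope L x"
  assumes y: "\<bar>y\<bar> \<le> s * K / L"
  shows "\<bar>side_deriv (Suc k) j t (x + y)\<bar> \<le> (1 / s) ^ Suc k * (C * L ^ k * ends_sum (envelope L) j t x)"
proof -
  have y': "\<bar>- y / s\<bar> \<le> K / L" "\<bar>y / s\<bar> \<le> K / L" using y s_pos L1 by (auto simp: field_simps)
  let ?P = "of_bool (p j) * (- 1 / s) ^ Suc k * tail_deriv (Suc k) (upper j t (x + y))"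
  let ?Q = "of_bool (q j) * (1 / s) ^ Suc k * tail_deriv (Suc k) (lower j t (x + y))"
  have s': "\<bar>(- 1 / s) ^ Suc k\<bar> = (1 / s) ^ Suc k" "\<bar>(1 / s) ^ Suc k\<bar> = (1 / s) ^ Suc k"
    using s_pos by (simp_all add: power_abs)
  have "\<bar>?P\<bar> \<le> of_bool (p j) * (1 / s) ^ Suc k * (C * L ^ k * envelope L (upper j t x))"
    unfolding abs_mult s' upper_shift using s_pos 
    by (intro mult_mono C y') (auto intro!: mult_nonneg_nonneg)
  moreover have "\<bar>?Q\<bar> \<le> of_bool (q j) * (1 / s) ^ Suc k * (C * L ^ k * envelope L (lower j t x))"
    unfolding abs_mult s' lower_shift using s_pos 
    by (intro mult_mono C y') (auto intro!: mult_nonneg_nonneg)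
  ultimately have "\<bar>?P\<bar> + \<bar>?Q\<bar> \<le> (1 / s) ^ Suc k * (C * L ^ k * ends_sum (envelope L) j t x)"
    unfolding ends_sum_def by (simp only: distrib_left ac_simps)
  moreover have "\<bar>side_deriv (Suc k) j t (x + y)\<bar> \<le> \<bar>?P\<bar> + \<bar>?Q\<bar>"
    unfolding side_deriv_def by (simp only: nat.simps if_False)
  ultimately show ?thesis by linarith
qed

text \<open>
  For an index outside \<open>js\<close> the factor is the probability bounded by \<open>side_deriv_0_le\<close>. For an
  index in \<open>js\<close> that exponential is inserted as well, at the cost of a factor \<open>exp 2\<close>, since
  its exponent is at least \<open>- 2\<close>; hence the full \<open>mass\<close> of all coordinates appears. The errors
  \<open>2 * exp (- L\<^sup>2)\<close> of the \<open>d\<close> coordinates add up to at most \<open>2\<close>.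
\<close>
lemma prod_side_deriv_le:
  assumes C: "\<And>k x h. k < v \<Longrightarrow> \<bar>h\<bar> \<le> K / L \<Longrightarrow> \<bar>tail_deriv (Suc k) (x + h)\<bar> \<le> C * L ^ k * envelope L x"
    and C1: "1 \<le> C" and t: "0 \<le> t" and js: "js \<in> multi_indices d v"
    and y: "\<And>j. j < d \<Longrightarrow> \<bar>y j\<bar> \<le> s * K / L"
  shows "\<bar>\<Prod>j<d. side_deriv (count_list js j) j t (x j + y j)\<bar> \<le>
    exp 2 * (exp 2 * C) ^ v * (1 / s) ^ v * exp (- c * mass t x) * weight L (\<lambda>j. ends_sum (envelope L) j t (x j)) js"
proof -
  let ?e = "exp (- L\<^sup>2)" and ?E = "\<lambda>j. ends_sum (envelope L) j t (x j)"
  let ?f = "\<lambda>j. exp (- c * ends_sum \<Psi> j t (x j) + 2 * ?e)"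
  let ?k = "count_list js"
  let ?g = "\<lambda>j. (exp 2 * C) * (1 / s) ^ ?k j * (L ^ (?k j - 1) * ?E j)"
  have len: "length js = v" "set js \<subseteq> {..<d}" using js by (auto simp: multi_indices_def)
  have M1: "1 \<le> exp 2 * C" using C1 mult_mono[of 1 "exp 2" 1 C] by simp
  have "\<bar>side_deriv (?k j) j t (x j + y j)\<bar> \<le> ?f j * (if j \<in> set js then ?g j else 1)" if j: "j < d" for j
  proof (cases "j \<in> set js")
    case False
    then have "?k j = 0" by simp
    then show ?thesis using False side_deriv_0_le[OF y[OF j], of j t "x j"] side_deriv_0_nonneg[OF j t, of "x j + y j"]
      by simp
  next
    case True
    then obtain k where k: "?k j = Suc k" using count_list_0_iff[of js j] by (cases "?k j") auto
    have "k < v" using k count_le_length[of js j] len by simp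
    note * = side_deriv_Suc_le[OF C[OF this] y[OF j], of j t "x j"]
    have "ends_sum \<Psi> j t (x j) \<le> 2" using Psi_le_1 unfolding ends_sum_def 
      by (cases "p j"; cases "q j") (auto intro: order_trans[OF add_mono[OF Psi_le_1 Psi_le_1]] order_trans[OF Psi_le_1])
    then have "c * ends_sum \<Psi> j t (x j) \<le> 1 * 2" 
      using c_pos c_le_1 ends_sum_nonneg[OF Psi_nonneg] by (intro mult_mono) auto
    then have "0 \<le> - c * ends_sum \<Psi> j t (x j) + 2 * ?e + 2" using exp_ge_zero[of "- L\<^sup>2"] by linarith
    then have "1 \<le> ?f j * exp 2" by (simp only: exp_add[symmetric] one_le_exp_iff)
    moreover have "0 \<le> (1 / s) ^ Suc k * (C * L ^ k * ?E j)"
      using s_pos C1 L1 ends_sum_nonneg[OF envelope_nonneg] by auto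
    ultimately have "1 * ((1 / s) ^ Suc k * (C * L ^ k * ?E j)) \<le> (?f j * exp 2) * ((1 / s) ^ Suc k * (C * L ^ k * ?E j))"
      by (intro mult_right_mono) auto
    also have "\<dots> = ?f j * (if j \<in> set js then ?g j else 1)" using True k by (simp only: if_True ac_simps) simp
    finally show ?thesis using * k by simp
  qed
  then have "\<bar>\<Prod>j<d. side_deriv (?k j) j t (x j + y j)\<bar> \<le> (\<Prod>j<d. ?f j * (if j \<in> set js then ?g j else 1))"
    unfolding abs_prod by (intro prod_mono) auto
  also have "\<dots> = (\<Prod>j<d. ?f j) * (\<Prod>j\<in>set js. ?g j)"
    using len by (simp add: prod.distrib prod.If_cases Int_absorb1)
  also have "(\<Prod>j<d. ?f j) = exp (2 * (real d * ?e)) * exp (- c * mass t x)"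
    by (simp add: exp_sum[symmetric] sum_subtractf sum.distrib mass_def sum_distrib_left sum_negf flip: exp_add)
  also have "(\<Prod>j\<in>set js. ?g j) = (exp 2 * C) ^ card (set js) * (1 / s) ^ v * weight L ?E js"
    by (simp add: prod.distrib prod_power_count[of "1 / s"] len(1) weight_def del: power_one_over power_mult_distrib)
  also have "exp (2 * (real d * ?e)) * exp (- c * mass t x) * ((exp 2 * C) ^ card (set js) * (1 / s) ^ v * weight L ?E js)
     \<le> exp 2 * exp (- c * mass t x) * ((exp 2 * C) ^ v * (1 / s) ^ v * weight L ?E js)"
  proof -
    have "(exp 2 * C) ^ card (set js) \<le> (exp 2 * C) ^ v"
      using M1 len card_length[of js] by (intro power_increasing) auto
    moreover have "exp (2 * (real d * ?e)) \<le> exp 2" using dL by simp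
    ultimately show ?thesis using M1 s_pos L1
      by (intro mult_mono order_refl weight_nonneg ends_sum_nonneg envelope_nonneg mult_nonneg_nonneg) auto
  qed
  finally show ?thesis by (simp only: ac_simps)
qed

lemma total_envelope_le:
  "total_envelope t x \<le> (4 * exp (3 / 2) + 2) * (L * (mass t x + 2))"
proof -
  let ?B = "4 * exp (3 / 2) + 2 :: real" and ?e = "exp (- L\<^sup>2)"
  have B: "0 \<le> ?B" by (simp add: add_nonneg_nonneg)
  have "ends_sum (envelope L) j t (x j) \<le> ?B * (L * ends_sum \<Psi> j t (x j) + 2 * ?e)" for j
  proof -
    have "ends_sum (envelope L) j t (x j) \<le> of_bool (p j) * (?B * (L * \<Psi> (upper j t (x j)) + ?e)) +
       of_bool (q j) * (?B * (L * \<Psi> (lower j t (x j)) + ?e))"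
      unfolding ends_sum_def using L1 by (intro add_mono mult_left_mono envelope_le_Psi) auto
    also have "\<dots> = ?B * (L * ends_sum \<Psi> j t (x j) + (of_bool (p j) + of_bool (q j)) * ?e)"
      by (simp add: ends_sum_def algebra_simps)
    also have "\<dots> \<le> ?B * (L * ends_sum \<Psi> j t (x j) + 2 * ?e)"
      using B by (intro mult_left_mono add_left_mono mult_right_mono) (auto simp: of_bool_def)
    finally show ?thesis .
  qed
  then have "total_envelope t x \<le> (\<Sum>j<d. ?B * (L * ends_sum \<Psi> j t (x j) + 2 * ?e))"
    unfolding total_envelope_def by (rule sum_mono)
  also have "\<dots> = ?B * (L * mass t x + 2 * (real d * ?e))"
    by (simp add: mass_def sum_distrib_left[symmetric] sum.distrib)
  also have "\<dots> \<le> ?B * (L * mass t x + L * 2)"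
    using B dL L1 by (intro mult_left_mono add_left_mono) auto
  finally show ?thesis by (simp only: distrib_left)
qed

text \<open>
  By \<open>sum_weight_le\<close> and \<open>total_envelope_le\<close> the sum of the weights is at most \<open>total_envelope\<close>
  times \<open>O((L (1 + M))\<^sup>n)\<close> with \<open>M\<close> the mass, and half of the exponential absorbs \<open>(1 + M)\<^sup>n\<close>. One
  factor \<open>total_envelope\<close> is kept, because the integration over \<open>t\<close> treats it better than its
  pointwise bound does.
\<close>
lemma sum_weight_le_total_envelope:
  "exp (- c * mass t x) * (\<Sum>js\<in>multi_indices d (Suc n). weight L (\<lambda>j. ends_sum (envelope L) j t (x j)) js)
    \<le> (real n + 2 * (4 * exp (3 / 2) + 2)) ^ n * (fact n * (2 / c) ^ n * exp (c / 2)) * L ^ n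
        * (total_envelope t x * exp (- (c / 2) * mass t x))"
proof -
  let ?B = "4 * exp (3 / 2) + 2 :: real" and ?S = "mass t x" and ?E = "total_envelope t x"
  have B: "0 \<le> ?B" by (simp add: add_nonneg_nonneg)
  have S: "0 \<le> ?S" by (rule mass_nonneg)
  have "real n * L + ?E \<le> L * ((real n + 2 * ?B) * (1 + ?S))"
  proof -
    have "real n * L + ?E \<le> L * (real n + ?B * (?S + 2))" using total_envelope_le[of t x] by (simp add: algebra_simps)
    also have "real n + ?B * (?S + 2) \<le> (real n + 2 * ?B) * (1 + ?S)"
    proof -
      have "0 \<le> real n * ?S + ?B * ?S" using S B by (intro add_nonneg_nonneg mult_nonneg_nonneg) auto
      then show ?thesis by (simp add: algebra_simps)
    qed
    finally show ?thesis using L1 by simp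
  qed
  then have "(real n * L + ?E) ^ n \<le> (L * ((real n + 2 * ?B) * (1 + ?S))) ^ n"
    using L1 total_envelope_nonneg by (intro power_mono) auto
  also have "\<dots> = L ^ n * ((real n + 2 * ?B) ^ n * (1 + ?S) ^ n)" by (simp only: power_mult_distrib)
  also have "(1 + ?S) ^ n \<le> fact n * (2 / c) ^ n * exp (c / 2) * exp (c / 2 * ?S)"
  proof -
    have "(c / 2 * (1 + ?S)) ^ n \<le> fact n * exp (c / 2 * (1 + ?S))"
      using c_pos S by (intro power_le_fact_exp) auto
    then have "(2 / c) ^ n * (c / 2 * (1 + ?S)) ^ n \<le> (2 / c) ^ n * (fact n * exp (c / 2 * (1 + ?S)))"
      using c_pos by (intro mult_left_mono) auto
    moreover have "(2 / c) ^ n * (c / 2 * (1 + ?S)) ^ n = (1 + ?S) ^ n"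
    proof -
      have "2 / c * (c / 2 * (1 + ?S)) = 1 + ?S" using c_pos by simp
      then show ?thesis by (simp only: power_mult_distrib[symmetric])
    qed
    ultimately show ?thesis by (simp add: distrib_left exp_add ac_simps)
  qed
  finally have *: "(real n * L + ?E) ^ n \<le> L ^ n * ((real n + 2 * ?B) ^ n * (fact n * (2 / c) ^ n * exp (c / 2) * exp (c / 2 * ?S)))"
    using L1 B by (simp add: mult_left_mono)
  have "exp (- c * ?S) * (\<Sum>js\<in>multi_indices d (Suc n). weight L (\<lambda>j. ends_sum (envelope L) j t (x j)) js)
    \<le> exp (- c * ?S) * (?E * (real n * L + ?E) ^ n)"
    unfolding total_envelope_def using L1 by (intro mult_left_mono sum_weight_le ends_sum_nonneg envelope_nonneg) auto
  also have "\<dots> \<le> exp (- c * ?S) * (?E * (L ^ n * ((real n + 2 * ?B) ^ n * (fact n * (2 / c) ^ n * exp (c / 2) * exp (c / 2 * ?S)))))"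
    using total_envelope_nonneg by (intro mult_left_mono * ) auto
  also have "\<dots> = (real n + 2 * ?B) ^ n * (fact n * (2 / c) ^ n * exp (c / 2)) * L ^ n * (?E * (exp (- c * ?S) * exp (c / 2 * ?S)))"
    by (simp only: ac_simps)
  also have "exp (- c * ?S) * exp (c / 2 * ?S) = exp (- (c / 2) * ?S)"
    by (simp flip: exp_add)
  finally show ?thesis .
qed

end

section \<open>Integration over the enlargement parameter\<close>

lemma nn_integral_gauss:
  assumes "0 < s"
  shows "(\<integral>\<^sup>+t. ennreal (exp (- ((t - m) / s)\<^sup>2 / 8)) \<partial>lborel) = ennreal (s * sqrt (8 * pi))"
proof -
  have "- ((t - m) / s)\<^sup>2 / 8 = - (1 / (2 * s)\<^sup>2 * (t - m)\<^sup>2) / 2" for t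
    by (simp add: power_divide power_mult_distrib)
  moreover have "sqrt (2 * pi / (1 / (2 * s)\<^sup>2)) = s * sqrt (8 * pi)"
  proof -
    have "2 * pi / (1 / (2 * s)\<^sup>2) = s\<^sup>2 * (8 * pi)" by (simp add: power2_eq_square)
    then show ?thesis using assms by (simp add: real_sqrt_mult)
  qed
  moreover have "0 < 1 / (2 * s)\<^sup>2" using assms by simp
  ultimately show ?thesis using nn_integral_gaussian_line[of "1 / (2 * s)\<^sup>2" m] by (simp only:)
qed

context box_scale
begin

lemma borel_measurable_ends_sum[measurable (raw)]:
  assumes [measurable]: "f \<in> borel_measurable borel"
  shows "(\<lambda>t. ends_sum f j t x) \<in> borel_measurable borel"
  unfolding ends_sum_def upper_def lower_def by measurable

lemma DERIV_mass:
  "((\<lambda>t. mass t x) has_field_derivative - (\<Sum>j<d. ends_sum std_normal_density j t (x j)) / s) (at t)"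
proof -
  have u: "((\<lambda>t. \<Psi> (upper j t y)) has_field_derivative (- std_normal_density (upper j t y) * (1 / s))) (at t)" for j y
    by (rule DERIV_chain2[OF DERIV_Psi]) (use s_pos in \<open>auto simp: upper_def[abs_def] intro!: derivative_eq_intros\<close>)
  have l: "((\<lambda>t. \<Psi> (lower j t y)) has_field_derivative (- std_normal_density (lower j t y) * (1 / s))) (at t)" for j y
    by (rule DERIV_chain2[OF DERIV_Psi]) (use s_pos in \<open>auto simp: lower_def[abs_def] intro!: derivative_eq_intros\<close>)
  have f: "((\<lambda>t. ends_sum \<Psi> j t y) has_field_derivative (- ends_sum std_normal_density j t y / s)) (at t)" for j y
    unfolding ends_sum_def
    by (rule DERIV_cong[OF DERIV_add[OF DERIV_cmult[OF u] DERIV_cmult[OF l]]])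
       (use s_pos in \<open>simp add: field_simps\<close>)
  show ?thesis unfolding mass_def
    by (rule DERIV_cong[OF DERIV_sum[OF f]]) (simp add: sum_negf sum_divide_distrib)
qed

lemma nn_integral_ends_sum_gauss_le:
  "(\<integral>\<^sup>+t. ennreal (ends_sum (\<lambda>u. exp (- u\<^sup>2 / 8)) j t x) \<partial>lborel) \<le> ennreal (2 * (s * sqrt (8 * pi)))"
proof -
  have u: "(\<integral>\<^sup>+t. ennreal (exp (- (upper j t x)\<^sup>2 / 8)) \<partial>lborel) = ennreal (s * sqrt (8 * pi))"
    using nn_integral_gauss[OF s_pos, of "x - b j"] by (simp add: upper_def algebra_simps)
  have l: "(\<integral>\<^sup>+t. ennreal (exp (- (lower j t x)\<^sup>2 / 8)) \<partial>lborel) = ennreal (s * sqrt (8 * pi))"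
    using nn_integral_gauss[OF s_pos, of "a j - x"] by (simp add: lower_def algebra_simps)
  have "(\<integral>\<^sup>+t. ennreal (ends_sum (\<lambda>u. exp (- u\<^sup>2 / 8)) j t x) \<partial>lborel) \<le>
     (\<integral>\<^sup>+t. ennreal (exp (- (upper j t x)\<^sup>2 / 8)) + ennreal (exp (- (lower j t x)\<^sup>2 / 8)) \<partial>lborel)"
    by (intro nn_integral_mono) (auto simp: ends_sum_def ennreal_plus[symmetric] intro!: ennreal_leI simp del: ennreal_plus)
  also have "\<dots> = (\<integral>\<^sup>+t. ennreal (exp (- (upper j t x)\<^sup>2 / 8)) \<partial>lborel) + (\<integral>\<^sup>+t. ennreal (exp (- (lower j t x)\<^sup>2 / 8)) \<partial>lborel)"
    by (rule nn_integral_add) (auto simp: upper_def lower_def)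
  also have "\<dots> = ennreal (2 * (s * sqrt (8 * pi)))"
    unfolding u l using s_pos by (subst ennreal_plus[symmetric]) auto
  finally show ?thesis .
qed

lemma total_envelope_eq:
  "total_envelope t x = (\<Sum>j<d. ends_sum std_normal_density j t (x j))
     + exp (- L\<^sup>2) * (\<Sum>j<d. ends_sum (\<lambda>u. exp (- u\<^sup>2 / 8)) j t (x j))"
proof -
  have "ends_sum (envelope L) j t (x j) = ends_sum std_normal_density j t (x j) + exp (- L\<^sup>2) * ends_sum (\<lambda>u. exp (- u\<^sup>2 / 8)) j t (x j)" for j
    by (simp add: ends_sum_def envelope_def algebra_simps)
  then show ?thesis by (simp add: total_envelope_def sum.distrib sum_distrib_left)
qed

text \<open>
  The density part of \<open>total_envelope\<close> is \<open>- s\<close> times the derivative of \<open>mass\<close> in \<open>t\<close>, so with the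
  exponential factor it is an exact derivative and integrates to at most \<open>s / \<kappa>\<close>, however many
  coordinates there are. The rest consists of at most \<open>2 d\<close> Gaussian functions of width of order
  \<open>s\<close>, each with the prefactor \<open>exp (- L\<^sup>2) \<le> 1 / d\<close>.
\<close>
lemma nn_integral_total_envelope_le:
  assumes "0 < \<kappa>" "0 \<le> T"
  shows "(\<integral>\<^sup>+t. ennreal (total_envelope t x * exp (- \<kappa> * mass t x)) * indicator {0..T} t \<partial>lborel)
    \<le> ennreal (s * (1 / \<kappa> + 2 * sqrt (8 * pi)))"
proof -
  let ?g = "\<lambda>t. \<Sum>j<d. ends_sum std_normal_density j t (x j)"
  let ?h = "\<lambda>t. exp (- L\<^sup>2) * (\<Sum>j<d. ends_sum (\<lambda>u. exp (- u\<^sup>2 / 8)) j t (x j))"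
  have g0: "0 \<le> ?g t" for t by (intro sum_nonneg ends_sum_nonneg) simp
  have h0: "0 \<le> ?h t" for t by (intro sum_nonneg ends_sum_nonneg mult_nonneg_nonneg) simp_all
  have [measurable]: "(\<lambda>t. mass t x) \<in> borel_measurable borel"
    by (intro borel_measurable_continuous_onI continuous_at_imp_continuous_on ballI DERIV_isCont[OF DERIV_mass])
  have D: "((\<lambda>t. s / \<kappa> * exp (- \<kappa> * mass t x)) has_field_derivative ?g t * exp (- \<kappa> * mass t x)) (at t)" for t
    using assms s_pos
    by (auto intro!: derivative_eq_intros DERIV_mass simp: field_simps)
  have "(\<integral>\<^sup>+t. ennreal (?g t * exp (- \<kappa> * mass t x)) * indicator {0..T} t \<partial>lborel) =
    s / \<kappa> * exp (- \<kappa> * mass T x) - s / \<kappa> * exp (- \<kappa> * mass 0 x)"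
    by (rule nn_integral_FTC_Icc[OF _ D]) (use assms g0 in auto)
  also have "\<dots> \<le> ennreal (s / \<kappa>)"
  proof (rule ennreal_leI)
    have "exp (- \<kappa> * mass T x) \<le> 1" using assms mass_nonneg[of T x] by simp
    then have "s / \<kappa> * exp (- \<kappa> * mass T x) \<le> s / \<kappa> * 1" using assms s_pos by (intro mult_left_mono) auto
    moreover have "0 \<le> s / \<kappa> * exp (- \<kappa> * mass 0 x)" using assms s_pos by auto
    ultimately show "s / \<kappa> * exp (- \<kappa> * mass T x) - s / \<kappa> * exp (- \<kappa> * mass 0 x) \<le> s / \<kappa>" by linarith
  qed
  finally have 1: "(\<integral>\<^sup>+t. ennreal (?g t * exp (- \<kappa> * mass t x)) * indicator {0..T} t \<partial>lborel) \<le> ennreal (s / \<kappa>)" .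
  have "(\<integral>\<^sup>+t. ennreal (?h t) \<partial>lborel) =
     ennreal (exp (- L\<^sup>2)) * (\<Sum>j<d. \<integral>\<^sup>+t. ennreal (ends_sum (\<lambda>u. exp (- u\<^sup>2 / 8)) j t (x j)) \<partial>lborel)"
  proof -
    have "ennreal (?h t) = ennreal (exp (- L\<^sup>2)) * (\<Sum>j<d. ennreal (ends_sum (\<lambda>u. exp (- u\<^sup>2 / 8)) j t (x j)))" for t
      by (subst sum_ennreal) (auto intro: ends_sum_nonneg simp: ennreal_mult')
    then show ?thesis by (simp only:) (subst nn_integral_cmult, measurable, subst nn_integral_sum, auto)
  qed
  also have "\<dots> \<le> ennreal (exp (- L\<^sup>2)) * (\<Sum>j<d. ennreal (2 * (s * sqrt (8 * pi))))"
    by (intro mult_left_mono sum_mono nn_integral_ends_sum_gauss_le) auto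
  also have "\<dots> = ennreal ((real d * exp (- L\<^sup>2)) * (2 * (s * sqrt (8 * pi))))"
    using s_pos by (simp add: ennreal_mult' ac_simps ennreal_of_nat_eq_real_of_nat)
  also have "\<dots> \<le> ennreal (1 * (2 * (s * sqrt (8 * pi))))"
    using s_pos dL by (intro ennreal_leI mult_right_mono) auto
  finally have 2: "(\<integral>\<^sup>+t. ennreal (?h t) \<partial>lborel) \<le> ennreal (2 * (s * sqrt (8 * pi)))" by simp
  have "(\<integral>\<^sup>+t. ennreal (total_envelope t x * exp (- \<kappa> * mass t x)) * indicator {0..T} t \<partial>lborel)
    \<le> (\<integral>\<^sup>+t. ennreal (?g t * exp (- \<kappa> * mass t x)) * indicator {0..T} t + ennreal (?h t) \<partial>lborel)"
  proof (rule nn_integral_mono)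
    fix t
    have "?h t * exp (- \<kappa> * mass t x) \<le> ?h t" using assms mass_nonneg[of t x] h0[of t]
      by (intro mult_left_le) auto
    then have "total_envelope t x * exp (- \<kappa> * mass t x) \<le> ?g t * exp (- \<kappa> * mass t x) + ?h t"
      by (simp add: total_envelope_eq distrib_right)
    then have "ennreal (total_envelope t x * exp (- \<kappa> * mass t x)) \<le> ennreal (?g t * exp (- \<kappa> * mass t x) + ?h t)"
      by (rule ennreal_leI)
    also have "\<dots> = ennreal (?g t * exp (- \<kappa> * mass t x)) + ennreal (?h t)"
      by (intro ennreal_plus mult_nonneg_nonneg g0 h0) simp
    finally show "ennreal (total_envelope t x * exp (- \<kappa> * mass t x)) * indicator {0..T} t \<le>
      ennreal (?g t * exp (- \<kappa> * mass t x)) * indicator {0..T} t + ennreal (?h t)"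
      by (auto simp: indicator_def)
  qed
  also have "\<dots> = (\<integral>\<^sup>+t. ennreal (?g t * exp (- \<kappa> * mass t x)) * indicator {0..T} t \<partial>lborel) + (\<integral>\<^sup>+t. ennreal (?h t) \<partial>lborel)"
    by (intro nn_integral_add) measurable
  also have "\<dots> \<le> ennreal (s / \<kappa>) + ennreal (2 * (s * sqrt (8 * pi)))"
    by (intro add_mono 1 2)
  also have "\<dots> = ennreal (s * (1 / \<kappa> + 2 * sqrt (8 * pi)))"
    using assms s_pos by (subst ennreal_plus[symmetric]) (auto simp: distrib_left)
  finally show ?thesis .
qed

end

section \<open>Positive definite matrices and the smallest eigenvalue\<close>

text \<open>
  The bilinear form of \<open>A\<close> on coordinate functions, on which the product measure lives.
\<close>
definition bform :: "nat \<Rightarrow> real mat \<Rightarrow> (nat \<Rightarrow> real) \<Rightarrow> (nat \<Rightarrow> real) \<Rightarrow> real" where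
  "bform d A x y = (\<Sum>i<d. \<Sum>j<d. A $$ (i, j) * x i * y j)"

lemma scalar_prod_mult_mat_vec_eq_bform:
  assumes "A \<in> carrier_mat d d"
  shows "Matrix.vec d x \<bullet> (A *\<^sub>v Matrix.vec d y) = bform d A x y"
  using assms by (auto simp: bform_def scalar_prod_def sum_distrib_left atLeast0LessThan algebra_simps intro!: sum.cong)

lemma vec_nth_eq: "x \<in> carrier_vec d \<Longrightarrow> Matrix.vec d (\<lambda>i. x $ i) = x"
  by (intro eq_vecI) auto

lemma scalar_prod_mult_mat_vec_bform_nth:
  assumes "A \<in> carrier_mat d d" "x \<in> carrier_vec d" "y \<in> carrier_vec d"
  shows "x \<bullet> (A *\<^sub>v y) = bform d A (\<lambda>i. x $ i) (\<lambda>i. y $ i)"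
  using scalar_prod_mult_mat_vec_eq_bform[OF assms(1), of "\<lambda>i. x $ i" "\<lambda>i. y $ i"] assms by (simp add: vec_nth_eq)

lemma scalar_prod_self_nonneg: "0 \<le> (x :: real Matrix.vec) \<bullet> x"
  by (simp add: scalar_prod_def sum_nonneg)

lemma scalar_prod_self_eq_0:
  fixes x :: "real Matrix.vec"
  assumes "x \<in> carrier_vec d"
  shows "x \<bullet> x = 0 \<longleftrightarrow> x = 0\<^sub>v d"
proof
  assume "x \<bullet> x = 0"
  then have "\<forall>i\<in>{0..<d}. x $ i * x $ i = 0"
    using assms by (subst (asm) scalar_prod_def, subst (asm) sum_nonneg_eq_0_iff) auto
  then show "x = 0\<^sub>v d" using assms by (intro eq_vecI) auto
qed (use assms in auto)

lemma symmetric_scalar_prod_mult_mat_vec: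
  fixes S :: "real mat"
  assumes "S \<in> carrier_mat d d" "transpose_mat S = S" "x \<in> carrier_vec d" "y \<in> carrier_vec d"
  shows "x \<bullet> (S *\<^sub>v y) = y \<bullet> (S *\<^sub>v x)"
  using transpose_vec_mult_scalar[OF assms(1,4,3)] assms
  by (metis comm_scalar_prod mult_mat_vec_carrier)

text \<open>
  The minimum of the quadratic form on the unit sphere is attained, by compactness, at some
  \<open>x0\<close>. With \<open>lam\<close> the minimum, the form of \<open>S - lam I\<close> is nonnegative and vanishes at \<open>x0\<close>. Moving
  from \<open>x0\<close> in the direction of \<open>r = S x0 - lam x0\<close> changes it to first order by
  \<open>2 t (r \<bullet> r)\<close>, which would be negative for small \<open>t < 0\<close> unless \<open>r = 0\<close>.
\<close>
lemma exists_eigenvalue_le_quadratic_form: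
  fixes S :: "real mat"
  assumes S: "S \<in> carrier_mat d d" "transpose_mat S = S" and d: "0 < d"
  shows "\<exists>lam. eigenvalue S lam \<and> (\<forall>x\<in>carrier_vec d. lam * (x \<bullet> x) \<le> x \<bullet> (S *\<^sub>v x))"
proof -
  define Q where "Q f = bform d S f f" for f
  define X where "X = (PiE UNIV (\<lambda>i. if i < d then {-1..1::real} else {0})) \<inter> {f. (\<Sum>i<d. f i * f i) = 1}"
  have cts: "continuous_on UNIV (\<lambda>f::nat\<Rightarrow>real. f i)" for i by (rule continuous_on_product_coordinates)
  have "compact (PiE UNIV (\<lambda>i. if i < d then {-1..1::real} else {0}))"
    unfolding compactin_euclidean_iff[symmetric] euclidean_product_topology[symmetric] compactin_PiE by auto
  moreover have "closed {f::nat\<Rightarrow>real. (\<Sum>i<d. f i * f i) = 1}"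
    by (intro closed_Collect_eq continuous_intros cts)
  ultimately have "compact X" unfolding X_def by (rule compact_Int_closed)
  moreover have "(\<lambda>i. if i = 0 then 1 else 0) \<in> X"
  proof -
    have "(\<Sum>i<d. (if i = 0 then 1 else 0) * (if i = 0 then 1 else 0 :: real)) = (\<Sum>i<d. if i = 0 then 1 else 0)"
      by (intro sum.cong) auto
    then show ?thesis using d by (auto simp: X_def PiE_iff)
  qed
  moreover have "continuous_on X Q" unfolding Q_def bform_def
    by (intro continuous_intros continuous_on_subset[OF cts]) auto
  ultimately obtain f0 where f0: "f0 \<in> X" "\<And>f. f \<in> X \<Longrightarrow> Q f0 \<le> Q f"
    using continuous_attains_inf[of X Q] by blast
  define lam where "lam = Q f0"
  define x0 where "x0 = Matrix.vec d f0"
  have x0[simp]: "x0 \<in> carrier_vec d" by (simp add: x0_def)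
  have x00: "x0 \<bullet> x0 = 1" using f0(1) by (simp add: x0_def scalar_prod_def X_def atLeast0LessThan)
  have x0S: "x0 \<bullet> (S *\<^sub>v x0) = lam" unfolding x0_def lam_def Q_def
    by (rule scalar_prod_mult_mat_vec_eq_bform[OF S(1)])
  have min: "lam * (x \<bullet> x) \<le> x \<bullet> (S *\<^sub>v x)" if x: "x \<in> carrier_vec d" for x
  proof (cases "x \<bullet> x = 0")
    case True
    then have "x = 0\<^sub>v d" using scalar_prod_self_eq_0[OF x] by simp
    then show ?thesis using S by simp
  next
    case False
    have sq: "x \<bullet> x = (\<Sum>i<d. (x $ i)\<^sup>2)" using x by (simp add: scalar_prod_def power2_eq_square atLeast0LessThan)
    define r where "r = sqrt (x \<bullet> x)"
    have "0 \<le> x \<bullet> x" unfolding sq by (intro sum_nonneg) auto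
    then have r: "0 < r" "r * r = x \<bullet> x" using False by (auto simp: r_def)
    define f where "f i = (if i < d then x $ i / r else 0)" for i
    have s1: "(\<Sum>i<d. f i * f i) = 1"
    proof -
      have "(\<Sum>i<d. f i * f i) = (\<Sum>i<d. (x $ i)\<^sup>2) / (r * r)"
        by (simp add: f_def power2_eq_square sum_divide_distrib)
      then show ?thesis using r False by (simp add: sq[symmetric])
    qed
    have "\<bar>f i\<bar> \<le> 1" if "i < d" for i
    proof -
      have "f i * f i \<le> (\<Sum>i<d. f i * f i)" using that by (intro member_le_sum) auto
      then show ?thesis unfolding s1 using abs_square_le_1[of "f i"] by (simp add: power2_eq_square)
    qed
    note f1 = this
    have "- 1 \<le> f i \<and> f i \<le> 1" if "i < d" for i using f1[OF that] by linarith
    moreover have "f i = 0" if "\<not> i < d" for i using that by (simp add: f_def)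
    ultimately have "f \<in> X" using s1 by (auto simp: X_def PiE_iff)
    then have "lam \<le> Q f" unfolding lam_def by (rule f0(2))
    also have "Q f = (x \<bullet> (S *\<^sub>v x)) / (r * r)"
      unfolding scalar_prod_mult_mat_vec_bform_nth[OF S(1) x x]
      by (simp add: Q_def bform_def f_def sum_divide_distrib)
    finally have "lam \<le> (x \<bullet> (S *\<^sub>v x)) / (r * r)" .
    moreover have "0 < r * r" by (intro mult_pos_pos r(1))
    ultimately have "lam * (r * r) \<le> x \<bullet> (S *\<^sub>v x)" by (simp only: pos_le_divide_eq)
    then show ?thesis using r by simp
  qed
  define r where "r = S *\<^sub>v x0 - lam \<cdot>\<^sub>v x0"
  have r[simp]: "r \<in> carrier_vec d" using S by (simp add: r_def)
  have Sx0[simp]: "S *\<^sub>v x0 \<in> carrier_vec d" using S by simp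
  note sym = symmetric_scalar_prod_mult_mat_vec[OF S]
  have "r \<bullet> r = 0"
  proof (rule ccontr)
    assume nz: "r \<bullet> r \<noteq> 0"
    have "0 \<le> r \<bullet> r" by (rule scalar_prod_self_nonneg)
    then have pos: "0 < r \<bullet> r" using nz by simp
    define B where "B = r \<bullet> (S *\<^sub>v r) - lam * (r \<bullet> r)"
    have q: "0 \<le> 2 * t * (r \<bullet> r) + t\<^sup>2 * B" for t
    proof -
      let ?x = "x0 + t \<cdot>\<^sub>v r"
      have Sr: "S *\<^sub>v r \<in> carrier_vec d" using S by simp
      have c1: "?x \<bullet> ?x = x0 \<bullet> x0 + 2 * t * (r \<bullet> x0) + t\<^sup>2 * (r \<bullet> r)"
        by (simp add: add_scalar_prod_distrib[of _ d] scalar_prod_add_distrib[of _ d] smult_scalar_prod_distrib[of _ d] scalar_prod_smult_distrib[of _ d] comm_scalar_prod[of x0 d r] power2_eq_square algebra_simps)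
      have "S *\<^sub>v ?x = S *\<^sub>v x0 + t \<cdot>\<^sub>v (S *\<^sub>v r)"
        using S by (simp add: mult_add_distrib_mat_vec[of _ d d] mult_mat_vec[of _ d d])
      then have c2: "?x \<bullet> (S *\<^sub>v ?x) = x0 \<bullet> (S *\<^sub>v x0) + 2 * t * (r \<bullet> (S *\<^sub>v x0)) + t\<^sup>2 * (r \<bullet> (S *\<^sub>v r))"
        using Sr by (simp add: add_scalar_prod_distrib[of _ d] scalar_prod_add_distrib[of _ d] smult_scalar_prod_distrib[of _ d] scalar_prod_smult_distrib[of _ d] sym[of x0 r] power2_eq_square algebra_simps)
      have c3: "r \<bullet> (S *\<^sub>v x0) - lam * (r \<bullet> x0) = r \<bullet> r"
        by (subst (4) r_def) (simp add: scalar_prod_minus_distrib[of _ d] scalar_prod_smult_distrib[of _ d])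
      have "lam * (?x \<bullet> ?x) \<le> ?x \<bullet> (S *\<^sub>v ?x)" by (intro min) simp
      then have "0 \<le> 2 * t * (r \<bullet> (S *\<^sub>v x0) - lam * (r \<bullet> x0)) + t\<^sup>2 * B"
        unfolding c1 c2 x00 x0S B_def by (simp add: algebra_simps)
      then show ?thesis unfolding c3 .
    qed
    \<comment> \<open>Small enough that the quadratic term cannot compensate the linear one.\<close>
    define t where "t = - (r \<bullet> r) / (1 + \<bar>B\<bar>)"
    have t: "t < 0" using pos by (simp add: t_def divide_neg_pos)
    have "- (t * B) \<le> \<bar>t\<bar> * \<bar>B\<bar>" by (metis abs_ge_minus_self abs_mult)
    also have "\<dots> < \<bar>t\<bar> * (1 + \<bar>B\<bar>)" using t by (intro mult_strict_left_mono) auto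
    also have "\<dots> = r \<bullet> r" using pos by (simp add: t_def abs_divide)
    finally have "0 < 2 * (r \<bullet> r) + t * B" using pos by linarith
    then have "t * (2 * (r \<bullet> r) + t * B) < 0" using t by (simp add: mult_neg_pos)
    then show False using q[of t] by (simp add: power2_eq_square algebra_simps)
  qed
  then have r0: "r = 0\<^sub>v d" using scalar_prod_self_eq_0[OF r] by simp
  have "S *\<^sub>v x0 = lam \<cdot>\<^sub>v x0"
  proof (intro eq_vecI)
    fix i assume i': "i < dim_vec (lam \<cdot>\<^sub>v x0)"
    then have i: "i < d" using x0 by (simp only: index_smult_vec carrier_vecD)
    have "r $ i = (S *\<^sub>v x0) $ i - (lam \<cdot>\<^sub>v x0) $ i" unfolding r_def by (rule index_minus_vec(1)[OF i'])
    then show "(S *\<^sub>v x0) $ i = (lam \<cdot>\<^sub>v x0) $ i" using r0 i by simp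
  qed (simp only: dim_mult_mat_vec index_smult_vec carrier_vecD[OF x0] carrier_matD[OF S(1)])
  moreover have "x0 \<noteq> 0\<^sub>v d" using x00 by auto
  ultimately have "eigenvalue S lam" using S by (auto simp: eigenvalue_def eigenvector_def intro!: exI[of _ x0])
  then show ?thesis using min by blast
qed


lemma sigma_star_properties:
  assumes S: "symmetric_pos_def d S" and d: "0 < d"
  shows "0 < sigma_star S"
    and "x \<in> carrier_vec d \<Longrightarrow> (sigma_star S)\<^sup>2 * (x \<bullet> x) \<le> x \<bullet> (S *\<^sub>v x)"
proof -
  have S': "S \<in> carrier_mat d d" "transpose_mat S = S" using S by (auto simp: symmetric_pos_def_def)
  obtain l where l: "eigenvalue S l" "\<And>x. x\<in>carrier_vec d \<Longrightarrow> l * (x \<bullet> x) \<le> x \<bullet> (S *\<^sub>v x)"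
    using exists_eigenvalue_le_quadratic_form[OF S' d] by blast
  have fin: "finite (spectrum S)" by (rule card_finite_spectrum[OF S'(1)])
  have ne: "l \<in> spectrum S" using l by (simp add: spectrum_def)
  have pos: "0 < k" if "k \<in> spectrum S" for k
  proof -
    from that obtain v where v: "v \<in> carrier_vec d" "v \<noteq> 0\<^sub>v d" "S *\<^sub>v v = k \<cdot>\<^sub>v v"
      using S' by (auto simp: spectrum_def eigenvalue_def eigenvector_def)
    have "0 < v \<bullet> (S *\<^sub>v v)" using S v by (auto simp: symmetric_pos_def_def)
    then have "0 < k * (v \<bullet> v)" using v by simp
    then show ?thesis using scalar_prod_self_nonneg[of v] by (simp add: zero_less_mult_iff)
  qed
  have m: "Min (spectrum S) \<in> spectrum S" "Min (spectrum S) \<le> l" using fin ne by (auto intro: Min_in)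
  then have p: "0 < Min (spectrum S)" using pos by blast
  then show "0 < sigma_star S" by (simp add: sigma_star_def)
  assume x: "x \<in> carrier_vec d"
  have "(sigma_star S)\<^sup>2 * (x \<bullet> x) = Min (spectrum S) * (x \<bullet> x)" using p by (simp add: sigma_star_def)
  also have "\<dots> \<le> l * (x \<bullet> x)" using m scalar_prod_self_nonneg by (intro mult_right_mono) auto
  also have "\<dots> \<le> x \<bullet> (S *\<^sub>v x)" by (rule l(2)[OF x])
  finally show "(sigma_star S)\<^sup>2 * (x \<bullet> x) \<le> x \<bullet> (S *\<^sub>v x)" .
qed

lemma symmetric_pos_def_inverse:
  assumes A: "symmetric_pos_def d A"
  shows "\<exists>B. mat_inverse A = Some B \<and> A * B = 1\<^sub>m d \<and> B * A = 1\<^sub>m d \<and> symmetric_pos_def d B"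
proof -
  have A': "A \<in> carrier_mat d d" "transpose_mat A = A" using A by (auto simp: symmetric_pos_def_def)
  have "Determinant.det A \<noteq> 0"
  proof
    assume "Determinant.det A = 0"
    then obtain v where v: "v \<in> carrier_vec d" "v \<noteq> 0\<^sub>v d" "A *\<^sub>v v = 0\<^sub>v d"
      using det_0_iff_vec_prod_zero_field[OF A'(1)] by auto
    have "0 < v \<bullet> (A *\<^sub>v v)" using A v by (auto simp: symmetric_pos_def_def)
    then show False using v by simp
  qed
  then have "A \<in> Units (ring_mat TYPE(real) d ())"
    by (rule det_non_zero_imp_unit[OF A'(1)])
  then obtain B where B: "mat_inverse A = Some B" using mat_inverse(1)[OF A'(1), where b = "()"] by (cases "mat_inverse A") auto
  have B': "A * B = 1\<^sub>m d" "B * A = 1\<^sub>m d" "B \<in> carrier_mat d d" using mat_inverse(2)[OF A'(1) B] by auto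
  have BtA: "transpose_mat B * A = 1\<^sub>m d"
    using transpose_mult[OF A'(1) B'(3)] unfolding A'(2) B'(1) by simp
  have "transpose_mat B = transpose_mat B * (A * B)" using B' by simp
  also have "\<dots> = (transpose_mat B * A) * B" using A' B' by (simp add: assoc_mult_mat[of _ d d _ d _ d])
  also have "\<dots> = B" using BtA B' by simp
  finally have Bt: "transpose_mat B = B" .
  have "0 < x \<bullet> (B *\<^sub>v x)" if x: "x \<in> carrier_vec d" "x \<noteq> 0\<^sub>v d" for x
  proof -
    let ?y = "B *\<^sub>v x"
    have y: "?y \<in> carrier_vec d" using B' x by simp
    have Ay: "A *\<^sub>v ?y = x" using A' B' x by (simp add: assoc_mult_mat_vec[of _ d d _ d, symmetric])
    moreover have "A *\<^sub>v 0\<^sub>v d = 0\<^sub>v d" using A' by (intro eq_vecI) auto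
    ultimately have "?y \<noteq> 0\<^sub>v d" using x by auto
    then have "0 < ?y \<bullet> (A *\<^sub>v ?y)" using A y by (auto simp: symmetric_pos_def_def)
    then show ?thesis unfolding Ay using x y by (simp add: comm_scalar_prod)
  qed
  then have "symmetric_pos_def d B" using B' Bt by (auto simp: symmetric_pos_def_def)
  then show ?thesis using B B' by blast
qed

text \<open>
  With \<open>y = P x\<close>, expand \<open>0 \<le> \<bar>x - l y\<bar>\<^sup>2\<close> and use \<open>l \<bar>y\<bar>\<^sup>2 \<le> y \<bullet> S y = x \<bullet> y\<close>.
\<close>
lemma quadratic_form_inverse_le:
  fixes S :: "real mat"
  assumes S: "S \<in> carrier_mat d d" and P: "P \<in> carrier_mat d d" "S * P = 1\<^sub>m d"
    and l: "0 < l" "\<And>x. x \<in> carrier_vec d \<Longrightarrow> l * (x \<bullet> x) \<le> x \<bullet> (S *\<^sub>v x)"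
    and x: "x \<in> carrier_vec d"
  shows "l * (x \<bullet> (P *\<^sub>v x)) \<le> x \<bullet> x"
proof -
  let ?y = "P *\<^sub>v x"
  have y[simp]: "?y \<in> carrier_vec d" using P x by simp
  have Sy: "S *\<^sub>v ?y = x" using S P x by (simp add: assoc_mult_mat_vec[of _ d d _ d, symmetric])
  have "0 \<le> (x - l \<cdot>\<^sub>v ?y) \<bullet> (x - l \<cdot>\<^sub>v ?y)" by (rule scalar_prod_self_nonneg)
  also have "\<dots> = x \<bullet> x - 2 * l * (x \<bullet> ?y) + l * (l * (?y \<bullet> ?y))"
    using x by (simp add: minus_scalar_prod_distrib[of _ d] scalar_prod_minus_distrib[of _ d] smult_scalar_prod_distrib[of _ d] comm_scalar_prod[of ?y d x] algebra_simps)
  also have "l * (l * (?y \<bullet> ?y)) \<le> l * (?y \<bullet> (S *\<^sub>v ?y))" using l by (intro mult_left_mono) auto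
  also have "?y \<bullet> (S *\<^sub>v ?y) = x \<bullet> ?y" unfolding Sy by (rule comm_scalar_prod[OF y x])
  finally show ?thesis by simp
qed

text \<open>
  If \<open>P\<close> is the inverse of \<open>S\<close>, this is the covariance matrix of \<open>u\<close> given \<open>z = u + t g\<close>, where \<open>u\<close>
  has the law \<open>N(0, S - t\<^sup>2 I)\<close>, independent of the standard normal \<open>g\<close>. By the assumption its form is at
  least \<open>3 / 4 * t\<^sup>2 * \<bar>x\<bar>\<^sup>2\<close>.
\<close>
lemma symmetric_pos_def_sub_inverse:
  assumes P: "symmetric_pos_def d P" and t: "0 < t" 
    and le: "\<And>x. x \<in> carrier_vec d \<Longrightarrow> 4 * t\<^sup>2 * (x \<bullet> (P *\<^sub>v x)) \<le> x \<bullet> x"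
  shows "symmetric_pos_def d (t\<^sup>2 \<cdot>\<^sub>m 1\<^sub>m d - t ^ 4 \<cdot>\<^sub>m P)" (is "symmetric_pos_def d ?N")
    and "bform d (t\<^sup>2 \<cdot>\<^sub>m 1\<^sub>m d - t ^ 4 \<cdot>\<^sub>m P) x x = t\<^sup>2 * (\<Sum>i<d. (x i)\<^sup>2) - t ^ 4 * bform d P x x"
proof -
  have P': "P \<in> carrier_mat d d" "transpose_mat P = P" using P by (auto simp: symmetric_pos_def_def)
  have N: "?N \<in> carrier_mat d d" using P' by (intro minus_carrier_mat) auto
  have Nt: "transpose_mat ?N = ?N" 
  proof (rule eq_matI)
    fix i j assume "i < dim_row ?N" "j < dim_col ?N"
    then have ij: "i < d" "j < d" using P' by auto
    have "P $$ (j, i) = transpose_mat P $$ (i, j)" using ij P'(1) by simp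
    then show "transpose_mat ?N $$ (i, j) = ?N $$ (i, j)" using ij P' by auto
  qed (use P' in auto)
  have bf: "bform d ?N x x = t\<^sup>2 * (\<Sum>i<d. (x i)\<^sup>2) - t ^ 4 * bform d P x x" for x
  proof -
    have "bform d ?N x x = (\<Sum>i<d. \<Sum>j<d. (if j = i then t\<^sup>2 * (x i)\<^sup>2 else 0) - t ^ 4 * (P $$ (i, j) * x i * x j))"
      unfolding bform_def using P'(1) by (intro sum.cong refl) (auto simp: power2_eq_square algebra_simps)
    then show ?thesis by (simp add: sum_subtractf bform_def sum_distrib_left)
  qed
  then show "bform d ?N x x = t\<^sup>2 * (\<Sum>i<d. (x i)\<^sup>2) - t ^ 4 * bform d P x x" .
  have "0 < x \<bullet> (?N *\<^sub>v x)" if x: "x \<in> carrier_vec d" "x \<noteq> 0\<^sub>v d" for x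
  proof -
    have xx: "x \<bullet> x = (\<Sum>i<d. (x $ i)\<^sup>2)" using x by (simp add: scalar_prod_def power2_eq_square atLeast0LessThan)
    have "x \<bullet> x \<noteq> 0" using x scalar_prod_self_eq_0 by blast
    then have pos: "0 < x \<bullet> x" using scalar_prod_self_nonneg[of x] by simp
    have 1: "x \<bullet> (?N *\<^sub>v x) = t\<^sup>2 * (x \<bullet> x) - t ^ 4 * (x \<bullet> (P *\<^sub>v x))"
      unfolding scalar_prod_mult_mat_vec_bform_nth[OF N x(1) x(1)] bf xx scalar_prod_mult_mat_vec_bform_nth[OF P'(1) x(1) x(1)] ..
    have "t ^ 4 * (x \<bullet> (P *\<^sub>v x)) = t\<^sup>2 / 4 * (4 * t\<^sup>2 * (x \<bullet> (P *\<^sub>v x)))" by (simp add: power4_eq_xxxx power2_eq_square)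
    also have "\<dots> \<le> t\<^sup>2 / 4 * (x \<bullet> x)" by (intro mult_left_mono le x) auto
    finally have "t\<^sup>2 * (x \<bullet> x) - t\<^sup>2 / 4 * (x \<bullet> x) \<le> x \<bullet> (?N *\<^sub>v x)" using 1 by linarith
    moreover have "t\<^sup>2 * (x \<bullet> x) - t\<^sup>2 / 4 * (x \<bullet> x) = 3 / 4 * (t\<^sup>2 * (x \<bullet> x))" by simp
    moreover have "0 < t\<^sup>2 * (x \<bullet> x)" using pos t by simp
    ultimately show ?thesis by linarith
  qed
  then show "symmetric_pos_def d ?N" using N Nt by (auto simp: symmetric_pos_def_def)
qed

section \<open>The Gaussian integral of a quadratic form\<close>

lemma bform_Suc:
  assumes "\<And>i. i < n \<Longrightarrow> A $$ (n, i) = A $$ (i, n)"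
  shows "bform (Suc n) A x x = bform n A x x + 2 * x n * (\<Sum>i<n. A $$ (i, n) * x i) + A $$ (n, n) * (x n)\<^sup>2"
  using assms
  by (simp add: bform_def sum.distrib sum_distrib_left power2_eq_square algebra_simps)

lemma symmetric_pos_def_iff_bform:
  "symmetric_pos_def d A \<longleftrightarrow> A \<in> carrier_mat d d \<and> (\<forall>i<d. \<forall>j<d. A $$ (i, j) = A $$ (j, i)) \<and>
     (\<forall>x. (\<exists>i<d. x i \<noteq> 0) \<longrightarrow> 0 < bform d A x x)"
proof (cases "A \<in> carrier_mat d d")
  case A: True
  have "transpose_mat A = A \<longleftrightarrow> (\<forall>i<d. \<forall>j<d. A $$ (i, j) = A $$ (j, i))"
  proof
    assume "transpose_mat A = A"
    then show "\<forall>i<d. \<forall>j<d. A $$ (i, j) = A $$ (j, i)" using A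
      by (metis carrier_matD index_transpose_mat(1))
  qed (use A in \<open>auto intro!: eq_matI\<close>)
  moreover have "(\<forall>x\<in>carrier_vec d. x \<noteq> 0\<^sub>v d \<longrightarrow> 0 < x \<bullet> (A *\<^sub>v x)) \<longleftrightarrow>
    (\<forall>x. (\<exists>i<d. x i \<noteq> 0) \<longrightarrow> 0 < bform d A x x)" (is "?l \<longleftrightarrow> ?r")
  proof
    assume l: ?l
    show ?r
    proof (intro allI impI)
      fix x :: "nat \<Rightarrow> real" assume "\<exists>i<d. x i \<noteq> 0"
      then obtain i where "i < d" "x i \<noteq> 0" by blast
      then have "Matrix.vec d x $ i \<noteq> 0\<^sub>v d $ i" by simp
      then have "Matrix.vec d x \<noteq> 0\<^sub>v d" by metis
      then have "0 < Matrix.vec d x \<bullet> (A *\<^sub>v Matrix.vec d x)" using l by simp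
      then show "0 < bform d A x x" by (simp only: scalar_prod_mult_mat_vec_eq_bform[OF A])
    qed
  next
    assume r: ?r
    show ?l
    proof (intro ballI impI)
      fix x :: "real Matrix.vec" assume x: "x \<in> carrier_vec d" "x \<noteq> 0\<^sub>v d"
      have "\<exists>i<d. x $ i \<noteq> 0"
      proof (rule ccontr)
        assume "\<not> ?thesis"
        then have "x = 0\<^sub>v d" using x(1) by (intro eq_vecI) auto
        with x show False by simp
      qed
      then show "0 < x \<bullet> (A *\<^sub>v x)" using r by (simp only: scalar_prod_mult_mat_vec_bform_nth[OF A x(1) x(1)])
    qed
  qed
  ultimately show ?thesis using A by (simp add: symmetric_pos_def_def)
qed (simp add: symmetric_pos_def_def)

text \<open>
  The complement of the last diagonal entry, that is, the form left over when the square in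
  the last coordinate is completed.
\<close>
definition schur_complement :: "nat \<Rightarrow> real mat \<Rightarrow> real mat" where
  "schur_complement n A = mat n n (\<lambda>(i, j). A $$ (i, j) - A $$ (i, n) * A $$ (j, n) / A $$ (n, n))"

lemma bform_schur_complement:
  "bform n (schur_complement n A) x x = bform n A x x - (\<Sum>i<n. A $$ (i, n) * x i)\<^sup>2 / A $$ (n, n)"
proof -
  have "bform n (schur_complement n A) x x = (\<Sum>i<n. \<Sum>j<n. A $$ (i, j) * x i * x j - (A $$ (i, n) * x i) * (A $$ (j, n) * x j) / A $$ (n, n))"
    unfolding bform_def by (intro sum.cong refl) (auto simp: schur_complement_def algebra_simps)
  also have "\<dots> = bform n A x x - (\<Sum>i<n. \<Sum>j<n. (A $$ (i, n) * x i) * (A $$ (j, n) * x j)) / A $$ (n, n)"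
    by (simp add: bform_def sum_subtractf sum_divide_distrib)
  finally show ?thesis by (simp add: power2_eq_square sum_product)
qed

lemma
  assumes A: "symmetric_pos_def (Suc n) A"
  shows pivot_pos: "0 < A $$ (n, n)"
    and bform_complete_square: "bform (Suc n) A x x =
      A $$ (n, n) * (x n + (\<Sum>i<n. A $$ (i, n) * x i) / A $$ (n, n))\<^sup>2 + bform n (schur_complement n A) x x"
    and symmetric_pos_def_schur_complement: "symmetric_pos_def n (schur_complement n A)"
    and det_schur_complement: "Determinant.det A = Determinant.det (schur_complement n A) * A $$ (n, n)"
proof -
  let ?c = "A $$ (n, n)"
  have A': "A \<in> carrier_mat (Suc n) (Suc n)" "\<And>i j. i < Suc n \<Longrightarrow> j < Suc n \<Longrightarrow> A $$ (i, j) = A $$ (j, i)"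
    "\<And>x i. i < Suc n \<Longrightarrow> x i \<noteq> 0 \<Longrightarrow> 0 < bform (Suc n) A x x"
    using A unfolding symmetric_pos_def_iff_bform by blast+
  have sym: "A $$ (n, i) = A $$ (i, n)" if "i < n" for i using that A'(2)[of n i] by simp
  have "0 < bform (Suc n) A (\<lambda>i. if i = n then 1 else 0) (\<lambda>i. if i = n then 1 else 0)"
    by (rule A'(3)[of n]) auto
  then show c: "0 < ?c" using sym by (simp add: bform_Suc) (simp add: bform_def)
  show sq: "bform (Suc n) A x x = ?c * (x n + (\<Sum>i<n. A $$ (i, n) * x i) / ?c)\<^sup>2 + bform n (schur_complement n A) x x" for x
  proof -
    define B where "B = (\<Sum>i<n. A $$ (i, n) * x i)"
    have "?c * (x n + B / ?c)\<^sup>2 = ?c * (x n)\<^sup>2 + 2 * x n * B + B\<^sup>2 / ?c" using c by (simp add: power2_eq_square field_simps)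
    then show ?thesis using sym by (simp add: bform_Suc bform_schur_complement flip: B_def)
  qed
  show "symmetric_pos_def n (schur_complement n A)"
    unfolding symmetric_pos_def_iff_bform
  proof (intro conjI allI impI)
    show "schur_complement n A \<in> carrier_mat n n" by (simp add: schur_complement_def)
    fix i j assume "i < n" "j < n"
    then show "schur_complement n A $$ (i, j) = schur_complement n A $$ (j, i)"
      using A'(2)[of i j] by (simp add: schur_complement_def)
  next
    fix x :: "nat \<Rightarrow> real" assume "\<exists>i<n. x i \<noteq> 0"
    then obtain i where i: "i < n" "x i \<noteq> 0" by blast
    \<comment> \<open>The last coordinate that makes the completed square vanish.\<close>
    define y where "y = x(n := - (\<Sum>i<n. A $$ (i, n) * x i) / ?c)"
    have "(\<Sum>i<n. A $$ (i, n) * y i) = (\<Sum>i<n. A $$ (i, n) * x i)" by (intro sum.cong) (auto simp: y_def)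
    then have "bform (Suc n) A y y = bform n (schur_complement n A) y y"
      unfolding sq by (simp add: y_def)
    also have "\<dots> = bform n (schur_complement n A) x x" by (simp add: bform_def y_def)
    finally show "0 < bform n (schur_complement n A) x x" using A'(3)[of i y] i by (simp add: y_def)
  qed
  let ?S = "schur_complement n A"
  define B where "B = mat n 1 (\<lambda>(i, j). A $$ (i, n))"
  define C where "C = mat 1 n (\<lambda>(i, j). A $$ (j, n) / ?c)"
  define D where "D = mat 1 1 (\<lambda>(i, j). ?c)"
  have cs: "?S \<in> carrier_mat n n" "B \<in> carrier_mat n 1" "C \<in> carrier_mat 1 n" "D \<in> carrier_mat 1 1"
    by (auto simp: B_def C_def D_def schur_complement_def)
  have "A = four_block_mat ?S B (0\<^sub>m 1 n) D * four_block_mat (1\<^sub>m n) (0\<^sub>m n 1) C (1\<^sub>m 1)"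
  proof -
    have "four_block_mat ?S B (0\<^sub>m 1 n) D * four_block_mat (1\<^sub>m n) (0\<^sub>m n 1) C (1\<^sub>m 1) =
      four_block_mat (?S * 1\<^sub>m n + B * C) (?S * 0\<^sub>m n 1 + B * 1\<^sub>m 1) (0\<^sub>m 1 n * 1\<^sub>m n + D * C) (0\<^sub>m 1 n * 0\<^sub>m n 1 + D * 1\<^sub>m 1)"
      using cs by (intro mult_four_block_mat) auto
    also have "\<dots> = A"
    proof (rule eq_matI)
      fix i j assume "i < dim_row A" "j < dim_col A"
      then have ij: "i < Suc n" "j < Suc n" using A'(1) by auto
      show "four_block_mat (?S * 1\<^sub>m n + B * C) (?S * 0\<^sub>m n 1 + B * 1\<^sub>m 1) (0\<^sub>m 1 n * 1\<^sub>m n + D * C) (0\<^sub>m 1 n * 0\<^sub>m n 1 + D * 1\<^sub>m 1) $$ (i, j) = A $$ (i, j)"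
        using ij cs c sym by (cases "i < n"; cases "j < n")
          (auto simp: less_Suc_eq B_def C_def D_def schur_complement_def scalar_prod_def)
    qed (use A' cs in auto)
    finally show ?thesis by simp
  qed
  then have "Determinant.det A = Determinant.det (four_block_mat ?S B (0\<^sub>m 1 n) D * four_block_mat (1\<^sub>m n) (0\<^sub>m n 1) C (1\<^sub>m 1))"
    by (rule arg_cong)
  also have "\<dots> = Determinant.det (four_block_mat ?S B (0\<^sub>m 1 n) D) * Determinant.det (four_block_mat (1\<^sub>m n) (0\<^sub>m n 1) C (1\<^sub>m 1))"
    using cs by (intro det_mult[of _ "n + 1"] four_block_carrier_mat) auto
  also have "Determinant.det (four_block_mat ?S B (0\<^sub>m 1 n) D) = Determinant.det ?S * Determinant.det D"
    using cs by (intro det_four_block_mat_lower_left_zero) auto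
  also have "Determinant.det D = ?c" by (subst det_single) (auto simp: D_def)
  also have "Determinant.det (four_block_mat (1\<^sub>m n) (0\<^sub>m n 1) C (1\<^sub>m 1)) = Determinant.det (1\<^sub>m n :: real mat) * Determinant.det (1\<^sub>m 1 :: real mat)"
    using cs by (intro det_four_block_mat_upper_right_zero) auto
  finally show "Determinant.det A = Determinant.det ?S * ?c" by simp
qed

abbreviation lborel_on :: "nat \<Rightarrow> (nat \<Rightarrow> real) measure" where
  "lborel_on d \<equiv> \<Pi>\<^sub>M i\<in>{..<d}. lborel"

interpretation lborel_product: product_sigma_finite "\<lambda>_::nat. lborel :: real measure"
  by standard

lemma borel_measurable_bform[measurable (raw)]:
  assumes "\<And>i. i < d \<Longrightarrow> (\<lambda>\<omega>. f \<omega> i) \<in> borel_measurable M" "\<And>i. i < d \<Longrightarrow> (\<lambda>\<omega>. g \<omega> i) \<in> borel_measurable M"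
  shows "(\<lambda>\<omega>. bform d A (f \<omega>) (g \<omega>)) \<in> borel_measurable M"
  unfolding bform_def using assms by (intro borel_measurable_sum borel_measurable_times) auto

text \<open>
  Induction on the dimension: integrate the last coordinate by completing the square. The
  centre \<open>a\<close> is general because completing a square in all variables moves it.
\<close>
lemma gaussian_integral:
  assumes "symmetric_pos_def d A"
  shows "0 < Determinant.det A \<and> (\<integral>\<^sup>+x. ennreal (exp (- bform d A (\<lambda>i. x i - a i) (\<lambda>i. x i - a i) / 2)) \<partial>lborel_on d)
    = ennreal (sqrt ((2 * pi) ^ d / Determinant.det A))"
  using assms
proof (induction d arbitrary: A)
  case 0
  then have "Determinant.det A = 1" by (auto simp: symmetric_pos_def_def intro!: det_dim_zero)
  then show ?case by (simp add: bform_def space_PiM_empty)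
next
  case (Suc n)
  let ?c = "A $$ (n, n)" and ?S = "schur_complement n A"
  note c = pivot_pos[OF Suc.prems] and sq = bform_complete_square[OF Suc.prems]
    and S = symmetric_pos_def_schur_complement[OF Suc.prems] and det = det_schur_complement[OF Suc.prems]
  note IH = Suc.IH[OF S]
  let ?y = "\<lambda>x i. x i - a i :: real"
  let ?l = "\<lambda>x. (\<Sum>i<n. A $$ (i, n) * ?y x i) / ?c"
  have "(\<integral>\<^sup>+x. ennreal (exp (- bform (Suc n) A (?y x) (?y x) / 2)) \<partial>lborel_on (Suc n)) =
    (\<integral>\<^sup>+x. \<integral>\<^sup>+t. ennreal (exp (- bform (Suc n) A (?y (x(n := t))) (?y (x(n := t))) / 2)) \<partial>lborel \<partial>lborel_on n)"
  proof -
    have "(\<lambda>x. bform (Suc n) A (?y x) (?y x)) \<in> borel_measurable (lborel_on (Suc n))"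
      by (intro borel_measurable_bform) measurable
    then have "(\<lambda>x. ennreal (exp (- bform (Suc n) A (?y x) (?y x) / 2))) \<in> borel_measurable (lborel_on (Suc n))"
      by measurable
    then show ?thesis unfolding lessThan_Suc
      by (intro lborel_product.product_nn_integral_insert) auto
  qed
  also have "\<dots> = (\<integral>\<^sup>+x. ennreal (exp (- bform n ?S (?y x) (?y x) / 2)) * ennreal (sqrt (2 * pi / ?c)) \<partial>lborel_on n)"
  proof (rule nn_integral_cong)
    fix x
    have "exp (- bform (Suc n) A (?y (x(n := t))) (?y (x(n := t))) / 2) =
       exp (- bform n ?S (?y x) (?y x) / 2) * exp (- (?c * (t - (a n - ?l x))\<^sup>2) / 2)" for t
    proof -
      have "(\<Sum>i<n. A $$ (i, n) * ?y (x(n := t)) i) = (\<Sum>i<n. A $$ (i, n) * ?y x i)" by (intro sum.cong) auto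
      moreover have "bform n ?S (?y (x(n := t))) (?y (x(n := t))) = bform n ?S (?y x) (?y x)"
        by (simp add: bform_def)
      ultimately have "bform (Suc n) A (?y (x(n := t))) (?y (x(n := t))) = ?c * (t - (a n - ?l x))\<^sup>2 + bform n ?S (?y x) (?y x)"
        unfolding sq by (simp add: algebra_simps)
      then show ?thesis by (simp add: mult_exp_exp add_divide_distrib)
    qed
    then have "(\<integral>\<^sup>+t. ennreal (exp (- bform (Suc n) A (?y (x(n := t))) (?y (x(n := t))) / 2)) \<partial>lborel) =
      (\<integral>\<^sup>+t. ennreal (exp (- bform n ?S (?y x) (?y x) / 2)) * ennreal (exp (- (?c * (t - (a n - ?l x))\<^sup>2) / 2)) \<partial>lborel)"
      by (simp add: ennreal_mult')
    also have "\<dots> = ennreal (exp (- bform n ?S (?y x) (?y x) / 2)) * ennreal (sqrt (2 * pi / ?c))"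
      unfolding nn_integral_gaussian_line[OF c, of "a n - ?l x", symmetric]
      by (rule nn_integral_cmult) measurable
    finally show "(\<integral>\<^sup>+t. ennreal (exp (- bform (Suc n) A (?y (x(n := t))) (?y (x(n := t))) / 2)) \<partial>lborel) =
      ennreal (exp (- bform n ?S (?y x) (?y x) / 2)) * ennreal (sqrt (2 * pi / ?c))" .
  qed
  also have "\<dots> = ennreal (sqrt ((2 * pi) ^ n / Determinant.det ?S)) * ennreal (sqrt (2 * pi / ?c))"
    unfolding IH[THEN conjunct2, symmetric] by (rule nn_integral_multc) measurable
  also have "\<dots> = ennreal (sqrt ((2 * pi) ^ Suc n / Determinant.det A))"
    using IH c by (simp add: ennreal_mult'[symmetric] real_sqrt_mult[symmetric] det mult.commute)
  finally show ?case using IH c det by simp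
qed

section \<open>The normal law as a mixture of isotropic normal laws\<close>

lemma prod_normal_density:
  assumes "0 < t"
  shows "(\<Prod>j<d. normal_density (u j) t (z j)) =
    exp (- (\<Sum>j<d. (z j - u j)\<^sup>2) / (2 * t\<^sup>2)) / (t * sqrt (2 * pi)) ^ d"
proof -
  have "normal_density (u j) t (z j) = exp (- ((z j - u j)\<^sup>2 / (2 * t\<^sup>2))) / (t * sqrt (2 * pi))" for j
    using assms by (simp add: normal_density_def real_sqrt_mult)
  then have "(\<Prod>j<d. normal_density (u j) t (z j)) =
    exp (- (\<Sum>j<d. (z j - u j)\<^sup>2 / (2 * t\<^sup>2))) / (t * sqrt (2 * pi)) ^ d"
    by (simp add: prod_dividef exp_sum flip: sum_negf)
  then show ?thesis by (simp add: sum_divide_distrib)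
qed

text \<open>
  Completing the square in \<open>u\<close> for the joint density of a centre \<open>u\<close> and \<open>z = u + t g\<close> with \<open>g\<close>
  standard normal. On the left, the exponents of the law of \<open>u\<close> given \<open>z\<close>, centred at \<open>m\<close>, and of
  the law of \<open>z\<close>; on the right, those of the law of \<open>u\<close> and of the law of \<open>z\<close> given \<open>u\<close>.
\<close>
lemma bform_split_gaussian:
  fixes M N P :: "real mat"
  assumes M: "M \<in> carrier_mat d d" "\<And>i j. i < d \<Longrightarrow> j < d \<Longrightarrow> M $$ (i, j) = M $$ (j, i)"
    and N: "N \<in> carrier_mat d d" "M * N = 1\<^sub>m d" and t: "t \<noteq> 0"
    and NP: "bform d N z z = t\<^sup>2 * (\<Sum>i<d. (z i)\<^sup>2) - t ^ 4 * bform d P z z"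
  defines "m \<equiv> \<lambda>i. (\<Sum>j<d. N $$ (i, j) * z j) / t\<^sup>2"
  shows "bform d M (\<lambda>i. u i - m i) (\<lambda>i. u i - m i) + bform d P z z =
    bform d M u u - (\<Sum>i<d. (u i)\<^sup>2) / t\<^sup>2 + (\<Sum>i<d. (z i - u i)\<^sup>2) / t\<^sup>2"
proof -
  have Mm: "(\<Sum>j<d. M $$ (i, j) * m j) = z i / t\<^sup>2" if i: "i < d" for i
  proof -
    have "(\<Sum>j<d. M $$ (i, j) * m j) = (\<Sum>j<d. \<Sum>k<d. M $$ (i, j) * N $$ (j, k) * z k) / t\<^sup>2"
      by (simp add: m_def sum_divide_distrib sum_distrib_left mult.assoc)
    also have "(\<Sum>j<d. \<Sum>k<d. M $$ (i, j) * N $$ (j, k) * z k) = (\<Sum>k<d. (\<Sum>j<d. M $$ (i, j) * N $$ (j, k)) * z k)"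
      by (subst sum.swap) (simp add: sum_distrib_right)
    also have "\<dots> = (\<Sum>k<d. (M * N) $$ (i, k) * z k)"
      using M(1) N(1) i by (intro sum.cong) (auto simp: scalar_prod_def atLeast0LessThan)
    also have "\<dots> = (\<Sum>k<d. (if k = i then z k else 0))" unfolding N(2) using i by (intro sum.cong) auto
    also have "\<dots> = z i" using i by simp
    finally show ?thesis .
  qed
  have um: "bform d M x m = (\<Sum>i<d. x i * z i) / t\<^sup>2" for x
  proof -
    have "bform d M x m = (\<Sum>i<d. x i * (\<Sum>j<d. M $$ (i, j) * m j))"
      by (simp add: bform_def sum_distrib_left ac_simps)
    also have "\<dots> = (\<Sum>i<d. x i * (z i / t\<^sup>2))" by (intro sum.cong) (auto simp: Mm)
    finally show ?thesis by (simp add: sum_divide_distrib)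
  qed
  have mu: "bform d M m x = bform d M x m" for x
    unfolding bform_def by (subst sum.swap) (intro sum.cong refl, use M(2) in auto)
  have mz: "(\<Sum>i<d. m i * z i) = bform d N z z / t\<^sup>2"
    by (simp add: m_def bform_def sum_divide_distrib sum_distrib_left sum_distrib_right ac_simps)
  have t4: "t ^ 4 * x / t\<^sup>2 = t\<^sup>2 * x" for x using t by (simp add: power4_eq_xxxx power2_eq_square)
  have "bform d M m m = ((\<Sum>i<d. (z i)\<^sup>2) - t\<^sup>2 * bform d P z z) / t\<^sup>2"
  proof -
    have "bform d M m m = (\<Sum>i<d. m i * z i) / t\<^sup>2" by (rule um)
    also have "(\<Sum>i<d. m i * z i) = bform d N z z / t\<^sup>2" by (rule mz)
    also have "bform d N z z / t\<^sup>2 = (\<Sum>i<d. (z i)\<^sup>2) - t\<^sup>2 * bform d P z z"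
      unfolding NP diff_divide_distrib t4 using t by simp
    finally show ?thesis .
  qed
  then have mm: "bform d M m m = (\<Sum>i<d. (z i)\<^sup>2) / t\<^sup>2 - bform d P z z"
    using t by (simp add: diff_divide_distrib)
  have "bform d M (\<lambda>i. u i - m i) (\<lambda>i. u i - m i) = bform d M u u - bform d M u m - bform d M m u + bform d M m m"
    by (simp add: bform_def algebra_simps sum.distrib sum_subtractf)
  also have "\<dots> = bform d M u u - 2 * (\<Sum>i<d. u i * z i) / t\<^sup>2 + (\<Sum>i<d. (z i)\<^sup>2) / t\<^sup>2 - bform d P z z"
    using mm um[of u] mu[of u] by simp
  also have "(\<Sum>i<d. (z i - u i)\<^sup>2) = (\<Sum>i<d. (z i)\<^sup>2) - 2 * (\<Sum>i<d. u i * z i) + (\<Sum>i<d. (u i)\<^sup>2)"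
    by (simp add: power2_diff sum.distrib sum_subtractf sum_distrib_left ac_simps)
  ultimately show ?thesis by (simp add: add_divide_distrib diff_divide_distrib)
qed

lemma mvn_density_eq_bform:
  assumes "S \<in> carrier_mat d d" "mat_inverse S = Some P" "P \<in> carrier_mat d d"
  shows "mvn_density S (Matrix.vec d z) = exp (- bform d P z z / 2) / sqrt ((2 * pi) ^ d * Determinant.det S)"
  using assms by (simp add: mvn_density_def scalar_prod_mult_mat_vec_eq_bform)

lemma nn_integral_mvn_density:
  assumes S: "symmetric_pos_def d S"
  shows "(\<integral>\<^sup>+z. ennreal (mvn_density S (Matrix.vec d z)) \<partial>lborel_on d) = 1"
proof -
  obtain P where P: "mat_inverse S = Some P" "S * P = 1\<^sub>m d" "symmetric_pos_def d P"
    using symmetric_pos_def_inverse[OF S] by blast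
  have car: "S \<in> carrier_mat d d" "P \<in> carrier_mat d d" using S P(3) by (auto simp: symmetric_pos_def_def)
  note GS = gaussian_integral[OF S, of "\<lambda>_. 0", THEN conjunct1] and GP = gaussian_integral[OF P(3), of "\<lambda>_. 0"]
  define Z where "Z = sqrt ((2 * pi) ^ d * Determinant.det S)"
  have Z: "0 < Z" using GS by (simp add: Z_def)
  have "Determinant.det S * Determinant.det P = 1" using det_mult[OF car] P(2) by simp
  then have "(2 * pi) ^ d / Determinant.det P = (2 * pi) ^ d * Determinant.det S" using GP by (simp add: field_simps)
  then have "(\<integral>\<^sup>+z. ennreal (exp (- bform d P z z / 2)) \<partial>lborel_on d) = ennreal Z"
    using GP unfolding Z_def by simp
  moreover have "ennreal (mvn_density S (Matrix.vec d z)) = ennreal (exp (- bform d P z z / 2)) * ennreal (1 / Z)" for z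
    unfolding mvn_density_eq_bform[OF car(1) P(1) car(2)] Z_def[symmetric]
    using Z by (subst ennreal_mult'[symmetric]) auto
  ultimately have "(\<integral>\<^sup>+z. ennreal (mvn_density S (Matrix.vec d z)) \<partial>lborel_on d) = ennreal Z * ennreal (1 / Z)"
    by (simp only:) (subst nn_integral_multc, measurable)
  then show ?thesis using Z by (simp add: ennreal_mult'[symmetric])
qed

lemma nn_integral_prod_normal_density:
  assumes "0 < t"
  shows "(\<integral>\<^sup>+z. (\<Prod>j<d. ennreal (normal_density (u j) t (z j))) \<partial>lborel_on d) = 1"
proof -
  have "(\<integral>\<^sup>+x. ennreal (normal_density (u j) t x) \<partial>lborel) = 1" for j
    using prob_space.emeasure_space_1[OF prob_space_normal_density[OF assms], of "u j"] by (simp add: emeasure_density)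
  then show ?thesis by (subst lborel_product.product_nn_integral_prod) auto
qed

text \<open>
  By \<open>bform_split_gaussian\<close> and \<open>gaussian_integral\<close> the integral over \<open>u\<close> reproduces the density,
  with \<open>q\<close> an exponential of a quadratic form. Its total mass is \<open>1\<close> because the isotropic
  densities and the mixture both have mass \<open>1\<close>.
\<close>
lemma mvn_density_mixture:
  assumes S: "symmetric_pos_def d S" and d: "0 < d" and t: "0 < t" "2 * t \<le> sigma_star S"
  shows "\<exists>q :: (nat \<Rightarrow> real) \<Rightarrow> ennreal. q \<in> borel_measurable (lborel_on d) \<and> (\<integral>\<^sup>+u. q u \<partial>lborel_on d) = 1 \<and>
    (\<forall>z. ennreal (mvn_density S (Matrix.vec d z)) =
      (\<integral>\<^sup>+u. q u * (\<Prod>j<d. ennreal (normal_density (u j) t (z j))) \<partial>lborel_on d))"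
proof -
  obtain P where P: "mat_inverse S = Some P" "S * P = 1\<^sub>m d" "symmetric_pos_def d P"
    using symmetric_pos_def_inverse[OF S] by blast
  have car: "S \<in> carrier_mat d d" "P \<in> carrier_mat d d" using S P(3) by (auto simp: symmetric_pos_def_def)
  have le: "4 * t\<^sup>2 * (x \<bullet> (P *\<^sub>v x)) \<le> x \<bullet> x" if x: "x \<in> carrier_vec d" for x
  proof -
    have "(2 * t)\<^sup>2 \<le> (sigma_star S)\<^sup>2" using t by (intro power_mono) auto
    then have "(2 * t)\<^sup>2 * (y \<bullet> y) \<le> y \<bullet> (S *\<^sub>v y)" if "y \<in> carrier_vec d" for y
      using sigma_star_properties(2)[OF S d that] scalar_prod_self_nonneg[of y]
      by (meson mult_right_mono order_trans)
    then have "(2 * t)\<^sup>2 * (x \<bullet> (P *\<^sub>v x)) \<le> x \<bullet> x"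
      using t by (intro quadratic_form_inverse_le[OF car P(2) _ _ x]) auto
    then show ?thesis by (simp add: power_mult_distrib)
  qed
  define N where "N = t\<^sup>2 \<cdot>\<^sub>m 1\<^sub>m d - t ^ 4 \<cdot>\<^sub>m P"
  have N: "symmetric_pos_def d N" "\<And>z. bform d N z z = t\<^sup>2 * (\<Sum>i<d. (z i)\<^sup>2) - t ^ 4 * bform d P z z"
    unfolding N_def using symmetric_pos_def_sub_inverse[OF P(3) t(1) le] by auto
  obtain M where M: "M * N = 1\<^sub>m d" "symmetric_pos_def d M" using symmetric_pos_def_inverse[OF N(1)] by blast
  have car': "M \<in> carrier_mat d d" "N \<in> carrier_mat d d" using M(2) N(1) by (auto simp: symmetric_pos_def_def)
  have Msym: "M $$ (i, j) = M $$ (j, i)" if "i < d" "j < d" for i j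
    using M(2) that unfolding symmetric_pos_def_iff_bform by blast
  define c where "c = sqrt ((2 * pi) ^ d / Determinant.det M)"
  define Z where "Z = sqrt ((2 * pi) ^ d * Determinant.det S)"
  have c: "0 < c" "\<And>a. (\<integral>\<^sup>+u. ennreal (exp (- bform d M (\<lambda>i. u i - a i) (\<lambda>i. u i - a i) / 2)) \<partial>lborel_on d) = ennreal c"
    using gaussian_integral[OF M(2)] by (auto simp: c_def)
  have Z: "0 < Z" using gaussian_integral[OF S] by (simp add: Z_def)
  define w where "w = (t * sqrt (2 * pi)) ^ d"
  have w: "0 < w" using t by (simp add: w_def)
  define q where "q u = ennreal (w / (Z * c) * exp (- (bform d M u u - (\<Sum>i<d. (u i)\<^sup>2) / t\<^sup>2) / 2))" for u
  have q_meas[measurable]: "q \<in> borel_measurable (lborel_on d)" unfolding q_def by measurable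
  have mix: "ennreal (mvn_density S (Matrix.vec d z)) =
      (\<integral>\<^sup>+u. q u * (\<Prod>j<d. ennreal (normal_density (u j) t (z j))) \<partial>lborel_on d)" for z
  proof -
    let ?m = "\<lambda>i. (\<Sum>j<d. N $$ (i, j) * z j) / t\<^sup>2"
    have "q u * (\<Prod>j<d. ennreal (normal_density (u j) t (z j))) =
      ennreal (exp (- bform d P z z / 2) / (Z * c)) * ennreal (exp (- bform d M (\<lambda>i. u i - ?m i) (\<lambda>i. u i - ?m i) / 2))" for u
    proof -
      have "bform d M (\<lambda>i. u i - ?m i) (\<lambda>i. u i - ?m i) + bform d P z z =
        bform d M u u - (\<Sum>i<d. (u i)\<^sup>2) / t\<^sup>2 + (\<Sum>i<d. (z i - u i)\<^sup>2) / t\<^sup>2"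
        by (rule bform_split_gaussian[OF car'(1) Msym car'(2) M(1) _ N(2)]) (use t in auto)
      then have e: "- (bform d M u u - (\<Sum>i<d. (u i)\<^sup>2) / t\<^sup>2) / 2 + - (\<Sum>j<d. (z j - u j)\<^sup>2) / (2 * t\<^sup>2) =
        - bform d P z z / 2 + - bform d M (\<lambda>i. u i - ?m i) (\<lambda>i. u i - ?m i) / 2"
        by (simp add: field_simps)
      have "w / (Z * c) * exp (- (bform d M u u - (\<Sum>i<d. (u i)\<^sup>2) / t\<^sup>2) / 2) * (\<Prod>j<d. normal_density (u j) t (z j))
        = 1 / (Z * c) * (exp (- (bform d M u u - (\<Sum>i<d. (u i)\<^sup>2) / t\<^sup>2) / 2) * exp (- (\<Sum>j<d. (z j - u j)\<^sup>2) / (2 * t\<^sup>2)))"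
        unfolding prod_normal_density[OF t(1)] w_def[symmetric] using w by simp
      also have "\<dots> = exp (- bform d P z z / 2) / (Z * c) * exp (- bform d M (\<lambda>i. u i - ?m i) (\<lambda>i. u i - ?m i) / 2)"
        unfolding exp_add[symmetric] e unfolding exp_add by simp
      finally show ?thesis unfolding q_def using w Z c(1)
        by (simp add: prod_ennreal ennreal_mult'[symmetric])
    qed
    then have "(\<integral>\<^sup>+u. q u * (\<Prod>j<d. ennreal (normal_density (u j) t (z j))) \<partial>lborel_on d) =
      ennreal (exp (- bform d P z z / 2) / (Z * c)) * ennreal c"
      unfolding c(2)[of ?m, symmetric] by (simp only:) (rule nn_integral_cmult, measurable)
    also have "\<dots> = ennreal (mvn_density S (Matrix.vec d z))"
      unfolding mvn_density_eq_bform[OF car(1) P(1) car(2)] Z_def[symmetric] using c(1) Z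
      by (simp add: ennreal_mult'[symmetric])
    finally show ?thesis by simp
  qed
  interpret L: sigma_finite_measure "lborel_on d" by (rule lborel_product.sigma_finite) simp
  interpret LL: pair_sigma_finite "lborel_on d" "lborel_on d" ..
  have nd[measurable]: "(\<lambda>(u, z). \<Prod>j<d. ennreal (normal_density (u j) t (z j))) \<in> borel_measurable (lborel_on d \<Otimes>\<^sub>M lborel_on d)"
    unfolding normal_density_def by measurable
  have "1 = (\<integral>\<^sup>+z. ennreal (mvn_density S (Matrix.vec d z)) \<partial>lborel_on d)"
    using nn_integral_mvn_density[OF S] by simp
  also have "\<dots> = (\<integral>\<^sup>+z. \<integral>\<^sup>+u. q u * (\<Prod>j<d. ennreal (normal_density (u j) t (z j))) \<partial>lborel_on d \<partial>lborel_on d)"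
    by (simp only: mix)
  also have "\<dots> = (\<integral>\<^sup>+u. \<integral>\<^sup>+z. q u * (\<Prod>j<d. ennreal (normal_density (u j) t (z j))) \<partial>lborel_on d \<partial>lborel_on d)"
    by (rule LL.Fubini') (measurable, simp add: normal_density_def)
  also have "\<dots> = (\<integral>\<^sup>+u. q u * 1 \<partial>lborel_on d)"
  proof (rule nn_integral_cong)
    fix u :: "nat \<Rightarrow> real"
    have m: "(\<lambda>z. \<Prod>j<d. ennreal (normal_density (u j) t (z j))) \<in> borel_measurable (lborel_on d)"
      by measurable
    show "(\<integral>\<^sup>+z. q u * (\<Prod>j<d. ennreal (normal_density (u j) t (z j))) \<partial>lborel_on d) = q u * 1"
      using nn_integral_cmult[OF m, of "q u"] nn_integral_prod_normal_density[OF t(1), where u = u and d = d] by simp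
  qed
  finally have "(\<integral>\<^sup>+u. q u \<partial>lborel_on d) = 1" by simp
  then show ?thesis using mix q_meas by blast
qed

section \<open>The smoothed rectangle as an integral of products\<close>

text \<open>
  The right-hand side is the probability that \<open>x \<le> t\<close> for \<open>t\<close> uniform on \<open>[0, 1 / \<phi>]\<close>. At \<open>x = 1 / \<phi>\<close> it
  is \<open>0\<close> because only a single \<open>t\<close> contributes.
\<close>
lemma gphi_layer_cake:
  assumes "0 < \<phi>"
  shows "ennreal (gphi \<phi> x) = (\<integral>\<^sup>+t. ennreal \<phi> * indicator {0..1 / \<phi>} t * of_bool (x \<le> ereal t) \<partial>lborel)"
proof -
  have len: "(\<integral>\<^sup>+t. ennreal \<phi> * indicator {r..1 / \<phi>} t \<partial>lborel) = ennreal (1 - \<phi> * r)" if "r \<le> 1 / \<phi>" for r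
    using that assms by (simp add: nn_integral_cmult ennreal_mult'[symmetric] algebra_simps)
  consider "x \<le> 0" | "0 < x" "x < ereal (1 / \<phi>)" | "ereal (1 / \<phi>) \<le> x" using not_le by blast
  then show ?thesis
  proof cases
    case 1
    have "(\<integral>\<^sup>+t. ennreal \<phi> * indicator {0..1 / \<phi>} t * of_bool (x \<le> ereal t) \<partial>lborel) =
      (\<integral>\<^sup>+t. ennreal \<phi> * indicator {0..1 / \<phi>} t \<partial>lborel)"
      using 1 by (intro nn_integral_cong) (auto simp: indicator_def intro: order_trans)
    then show ?thesis using 1 len[of 0] assms by (simp add: gphi_def)
  next
    case 2
    then obtain r where r: "x = ereal r" by (cases x) auto
    have "(\<integral>\<^sup>+t. ennreal \<phi> * indicator {0..1 / \<phi>} t * of_bool (x \<le> ereal t) \<partial>lborel) =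
      (\<integral>\<^sup>+t. ennreal \<phi> * indicator {r..1 / \<phi>} t \<partial>lborel)"
      using 2 r by (intro nn_integral_cong) (auto simp: indicator_def)
    then show ?thesis using 2 r len[of r] assms by (simp add: gphi_def)
  next
    case 3
    have "(\<integral>\<^sup>+t. ennreal \<phi> * indicator {0..1 / \<phi>} t * of_bool (x \<le> ereal t) \<partial>lborel) = integral\<^sup>N lborel (\<lambda>t::real. 0)"
    proof (rule nn_integral_cong_AE, rule eventually_mono[OF AE_lborel_singleton[of "1 / \<phi>"]])
      fix t assume elim: "t \<noteq> 1 / \<phi>"
      show "ennreal \<phi> * indicator {0..1 / \<phi>} t * of_bool (x \<le> ereal t) = 0"
      proof (cases "t \<in> {0..1 / \<phi>}")
        case True
        then have "ereal t < ereal (1 / \<phi>)" using elim by auto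
        then have "\<not> x \<le> ereal t" using 3 by (meson leD order_trans)
        then show ?thesis by simp
      qed simp
    qed
    moreover have "\<not> x \<le> 0"
    proof -
      have "0 < ereal (1 / \<phi>)" using assms by simp
      then show ?thesis using 3 by (meson leD order_less_le_trans)
    qed
    ultimately show ?thesis using 3 by (simp add: gphi_def)
  qed
qed

text \<open>
  If an upper end is \<open>- \<infinity>\<close> or a lower end is \<open>\<infinity>\<close>, the maximum in \<open>mrect\<close> is \<open>\<infinity>\<close> and the function
  vanishes identically.
\<close>
definition nondegenerate :: "nat \<Rightarrow> rectangle \<Rightarrow> bool" where
  "nondegenerate d A \<longleftrightarrow> (\<forall>j<d. snd A $ j \<noteq> -\<infinity> \<and> fst A $ j \<noteq> \<infinity>)"

text \<open>
  Membership of \<open>x\<close> in the \<open>j\<close>-th side of the rectangle, enlarged by \<open>t\<close> at its finite ends.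
\<close>
definition in_side :: "rectangle \<Rightarrow> nat \<Rightarrow> real \<Rightarrow> real \<Rightarrow> bool" where
  "in_side A j t x \<longleftrightarrow> (snd A $ j \<noteq> \<infinity> \<longrightarrow> x \<le> real_of_ereal (snd A $ j) + t) \<and>
     (fst A $ j \<noteq> -\<infinity> \<longrightarrow> real_of_ereal (fst A $ j) - t \<le> x)"

lemma excess_le_iff:
  assumes "b \<noteq> -\<infinity>" "a \<noteq> \<infinity>"
  shows "max (ereal x - b) (a - ereal x) \<le> ereal t \<longleftrightarrow>
    (b \<noteq> \<infinity> \<longrightarrow> x \<le> real_of_ereal b + t) \<and> (a \<noteq> -\<infinity> \<longrightarrow> real_of_ereal a - t \<le> x)"
  using assms by (cases b; cases a) auto

lemma mrect_layer_cake:
  assumes "0 < \<phi>" "0 < d" "w \<in> carrier_vec d" "nondegenerate d A"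
  shows "ennreal (mrect A \<phi> w) =
    (\<integral>\<^sup>+t. ennreal \<phi> * indicator {0..1 / \<phi>} t * (\<Prod>j<d. of_bool (in_side A j t (w $ j))) \<partial>lborel)"
proof -
  obtain a b where A: "A = (a, b)" by (cases A)
  let ?M = "Max ((\<lambda>j. max (ereal (w $ j) - b $ j) (a $ j - ereal (w $ j))) ` {..<d})"
  have "of_bool (?M \<le> ereal t) = (\<Prod>j<d. of_bool (in_side A j t (w $ j)) :: ennreal)" for t
  proof -
    have "?M \<le> ereal t \<longleftrightarrow> (\<forall>j<d. max (ereal (w $ j) - b $ j) (a $ j - ereal (w $ j)) \<le> ereal t)"
      using assms by (subst Max_le_iff) auto
    also have "\<dots> \<longleftrightarrow> (\<forall>j<d. in_side A j t (w $ j))"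
    proof -
      have "max (ereal (w $ j) - b $ j) (a $ j - ereal (w $ j)) \<le> ereal t \<longleftrightarrow> in_side A j t (w $ j)" if "j < d" for j
        using assms(4) that unfolding A nondegenerate_def in_side_def fst_conv snd_conv
        by (intro excess_le_iff) auto
      then show ?thesis by blast
    qed
    finally show ?thesis by (cases "\<forall>j<d. in_side A j t (w $ j)") (auto intro!: prod_zero[symmetric])
  qed
  then show ?thesis using assms gphi_layer_cake[of \<phi> ?M] by (simp add: A mrect_def)
qed

lemma mrect_degenerate:
  assumes "0 < \<phi>" "w \<in> carrier_vec d" "\<not> nondegenerate d A"
  shows "mrect A \<phi> w = 0"
proof -
  obtain a b where A: "A = (a, b)" by (cases A)
  let ?f = "\<lambda>j. max (ereal (w $ j) - b $ j) (a $ j - ereal (w $ j))"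
  from assms(3) obtain j where j: "j < d" "b $ j = -\<infinity> \<or> a $ j = \<infinity>" by (auto simp: nondegenerate_def A)
  then have "?f j = \<infinity>" by (auto simp: max_def)
  moreover have "?f j \<le> Max (?f ` {..<d})"
    by (rule Max_ge) (use j(1) in \<open>auto intro: imageI\<close>)
  ultimately have "Max (?f ` {..<d}) = \<infinity>" by (simp only: ereal_infty_less_eq(1))
  then show ?thesis using assms by (simp add: A mrect_def gphi_def)
qed

lemma partial_derivs_const_0:
  assumes "\<And>w. w \<in> carrier_vec d \<Longrightarrow> f w = 0"
  shows "w \<in> carrier_vec d \<Longrightarrow> partial_derivs js f w = 0"
proof (induction js arbitrary: w)
  case Nil
  then show ?case using assms by simp
next
  case (Cons j js)
  have "partial_derivs js f (w + t \<cdot>\<^sub>v unit_vec (dim_vec w) j) = 0" for t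
    using Cons.prems by (intro Cons.IH) auto
  then show ?case by (simp add: partial_deriv_def)
qed

lemma box_rectangle:
  assumes "A \<in> rectangles d" "nondegenerate d A" "0 < s"
  shows "box d (\<lambda>j. snd A $ j \<noteq> \<infinity>) (\<lambda>j. fst A $ j \<noteq> -\<infinity>)
    (\<lambda>j. real_of_ereal (fst A $ j)) (\<lambda>j. real_of_ereal (snd A $ j)) s"
proof
  fix j assume "j < d" "snd A $ j \<noteq> \<infinity>" "fst A $ j \<noteq> -\<infinity>"
  then show "real_of_ereal (fst A $ j) \<le> real_of_ereal (snd A $ j)"
    using assms by (cases "fst A $ j"; cases "snd A $ j") (force simp: rectangles_def nondegenerate_def)+
qed fact

abbreviation side :: "rectangle \<Rightarrow> real \<Rightarrow> nat \<Rightarrow> nat \<Rightarrow> real \<Rightarrow> real \<Rightarrow> real" where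
  "side A s \<equiv> box.side_deriv (\<lambda>j. snd A $ j \<noteq> \<infinity>) (\<lambda>j. fst A $ j \<noteq> -\<infinity>)
    (\<lambda>j. real_of_ereal (fst A $ j)) (\<lambda>j. real_of_ereal (snd A $ j)) s"

lemma nn_integral_in_side:
  assumes A: "A \<in> rectangles d" "nondegenerate d A" and j: "j < d"
    and pos: "0 < \<epsilon>" "0 < \<tau>" "0 \<le> t"
  shows "(\<integral>\<^sup>+z. ennreal (normal_density u \<tau> z) * of_bool (in_side A j t (x + \<epsilon> * z)) \<partial>lborel)
    = ennreal (side A (\<epsilon> * \<tau>) 0 j t (x + \<epsilon> * u))"
proof -
  interpret box d "\<lambda>j. snd A $ j \<noteq> \<infinity>" "\<lambda>j. fst A $ j \<noteq> -\<infinity>"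
    "\<lambda>j. real_of_ereal (fst A $ j)" "\<lambda>j. real_of_ereal (snd A $ j)" "\<epsilon> * \<tau>"
    using A pos by (intro box_rectangle) auto
  let ?y = "x + \<epsilon> * u"
  have s: "0 < \<epsilon> * \<tau>" using pos by simp
  have iff: "in_side A j t (x + \<epsilon> * (u + \<tau> * z)) \<longleftrightarrow>
    (snd A $ j \<noteq> \<infinity> \<longrightarrow> z \<le> upper j t ?y) \<and> (fst A $ j \<noteq> -\<infinity> \<longrightarrow> - lower j t ?y \<le> z)" for z
  proof -
    have "z \<le> upper j t ?y \<longleftrightarrow> x + \<epsilon> * (u + \<tau> * z) \<le> real_of_ereal (snd A $ j) + t"
      unfolding upper_def pos_le_divide_eq[OF s] by (simp add: algebra_simps)
    moreover have "- lower j t ?y \<le> z \<longleftrightarrow> real_of_ereal (fst A $ j) - t \<le> x + \<epsilon> * (u + \<tau> * z)"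
      unfolding lower_def minus_divide_left pos_divide_le_eq[OF s] by (simp add: algebra_simps)
    ultimately show ?thesis by (simp add: in_side_def)
  qed
  have dens: "\<tau> * normal_density u \<tau> (u + \<tau> * z) = std_normal_density z" for z
    using pos by (simp add: normal_density_def real_sqrt_mult power_mult_distrib)
  have le: "- lower j t ?y \<le> upper j t ?y" if "snd A $ j \<noteq> \<infinity>" "fst A $ j \<noteq> -\<infinity>"
    unfolding upper_def lower_def minus_divide_left using ordered[OF j that] pos
    by (intro divide_right_mono) auto
  have "(\<integral>\<^sup>+z. ennreal (normal_density u \<tau> z) * of_bool (in_side A j t (x + \<epsilon> * z)) \<partial>lborel) =
    ennreal \<tau> * (\<integral>\<^sup>+z. ennreal (normal_density u \<tau> (u + \<tau> * z)) * of_bool (in_side A j t (x + \<epsilon> * (u + \<tau> * z))) \<partial>lborel)"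
    using pos by (subst nn_integral_real_affine[where c = \<tau> and t = u]) (auto simp: in_side_def)
  also have "\<dots> = (\<integral>\<^sup>+z. ennreal (std_normal_density z) * of_bool (in_side A j t (x + \<epsilon> * (u + \<tau> * z))) \<partial>lborel)"
    unfolding dens[symmetric] using pos
    by (subst nn_integral_cmult[symmetric]) (auto simp: in_side_def ennreal_mult' mult.assoc)
  also have "\<dots> = ennreal (side_deriv 0 j t ?y)"
    unfolding iff by (subst std_normal_mass_interval) (auto simp: le side_deriv_def)
  finally show ?thesis .
qed

text \<open>
  The uniform law on \<open>[0, 1 / \<phi>]\<close>.
\<close>
definition ramp :: "real \<Rightarrow> real measure" where
  "ramp \<phi> = density lborel (\<lambda>t. ennreal \<phi> * indicator {0..1 / \<phi>} t)"

lemma sets_ramp[measurable_cong, simp]: "sets (ramp \<phi>) = sets borel"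
  by (simp add: ramp_def)

lemma prob_space_ramp: "0 < \<phi> \<Longrightarrow> prob_space (ramp \<phi>)"
  by (rule prob_spaceI) (simp add: ramp_def emeasure_density nn_integral_cmult ennreal_mult'[symmetric])

lemma AE_ramp_nonneg: "AE t in ramp \<phi>. 0 \<le> t"
  unfolding ramp_def by (subst AE_density) (auto simp: indicator_def)

lemma measurable_pred_in_side[measurable (raw)]:
  assumes [measurable]: "f \<in> borel_measurable M" "g \<in> borel_measurable M"
  shows "Measurable.pred M (\<lambda>\<omega>. in_side A j (f \<omega>) (g \<omega>))"
  unfolding in_side_def by measurable

lemma borel_measurable_side[measurable (raw)]:
  assumes A: "A \<in> rectangles d" "nondegenerate d A" "0 < s"
    and [measurable]: "f \<in> borel_measurable M" "g \<in> borel_measurable M"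
  shows "(\<lambda>\<omega>. side A s k j (f \<omega>) (g \<omega>)) \<in> borel_measurable M"
proof -
  interpret box d "\<lambda>j. snd A $ j \<noteq> \<infinity>" "\<lambda>j. fst A $ j \<noteq> -\<infinity>"
    "\<lambda>j. real_of_ereal (fst A $ j)" "\<lambda>j. real_of_ereal (snd A $ j)" s
    using A by (rule box_rectangle)
  show ?thesis unfolding side_deriv_def upper_def lower_def by measurable
qed

lemma gphi_nonneg: "0 < \<phi> \<Longrightarrow> 0 \<le> gphi \<phi> x"
  by (cases x) (auto simp: gphi_def field_simps)

text \<open>
  Insert the mixture for the density and the layer-cake formula for \<open>mrect\<close>, integrate over \<open>z\<close>
  first by Tonelli, and use that for fixed \<open>u\<close> and \<open>t\<close> the integrand is a product over the
  coordinates.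
\<close>
lemma nn_integral_mrect_mvn:
  assumes A: "A \<in> rectangles d" "nondegenerate d A" and S: "S \<in> carrier_mat d d" and d: "0 < d"
    and pos: "0 < \<phi>" "0 < \<epsilon>" "0 < \<tau>"
    and q[measurable]: "q \<in> borel_measurable (lborel_on d)"
    and mix: "\<And>z. ennreal (mvn_density S (Matrix.vec d z)) =
      (\<integral>\<^sup>+u. q u * (\<Prod>j<d. ennreal (normal_density (u j) \<tau> (z j))) \<partial>lborel_on d)"
    and w: "w \<in> carrier_vec d"
  shows "(\<lambda>z. mrect A \<phi> (w + \<epsilon> \<cdot>\<^sub>v Matrix.vec d z)) \<in> borel_measurable (mvn S)"
    and "(\<integral>\<^sup>+z. ennreal (mrect A \<phi> (w + \<epsilon> \<cdot>\<^sub>v Matrix.vec d z)) \<partial>mvn S) =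
      (\<integral>\<^sup>+u. \<integral>\<^sup>+t. (\<Prod>j<d. ennreal (side A (\<epsilon> * \<tau>) 0 j t (w $ j + \<epsilon> * u j))) \<partial>ramp \<phi> \<partial>density (lborel_on d) q)"
proof -
  interpret L: sigma_finite_measure "lborel_on d" by (rule lborel_product.sigma_finite) simp
  interpret LL: pair_sigma_finite "lborel_on d" "lborel_on d" ..
  interpret Lt: pair_sigma_finite "lborel_on d" "lborel :: real measure" ..
  define H :: "(nat \<Rightarrow> real) \<Rightarrow> real \<Rightarrow> ennreal" where
    "H z t = (\<Prod>j<d. of_bool (in_side A j t (w $ j + \<epsilon> * z j)))" for z t
  define r :: "real \<Rightarrow> ennreal" where "r t = ennreal \<phi> * indicator {0..1 / \<phi>} t" for t
  define N :: "(nat \<Rightarrow> real) \<Rightarrow> (nat \<Rightarrow> real) \<Rightarrow> ennreal" where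
    "N u z = (\<Prod>j<d. ennreal (normal_density (u j) \<tau> (z j)))" for u z
  have [measurable]: "r \<in> borel_measurable borel" unfolding r_def by measurable
  have H_meas[measurable]: "(\<lambda>(z, t). H z t) \<in> borel_measurable (lborel_on d \<Otimes>\<^sub>M borel)"
    unfolding H_def of_bool_def by measurable
  have N_meas[measurable]: "(\<lambda>(u, z). N u z) \<in> borel_measurable (lborel_on d \<Otimes>\<^sub>M lborel_on d)"
    unfolding N_def normal_density_def by measurable
  define X where "X z = (\<integral>\<^sup>+t. r t * H z t \<partial>lborel)" for z
  have X_meas[measurable]: "X \<in> borel_measurable (lborel_on d)" unfolding X_def by measurable
  have mrect: "ennreal (mrect A \<phi> (w + \<epsilon> \<cdot>\<^sub>v Matrix.vec d z)) = X z" for z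
    using mrect_layer_cake[OF pos(1) d _ A(2), of "w + \<epsilon> \<cdot>\<^sub>v Matrix.vec d z"] w
    by (simp add: X_def r_def H_def)
  have nn: "0 \<le> mrect A \<phi> x" for x
    using gphi_nonneg[OF pos(1)] by (simp add: mrect_def split: prod.split)
  have eq: "mrect A \<phi> (w + \<epsilon> \<cdot>\<^sub>v Matrix.vec d z) = enn2real (X z)" for z
    unfolding mrect[symmetric] using nn by simp
  show "(\<lambda>z. mrect A \<phi> (w + \<epsilon> \<cdot>\<^sub>v Matrix.vec d z)) \<in> borel_measurable (mvn S)"
    unfolding eq mvn_def using S by simp
  have dens: "(\<lambda>z. ennreal (mvn_density S (Matrix.vec d z))) \<in> borel_measurable (lborel_on d)"
    unfolding mix N_def[symmetric] by measurable
  have "(\<integral>\<^sup>+z. ennreal (mrect A \<phi> (w + \<epsilon> \<cdot>\<^sub>v Matrix.vec d z)) \<partial>mvn S) =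
     (\<integral>\<^sup>+z. (\<integral>\<^sup>+u. q u * N u z \<partial>lborel_on d) * X z \<partial>lborel_on d)"
    unfolding mvn_def mrect using S dens by (simp add: nn_integral_density mix flip: N_def)
  also have "\<dots> = (\<integral>\<^sup>+z. \<integral>\<^sup>+u. q u * N u z * X z \<partial>lborel_on d \<partial>lborel_on d)"
    by (intro nn_integral_cong nn_integral_multc[symmetric]) measurable
  also have "\<dots> = (\<integral>\<^sup>+u. \<integral>\<^sup>+z. q u * N u z * X z \<partial>lborel_on d \<partial>lborel_on d)"
    by (rule LL.Fubini') measurable
  also have "\<dots> = (\<integral>\<^sup>+u. q u * (\<integral>\<^sup>+t. (\<Prod>j<d. ennreal (side A (\<epsilon> * \<tau>) 0 j t (w $ j + \<epsilon> * u j))) \<partial>ramp \<phi>) \<partial>lborel_on d)"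
  proof (rule nn_integral_cong)
    fix u assume [measurable]: "u \<in> space (lborel_on d)"
    have NX: "N u z * X z = (\<integral>\<^sup>+t. N u z * (r t * H z t) \<partial>lborel)" if "z \<in> space (lborel_on d)" for z
      unfolding X_def using that by (intro nn_integral_cmult[symmetric]) measurable
    have "(\<integral>\<^sup>+z. q u * N u z * X z \<partial>lborel_on d) = q u * (\<integral>\<^sup>+z. N u z * X z \<partial>lborel_on d)"
      unfolding mult.assoc by (rule nn_integral_cmult) measurable
    also have "(\<integral>\<^sup>+z. N u z * X z \<partial>lborel_on d) = (\<integral>\<^sup>+z. \<integral>\<^sup>+t. N u z * (r t * H z t) \<partial>lborel \<partial>lborel_on d)"
      by (intro nn_integral_cong NX)
    also have "\<dots> = (\<integral>\<^sup>+t. \<integral>\<^sup>+z. N u z * (r t * H z t) \<partial>lborel_on d \<partial>lborel)"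
      by (rule Lt.Fubini'[symmetric]) measurable
    also have "\<dots> = (\<integral>\<^sup>+t. r t * (\<Prod>j<d. ennreal (side A (\<epsilon> * \<tau>) 0 j t (w $ j + \<epsilon> * u j))) \<partial>lborel)"
    proof (rule nn_integral_cong)
      fix t :: real
      have "(\<integral>\<^sup>+z. N u z * (r t * H z t) \<partial>lborel_on d) =
        (\<integral>\<^sup>+z. r t * (\<Prod>j<d. ennreal (normal_density (u j) \<tau> (z j)) * of_bool (in_side A j t (w $ j + \<epsilon> * z j))) \<partial>lborel_on d)"
        by (simp add: N_def H_def prod.distrib ac_simps)
      also have "\<dots> = r t * (\<integral>\<^sup>+z. (\<Prod>j<d. ennreal (normal_density (u j) \<tau> (z j)) * of_bool (in_side A j t (w $ j + \<epsilon> * z j))) \<partial>lborel_on d)"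
        by (rule nn_integral_cmult) (unfold of_bool_def, measurable)
      also have "(\<integral>\<^sup>+z. (\<Prod>j<d. ennreal (normal_density (u j) \<tau> (z j)) * of_bool (in_side A j t (w $ j + \<epsilon> * z j))) \<partial>lborel_on d) =
        (\<Prod>j<d. \<integral>\<^sup>+z. ennreal (normal_density (u j) \<tau> z) * of_bool (in_side A j t (w $ j + \<epsilon> * z)) \<partial>lborel)"
        by (rule lborel_product.product_nn_integral_prod[of "{..<d}" "\<lambda>j z. ennreal (normal_density (u j) \<tau> z) * of_bool (in_side A j t (w $ j + \<epsilon> * z))"])
           (auto simp: of_bool_def)
      also have "r t * \<dots> = r t * (\<Prod>j<d. ennreal (side A (\<epsilon> * \<tau>) 0 j t (w $ j + \<epsilon> * u j)))"
      proof (cases "0 \<le> t")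
        case True
        then show ?thesis using A pos by (simp add: nn_integral_in_side)
      qed (simp add: r_def)
      finally show "(\<integral>\<^sup>+z. N u z * (r t * H z t) \<partial>lborel_on d) = r t * (\<Prod>j<d. ennreal (side A (\<epsilon> * \<tau>) 0 j t (w $ j + \<epsilon> * u j)))" .
    qed
    also have "\<dots> = (\<integral>\<^sup>+t. (\<Prod>j<d. ennreal (side A (\<epsilon> * \<tau>) 0 j t (w $ j + \<epsilon> * u j))) \<partial>ramp \<phi>)"
      unfolding ramp_def r_def[symmetric] 
      by (rule nn_integral_density[symmetric])
         (use A pos in \<open>auto intro!: borel_measurable_prod_ennreal measurable_compose[OF _ measurable_ennreal] borel_measurable_side\<close>)
    finally show "(\<integral>\<^sup>+z. q u * N u z * X z \<partial>lborel_on d) = q u * (\<integral>\<^sup>+t. (\<Prod>j<d. ennreal (side A (\<epsilon> * \<tau>) 0 j t (w $ j + \<epsilon> * u j))) \<partial>ramp \<phi>)" .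
  qed
  also have "\<dots> = (\<integral>\<^sup>+u. \<integral>\<^sup>+t. (\<Prod>j<d. ennreal (side A (\<epsilon> * \<tau>) 0 j t (w $ j + \<epsilon> * u j))) \<partial>ramp \<phi> \<partial>density (lborel_on d) q)"
  proof (rule nn_integral_density[symmetric, OF q])
    interpret R: prob_space "ramp \<phi>" by (rule prob_space_ramp) fact
    have "(\<lambda>(u, t). \<Prod>j<d. ennreal (side A (\<epsilon> * \<tau>) 0 j t (w $ j + \<epsilon> * u j))) \<in> borel_measurable (lborel_on d \<Otimes>\<^sub>M ramp \<phi>)"
      unfolding case_prod_beta
      by (intro borel_measurable_prod_ennreal measurable_compose[OF _ measurable_ennreal] borel_measurable_side[OF A])
         (use pos in \<open>auto\<close>)
    then show "(\<lambda>u. \<integral>\<^sup>+t. (\<Prod>j<d. ennreal (side A (\<epsilon> * \<tau>) 0 j t (w $ j + \<epsilon> * u j))) \<partial>ramp \<phi>) \<in> borel_measurable (lborel_on d)"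
      by (rule R.borel_measurable_nn_integral)
  qed
  finally show "(\<integral>\<^sup>+z. ennreal (mrect A \<phi> (w + \<epsilon> \<cdot>\<^sub>v Matrix.vec d z)) \<partial>mvn S) =
      (\<integral>\<^sup>+u. \<integral>\<^sup>+t. (\<Prod>j<d. ennreal (side A (\<epsilon> * \<tau>) 0 j t (w $ j + \<epsilon> * u j))) \<partial>ramp \<phi> \<partial>density (lborel_on d) q)" .
qed

section \<open>The bound\<close>

lemma sup_ballD: "y \<in> sup_ball d r \<Longrightarrow> j < d \<Longrightarrow> \<bar>y $ j\<bar> \<le> r"
  unfolding sup_ball_def by (auto dest!: order_trans[OF Max_ge, rotated 2])

text \<open>
  \<open>D js\<close> is the integral of the bound of \<open>prod_side_deriv_le\<close>, with base point \<open>w + \<epsilon> u\<close> and mixture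
  variable \<open>u\<close>; it is the same for all shifts \<open>y\<close>. The integral over \<open>t\<close> is bounded
  uniformly in \<open>u\<close>, so the law of \<open>u\<close> enters through its total mass only.
\<close>
lemma partial_derivs_sum_bound:
  fixes A :: rectangle and S :: "real mat" and w :: "real Matrix.vec"
  assumes A: "A \<in> rectangles d" "nondegenerate d A" and S: "symmetric_pos_def d S" and d: "0 < d"
    and pos: "0 < \<phi>" "0 < \<epsilon>" "0 < \<tau>" "2 * \<tau> \<le> sigma_star S"
    and L: "1 \<le> L" "real d * exp (- L\<^sup>2) \<le> 1" and K: "0 \<le> K"
    and C: "\<And>k x h. k < Suc n \<Longrightarrow> \<bar>h\<bar> \<le> K / L \<Longrightarrow> \<bar>tail_deriv (Suc k) (x + h)\<bar> \<le> C * L ^ k * envelope L x"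
    and C1: "1 \<le> C" and w: "w \<in> carrier_vec d"
  defines "c \<equiv> shift_const K"
  shows "\<exists>D :: nat list \<Rightarrow> ennreal.
    (\<forall>js\<in>multi_indices d (Suc n). \<forall>y\<in>sup_ball d (\<epsilon> * \<tau> * K / L).
      ennreal \<bar>partial_derivs js (rho A \<phi> \<epsilon> S) (w + y)\<bar> \<le> D js) \<and>
    (\<Sum>js\<in>multi_indices d (Suc n). D js) \<le> ennreal (
       exp 2 * (exp 2 * C) ^ Suc n * ((real n + 2 * (4 * exp (3 / 2) + 2)) ^ n * (fact n * (2 / c) ^ n * exp (c / 2)))
       * (2 / c + 2 * sqrt (8 * pi)) * (\<phi> * L ^ n / (\<epsilon> * \<tau>) ^ n))"
proof -
  define s where "s = \<epsilon> * \<tau>"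
  have s: "0 < s" using pos by (simp add: s_def)
  interpret box d "\<lambda>j. snd A $ j \<noteq> \<infinity>" "\<lambda>j. fst A $ j \<noteq> -\<infinity>"
    "\<lambda>j. real_of_ereal (fst A $ j)" "\<lambda>j. real_of_ereal (snd A $ j)" s
    using A s by (rule box_rectangle)
  interpret box_scale d "\<lambda>j. snd A $ j \<noteq> \<infinity>" "\<lambda>j. fst A $ j \<noteq> -\<infinity>"
    "\<lambda>j. real_of_ereal (fst A $ j)" "\<lambda>j. real_of_ereal (snd A $ j)" s L K c
    by unfold_locales (use L K c_def in auto)
  have car: "S \<in> carrier_mat d d" using S by (simp add: symmetric_pos_def_def)
  obtain q where q[measurable]: "q \<in> borel_measurable (lborel_on d)" and q1: "(\<integral>\<^sup>+u. q u \<partial>lborel_on d) = 1"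
    and mix: "\<And>z. ennreal (mvn_density S (Matrix.vec d z)) =
      (\<integral>\<^sup>+u. q u * (\<Prod>j<d. ennreal (normal_density (u j) \<tau> (z j))) \<partial>lborel_on d)"
    using mvn_density_mixture[OF S d pos(3,4)] by blast
  define \<mu> where "\<mu> = density (lborel_on d) q"
  have sets_\<mu>[measurable_cong]: "sets \<mu> = sets (lborel_on d)" by (simp add: \<mu>_def)
  interpret \<mu>: prob_space \<mu>
    by (rule prob_spaceI) (simp add: \<mu>_def emeasure_density q1 cong: nn_integral_cong)
  interpret R: prob_space "ramp \<phi>" by (rule prob_space_ramp) fact
  interpret P: pair_prob_space \<mu> "ramp \<phi>" ..
  let ?M = "\<mu> \<Otimes>\<^sub>M ramp \<phi>"
  have coord[measurable]: "(\<lambda>\<omega>. fst \<omega> j) \<in> borel_measurable ?M" if "j < d" for j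
  proof -
    have "(\<lambda>u. u j) \<in> borel_measurable (lborel_on d)"
      using measurable_component_singleton[of j "{..<d}" "\<lambda>_. lborel :: real measure"] that by simp
    then have "(\<lambda>u. u j) \<in> borel_measurable \<mu>" by (simp only: measurable_cong_sets[OF sets_\<mu> refl])
    then show ?thesis by (rule measurable_compose[OF measurable_fst])
  qed
  have AE_nonneg: "AE \<omega> in ?M. 0 \<le> snd \<omega>"
  proof (rule P.AE_pair_measure)
    show "{\<omega> \<in> space ?M. 0 \<le> snd \<omega>} \<in> sets ?M" by measurable
    show "AE u in \<mu>. AE t in ramp \<phi>. 0 \<le> snd (u, t)" using AE_ramp_nonneg by simp
  qed
  define F where "F k j \<omega> x = side_deriv k j (snd \<omega>) (x + \<epsilon> * fst \<omega> j)" for k j and \<omega> :: "(nat \<Rightarrow> real) \<times> real" and x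
  have F_meas[measurable]: "(\<lambda>\<omega>. F k j \<omega> x) \<in> borel_measurable ?M" if "j < d" for k j x
    unfolding F_def using that by (intro borel_measurable_side[OF A s]) measurable
  have F_bound: "\<exists>B. \<forall>j<d. \<forall>\<omega>\<in>space ?M. \<forall>x. \<bar>F k j \<omega> x\<bar> \<le> B" for k
    using side_deriv_bounded[of k] unfolding F_def by blast
  have F_deriv: "(F k j \<omega> has_field_derivative F (Suc k) j \<omega> x) (at x)" for k j \<omega> x
    unfolding F_def by (rule DERIV_shift[THEN iffD1, OF DERIV_side_deriv])
  have rho: "rho A \<phi> \<epsilon> S x = (\<integral>\<omega>. (\<Prod>j<d. F 0 j \<omega> (x $ j)) \<partial>?M)" if x: "x \<in> carrier_vec d" for x
  proof -
    note mr = nn_integral_mrect_mvn[OF A car d pos(1-3) q mix x]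
    have nn: "AE z in mvn S. 0 \<le> mrect A \<phi> (x + \<epsilon> \<cdot>\<^sub>v Matrix.vec d z)"
      using gphi_nonneg[OF pos(1)] by (simp add: mrect_def split: prod.split)
    have "rho A \<phi> \<epsilon> S x = (\<integral>z. mrect A \<phi> (x + \<epsilon> \<cdot>\<^sub>v Matrix.vec d z) \<partial>mvn S)"
      using car by (simp add: rho_def)
    also have "\<dots> = enn2real (\<integral>\<^sup>+z. ennreal (mrect A \<phi> (x + \<epsilon> \<cdot>\<^sub>v Matrix.vec d z)) \<partial>mvn S)"
      by (rule integral_eq_nn_integral[OF mr(1) nn])
    also have "(\<integral>\<^sup>+z. ennreal (mrect A \<phi> (x + \<epsilon> \<cdot>\<^sub>v Matrix.vec d z)) \<partial>mvn S) =
      (\<integral>\<^sup>+u. \<integral>\<^sup>+t. (\<Prod>j<d. ennreal (F 0 j (u, t) (x $ j))) \<partial>ramp \<phi> \<partial>\<mu>)"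
      unfolding mr(2) \<mu>_def F_def s_def by simp
    also have "\<dots> = (\<integral>\<^sup>+\<omega>. (\<Prod>j<d. ennreal (F 0 j \<omega> (x $ j))) \<partial>?M)"
      by (rule R.nn_integral_fst) measurable
    also have "\<dots> = (\<integral>\<^sup>+\<omega>. ennreal (\<Prod>j<d. F 0 j \<omega> (x $ j)) \<partial>?M)"
    proof (rule nn_integral_cong_AE[OF eventually_mono[OF AE_nonneg]])
      fix \<omega> :: "(nat \<Rightarrow> real) \<times> real" assume "0 \<le> snd \<omega>"
      then show "(\<Prod>j<d. ennreal (F 0 j \<omega> (x $ j))) = ennreal (\<Prod>j<d. F 0 j \<omega> (x $ j))"
        unfolding F_def by (intro prod_ennreal side_deriv_0_nonneg) auto
    qed
    also have "enn2real \<dots> = (\<integral>\<omega>. (\<Prod>j<d. F 0 j \<omega> (x $ j)) \<partial>?M)"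
    proof (rule integral_eq_nn_integral[symmetric])
      show "AE \<omega> in ?M. 0 \<le> (\<Prod>j<d. F 0 j \<omega> (x $ j))"
        using AE_nonneg by eventually_elim (auto simp: F_def intro!: prod_nonneg side_deriv_0_nonneg)
    qed measurable
    finally show ?thesis .
  qed
  note derivs = P.partial_derivs_integral_prod[OF F_deriv F_bound F_meas rho]
  define X where "X u = (\<lambda>j. w $ j + \<epsilon> * u j)" for u :: "nat \<Rightarrow> real"
  let ?a1 = "exp 2 * (exp 2 * C) ^ Suc n * (1 / s) ^ Suc n"
  let ?a2 = "(real n + 2 * (4 * exp (3 / 2) + 2)) ^ n * (fact n * (2 / c) ^ n * exp (c / 2)) * L ^ n"
  define W where "W t u js = ?a1 * exp (- c * mass t (X u)) * weight L (\<lambda>j. ends_sum (envelope L) j t (X u j)) js" for t u js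
  have a1: "0 \<le> ?a1" using s C1 by simp
  have a2: "0 \<le> ?a2" using L c_pos by (auto intro!: mult_nonneg_nonneg zero_le_power add_nonneg_nonneg)
  have W0: "0 \<le> W t u js" for t u js unfolding W_def
    by (rule mult_nonneg_nonneg[OF mult_nonneg_nonneg[OF a1 exp_ge_zero] weight_nonneg])
       (use L in \<open>auto intro: ends_sum_nonneg envelope_nonneg\<close>)
  have ends_sum_meas: "(\<lambda>\<omega>. ends_sum f j (snd \<omega>) (X (fst \<omega>) j)) \<in> borel_measurable ?M"
    if [measurable]: "f \<in> borel_measurable borel" and "j < d" for f j
    unfolding ends_sum_def upper_def lower_def X_def using that(2) by measurable
  have \<Psi>_meas[measurable]: "\<Psi> \<in> borel_measurable borel"
    using borel_measurable_tail_deriv[of 0] by (simp add: fun_eq_iff[of "tail_deriv 0" \<Psi>, THEN iffD2])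
  have envelope_meas[measurable]: "envelope L \<in> borel_measurable borel" unfolding envelope_def[abs_def] by measurable
  have W_meas: "(\<lambda>\<omega>. W (snd \<omega>) (fst \<omega>) js) \<in> borel_measurable ?M" if "js \<in> multi_indices d (Suc n)" for js
    unfolding W_def weight_def mass_def using that
    by (intro borel_measurable_times borel_measurable_const borel_measurable_exp[THEN measurable_compose_rev]
      borel_measurable_sum borel_measurable_prod ends_sum_meas measurable_compose[OF _ borel_measurable_exp] \<Psi>_meas envelope_meas)
      (auto simp: multi_indices_def)
  define D where "D js = (\<integral>\<^sup>+\<omega>. ennreal (W (snd \<omega>) (fst \<omega>) js) \<partial>?M)" for js
  show ?thesis
  proof (intro exI[of _ D] conjI ballI)
    fix js y assume js: "js \<in> multi_indices d (Suc n)" and y: "y \<in> sup_ball d (\<epsilon> * \<tau> * K / L)"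
    have y': "\<bar>y $ j\<bar> \<le> s * K / L" if "j < d" for j using sup_ballD[OF y that] by (simp add: s_def)
    have yc: "y \<in> carrier_vec d" using y by (simp add: sup_ball_def)
    let ?G = "\<lambda>\<omega>. \<Prod>j<d. F (count_list js j) j \<omega> ((w + y) $ j)"
    have "partial_derivs js (rho A \<phi> \<epsilon> S) (w + y) = (\<integral>\<omega>. ?G \<omega> \<partial>?M)"
      using js w yc by (intro derivs) (auto simp: multi_indices_def)
    then have "ennreal \<bar>partial_derivs js (rho A \<phi> \<epsilon> S) (w + y)\<bar> = ennreal (norm (\<integral>\<omega>. ?G \<omega> \<partial>?M))" by simp
    also have "\<dots> \<le> (\<integral>\<^sup>+\<omega>. ennreal (norm (?G \<omega>)) \<partial>?M)"
    proof (cases "integrable ?M ?G")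
      case True
      then show ?thesis by (rule integral_norm_bound_ennreal)
    qed (simp add: not_integrable_integral_eq)
    also have "\<dots> \<le> D js" unfolding D_def
    proof (rule nn_integral_mono_AE, use AE_nonneg in eventually_elim)
      case (elim \<omega>)
      have "\<bar>\<Prod>j<d. side_deriv (count_list js j) j (snd \<omega>) (X (fst \<omega>) j + y $ j)\<bar> \<le> W (snd \<omega>) (fst \<omega>) js"
        unfolding W_def by (rule prod_side_deriv_le[OF C C1 elim js y'])
      moreover have "?G \<omega> = (\<Prod>j<d. side_deriv (count_list js j) j (snd \<omega>) (X (fst \<omega>) j + y $ j))"
        using w yc by (intro prod.cong) (auto simp: F_def X_def ac_simps)
      ultimately show ?case by (intro ennreal_leI) (simp only: real_norm_def)
    qed
    finally show "ennreal \<bar>partial_derivs js (rho A \<phi> \<epsilon> S) (w + y)\<bar> \<le> D js" .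
  next
    have "(\<Sum>js\<in>multi_indices d (Suc n). D js) = (\<integral>\<^sup>+\<omega>. (\<Sum>js\<in>multi_indices d (Suc n). ennreal (W (snd \<omega>) (fst \<omega>) js)) \<partial>?M)"
      unfolding D_def by (rule nn_integral_sum[symmetric]) (intro measurable_compose[OF W_meas measurable_ennreal])
    also have "\<dots> = (\<integral>\<^sup>+u. \<integral>\<^sup>+t. (\<Sum>js\<in>multi_indices d (Suc n). ennreal (W t u js)) \<partial>ramp \<phi> \<partial>\<mu>)"
      by (subst R.nn_integral_fst[symmetric])
         (auto intro!: borel_measurable_sum measurable_compose[OF W_meas measurable_ennreal])
    also have "\<dots> \<le> (\<integral>\<^sup>+u. ennreal (?a1 * ?a2 * \<phi> * (s * (1 / (c / 2) + 2 * sqrt (8 * pi)))) \<partial>\<mu>)"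
    proof (rule nn_integral_mono)
      fix u
      have [measurable]: "(\<lambda>t. total_envelope t (X u)) \<in> borel_measurable borel" "(\<lambda>t. mass t (X u)) \<in> borel_measurable borel"
        unfolding total_envelope_def mass_def by measurable
      have "(\<integral>\<^sup>+t. (\<Sum>js\<in>multi_indices d (Suc n). ennreal (W t u js)) \<partial>ramp \<phi>) \<le>
        (\<integral>\<^sup>+t. ennreal (?a1 * ?a2) * ennreal (total_envelope t (X u) * exp (- (c / 2) * mass t (X u))) \<partial>ramp \<phi>)"
      proof (rule nn_integral_mono)
        fix t
        have "(\<Sum>js\<in>multi_indices d (Suc n). W t u js) =
          ?a1 * (exp (- c * mass t (X u)) * (\<Sum>js\<in>multi_indices d (Suc n). weight L (\<lambda>j. ends_sum (envelope L) j t (X u j)) js))"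
          unfolding W_def by (simp add: sum_distrib_left mult.assoc)
        also have "\<dots> \<le> ?a1 * (?a2 * (total_envelope t (X u) * exp (- (c / 2) * mass t (X u))))"
          by (intro mult_left_mono a1 sum_weight_le_total_envelope)
        finally have "(\<Sum>js\<in>multi_indices d (Suc n). W t u js) \<le> (?a1 * ?a2) * (total_envelope t (X u) * exp (- (c / 2) * mass t (X u)))"
          by (simp only: mult.assoc)
        then have "ennreal (\<Sum>js\<in>multi_indices d (Suc n). W t u js) \<le> ennreal ((?a1 * ?a2) * (total_envelope t (X u) * exp (- (c / 2) * mass t (X u))))"
          by (rule ennreal_leI)
        also have "\<dots> = ennreal (?a1 * ?a2) * ennreal (total_envelope t (X u) * exp (- (c / 2) * mass t (X u)))"
          by (intro ennreal_mult mult_nonneg_nonneg[OF a1 a2] mult_nonneg_nonneg total_envelope_nonneg) simp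
        finally show "(\<Sum>js\<in>multi_indices d (Suc n). ennreal (W t u js)) \<le>
          ennreal (?a1 * ?a2) * ennreal (total_envelope t (X u) * exp (- (c / 2) * mass t (X u)))"
          using W0 by (simp add: sum_ennreal)
      qed
      also have "\<dots> = (\<integral>\<^sup>+t. ennreal \<phi> * indicator {0..1 / \<phi>} t * (ennreal (?a1 * ?a2) * ennreal (total_envelope t (X u) * exp (- (c / 2) * mass t (X u)))) \<partial>lborel)"
        unfolding ramp_def by (rule nn_integral_density) measurable
      also have "\<dots> = (\<integral>\<^sup>+t. ennreal (?a1 * ?a2) * ennreal \<phi> * (ennreal (total_envelope t (X u) * exp (- (c / 2) * mass t (X u))) * indicator {0..1 / \<phi>} t) \<partial>lborel)"
        by (simp only: ac_simps)
      also have "\<dots> = ennreal (?a1 * ?a2) * ennreal \<phi> * (\<integral>\<^sup>+t. ennreal (total_envelope t (X u) * exp (- (c / 2) * mass t (X u))) * indicator {0..1 / \<phi>} t \<partial>lborel)"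
        by (rule nn_integral_cmult) measurable
      also have "\<dots> \<le> ennreal (?a1 * ?a2) * ennreal \<phi> * ennreal (s * (1 / (c / 2) + 2 * sqrt (8 * pi)))"
        using c_pos pos by (intro mult_left_mono nn_integral_total_envelope_le) auto
      also have "\<dots> = ennreal (?a1 * ?a2 * \<phi> * (s * (1 / (c / 2) + 2 * sqrt (8 * pi))))"
        using mult_nonneg_nonneg[OF a1 a2] pos s c_pos by (simp only: ennreal_mult'[symmetric] mult_nonneg_nonneg less_imp_le)
      finally show "(\<integral>\<^sup>+t. (\<Sum>js\<in>multi_indices d (Suc n). ennreal (W t u js)) \<partial>ramp \<phi>) \<le> ennreal (?a1 * ?a2 * \<phi> * (s * (1 / (c / 2) + 2 * sqrt (8 * pi))))" .
    qed
    also have "\<dots> = ennreal (?a1 * ?a2 * \<phi> * (s * (1 / (c / 2) + 2 * sqrt (8 * pi))))"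
      by (simp only: nn_integral_const \<mu>.emeasure_space_1 mult_1_right)
    also have "?a1 * ?a2 * \<phi> * (s * (1 / (c / 2) + 2 * sqrt (8 * pi))) =
       exp 2 * (exp 2 * C) ^ Suc n * ((real n + 2 * (4 * exp (3 / 2) + 2)) ^ n * (fact n * (2 / c) ^ n * exp (c / 2)))
       * (2 / c + 2 * sqrt (8 * pi)) * (\<phi> * L ^ n / s ^ n)"
    proof -
      have "x * (1 / s) ^ Suc n * (y * L ^ n) * \<phi> * (s * z) = x * y * z * (\<phi> * L ^ n / s ^ n)" for x y z
        using s by (simp add: power_one_over field_simps)
      moreover have "1 / (c / 2) = 2 / c" by simp
      ultimately show ?thesis by (simp only:)
    qed
    finally show "(\<Sum>js\<in>multi_indices d (Suc n). D js) \<le> ennreal (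
       exp 2 * (exp 2 * C) ^ Suc n * ((real n + 2 * (4 * exp (3 / 2) + 2)) ^ n * (fact n * (2 / c) ^ n * exp (c / 2)))
       * (2 / c + 2 * sqrt (8 * pi)) * (\<phi> * L ^ n / (\<epsilon> * \<tau>) ^ n))" unfolding s_def .
  qed
qed

lemma sum_enn2ereal: "(\<Sum>i\<in>I. enn2ereal (f i)) = enn2ereal (\<Sum>i\<in>I. f i)"
  by (induction I rule: infinite_finite_induct) (auto simp: plus_ennreal.rep_eq zero_ennreal.rep_eq)

lemma rho_degenerate:
  assumes "S \<in> carrier_mat d d" "0 < \<phi>" "\<not> nondegenerate d A" "w \<in> carrier_vec d"
  shows "rho A \<phi> \<epsilon> S w = 0"
  using assms by (simp add: rho_def mrect_degenerate[where d = d])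

theorem lemma6p1:
  fixes v :: nat and K :: real
  assumes "v \<ge> 1" and "K > 0"
  shows "\<exists>C>0. \<forall>(d::nat) (\<phi>::real) (\<epsilon>::real) (S::real mat).
    d \<ge> 3 \<longrightarrow> \<phi> > 0 \<longrightarrow> 0 < \<epsilon> \<longrightarrow> \<epsilon> \<le> 1 \<longrightarrow>
    symmetric_pos_def d S \<longrightarrow> (\<forall>j<d. S $$ (j, j) = 1) \<longrightarrow>
    (let \<eta> = K / sqrt (ln (real d)) in
      (SUP A\<in>rectangles d. SUP w\<in>carrier_vec d.
         \<Sum>js\<in>multi_indices d v. SUP y\<in>sup_ball d (\<epsilon> * sigma_star S * \<eta>).
           ereal \<bar>partial_derivs js (rho A \<phi> \<epsilon> S) (w + y)\<bar>)
      \<le> ereal (C * (\<phi> * ln (real d) powr ((real v - 1) / 2)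
                    / (\<epsilon> * sigma_star S) ^ (v - 1))))"
proof -
  obtain n where v: "v = Suc n" using assms(1) by (cases v) auto
  have K: "0 \<le> 2 * K" using assms(2) by simp
  have "\<forall>k. \<exists>C\<ge>0. \<forall>L\<ge>1. \<forall>x h. \<bar>h\<bar> \<le> 2 * K / L \<longrightarrow> \<bar>tail_deriv (Suc k) (x + h)\<bar> \<le> C * L ^ k * envelope L x"
    using tail_deriv_le_envelope[OF K] by blast
  then obtain Ck where Ck: "\<And>k. 0 \<le> Ck k"
    "\<And>k L x h. 1 \<le> L \<Longrightarrow> \<bar>h\<bar> \<le> 2 * K / L \<Longrightarrow> \<bar>tail_deriv (Suc k) (x + h)\<bar> \<le> Ck k * L ^ k * envelope L x"
    by metis
  define C where "C = 1 + (\<Sum>k<Suc n. Ck k)"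
  have C1: "1 \<le> C" unfolding C_def using Ck(1) by (simp add: sum_nonneg)
  have C: "\<bar>tail_deriv (Suc k) (x + h)\<bar> \<le> C * L ^ k * envelope L x"
    if "k < Suc n" "1 \<le> L" "\<bar>h\<bar> \<le> 2 * K / L" for k L x h
  proof -
    have "Ck k \<le> (\<Sum>k<Suc n. Ck k)" using that Ck(1) by (intro member_le_sum) auto
    then have "Ck k * L ^ k * envelope L x \<le> C * L ^ k * envelope L x"
      using that unfolding C_def by (intro mult_right_mono envelope_nonneg) auto
    then show ?thesis using Ck(2)[OF that(2,3), of k x] by linarith
  qed
  define c where "c = shift_const (2 * K)"
  define B where "B = exp 2 * (exp 2 * C) ^ Suc n * ((real n + 2 * (4 * exp (3 / 2) + 2)) ^ n
    * (fact n * (2 / c) ^ n * exp (c / 2))) * (2 / c + 2 * sqrt (8 * pi))"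
  have "0 < c" by (simp add: c_def shift_const_def)
  then have "0 < B" unfolding B_def using C1
    by (intro mult_pos_pos zero_less_power add_pos_pos add_nonneg_pos divide_pos_pos) auto
  show ?thesis
  proof (intro exI[of _ "B * 2 ^ n"] conjI allI impI)
    show "0 < B * 2 ^ n" using \<open>0 < B\<close> by simp
    fix d :: nat and \<phi> \<epsilon> :: real and S :: "real mat"
    assume d: "3 \<le> d" and \<phi>: "0 < \<phi>" and \<epsilon>: "0 < \<epsilon>" and S: "symmetric_pos_def d S"
    define L where "L = sqrt (ln (real d))"
    have "exp 1 \<le> real d" using exp_le d by linarith
    then have ln1: "1 \<le> ln (real d)" using d by (subst ln_ge_iff) auto
    then have L1: "1 \<le> L" by (simp add: L_def)
    have dL: "real d * exp (- L\<^sup>2) \<le> 1" using ln1 d by (simp add: L_def exp_minus)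
    have sg: "0 < sigma_star S" using sigma_star_properties(1)[OF S] d by simp
    have Ln: "L ^ n = ln (real d) powr ((real v - 1) / 2)"
      using ln1 by (simp add: L_def v powr_half_sqrt[symmetric] powr_power)
    let ?R = "B * 2 ^ n * (\<phi> * ln (real d) powr ((real v - 1) / 2) / (\<epsilon> * sigma_star S) ^ (v - 1))"
    have R: "?R = B * (\<phi> * L ^ n / (\<epsilon> * (sigma_star S / 2)) ^ n)"
      unfolding Ln by (simp add: v power_divide)
    have R0: "0 \<le> ?R" unfolding R using \<open>0 < B\<close> \<phi> \<epsilon> sg L1 by auto
    \<comment> \<open>Halving \<open>sigma_star S\<close> doubles the admissible shift in units of the noise, hence \<open>2 * K\<close>.\<close>
    have rad: "\<epsilon> * sigma_star S * (K / sqrt (ln (real d))) = \<epsilon> * (sigma_star S / 2) * (2 * K) / L"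
      by (simp add: L_def)
    show "let \<eta> = K / sqrt (ln (real d)) in
      (SUP A\<in>rectangles d. SUP w\<in>carrier_vec d.
         \<Sum>js\<in>multi_indices d v. SUP y\<in>sup_ball d (\<epsilon> * sigma_star S * \<eta>).
           ereal \<bar>partial_derivs js (rho A \<phi> \<epsilon> S) (w + y)\<bar>) \<le> ereal ?R"
      unfolding Let_def rad
    proof (intro SUP_least)
      fix A :: rectangle and w :: "real Matrix.vec" assume A: "A \<in> rectangles d" and w: "w \<in> carrier_vec d"
      let ?Y = "sup_ball d (\<epsilon> * (sigma_star S / 2) * (2 * K) / L)"
      show "(\<Sum>js\<in>multi_indices d v. SUP y\<in>?Y. ereal \<bar>partial_derivs js (rho A \<phi> \<epsilon> S) (w + y)\<bar>) \<le> ereal ?R"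
      proof (cases "nondegenerate d A")
        case True
        have "\<exists>D :: nat list \<Rightarrow> ennreal. (\<forall>js\<in>multi_indices d (Suc n). \<forall>y\<in>?Y.
            ennreal \<bar>partial_derivs js (rho A \<phi> \<epsilon> S) (w + y)\<bar> \<le> D js) \<and>
          (\<Sum>js\<in>multi_indices d (Suc n). D js) \<le> ennreal (B * (\<phi> * L ^ n / (\<epsilon> * (sigma_star S / 2)) ^ n))"
          unfolding B_def c_def
          by (rule partial_derivs_sum_bound[OF A True S _ \<phi> \<epsilon> _ _ L1 dL K C[OF _ L1] C1 w]) (use sg d in auto)
        then obtain D :: "nat list \<Rightarrow> ennreal" where
          D: "\<forall>js\<in>multi_indices d (Suc n). \<forall>y\<in>?Y. ennreal \<bar>partial_derivs js (rho A \<phi> \<epsilon> S) (w + y)\<bar> \<le> D js"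
          and sD: "(\<Sum>js\<in>multi_indices d (Suc n). D js) \<le> ennreal (B * (\<phi> * L ^ n / (\<epsilon> * (sigma_star S / 2)) ^ n))"
          by (elim exE conjE)
        have "(\<Sum>js\<in>multi_indices d v. SUP y\<in>?Y. ereal \<bar>partial_derivs js (rho A \<phi> \<epsilon> S) (w + y)\<bar>)
          \<le> (\<Sum>js\<in>multi_indices d v. enn2ereal (D js))"
        proof (intro sum_mono SUP_least)
          fix js y assume "js \<in> multi_indices d v" "y \<in> ?Y"
          from D[rule_format, OF this[unfolded v]] show "ereal \<bar>partial_derivs js (rho A \<phi> \<epsilon> S) (w + y)\<bar> \<le> enn2ereal (D js)"
            unfolding less_eq_ennreal.rep_eq by (simp add: enn2ereal_ennreal)
        qed
        also have "\<dots> = enn2ereal (\<Sum>js\<in>multi_indices d v. D js)" by (rule sum_enn2ereal)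
        also have "\<dots> \<le> enn2ereal (ennreal ?R)" using sD unfolding v[symmetric] R[symmetric] less_eq_ennreal.rep_eq .
        also have "\<dots> = ereal ?R" using R0 by (rule enn2ereal_ennreal)
        finally show ?thesis .
      next
        case False
        have S': "S \<in> carrier_mat d d" using S by (simp add: symmetric_pos_def_def)
        have "(\<Sum>js\<in>multi_indices d v. SUP y\<in>?Y. ereal \<bar>partial_derivs js (rho A \<phi> \<epsilon> S) (w + y)\<bar>)
          \<le> (\<Sum>js\<in>multi_indices d v. 0)"
        proof (intro sum_mono SUP_least)
          fix js y assume "y \<in> ?Y"
          then have "w + y \<in> carrier_vec d" using w by (simp add: sup_ball_def)
          then have "partial_derivs js (rho A \<phi> \<epsilon> S) (w + y) = 0"
            by (intro partial_derivs_const_0[of d] rho_degenerate[OF S' \<phi> False])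
          then show "ereal \<bar>partial_derivs js (rho A \<phi> \<epsilon> S) (w + y)\<bar> \<le> 0" by simp
        qed
        also have "\<dots> \<le> ereal ?R" using R0 by simp
        finally show ?thesis .
      qed
    qed
  qed
qed

end
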